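(* For $1\le\rho<\infty$ and all indices $j,k,l\in\{1,\dots,d\}$: 1. $\|\partial_0^{e_j}\phi_1^\rho\|_{H^1}\lesssim\frac1{\rho^2}$ and $\partial_0^{e_j}\lambda_1^\rho=0$. 2. $\|\partial_0^{e_j+e_k}\phi_1^\rho\|_{H^1}\lesssim\frac1{\rho^2}$ and $\left|\partial_0^{e_j+e_k}\lambda_1^\rho-2\mathcal{M}_Y(e_j\cdot Ae_k)\right|\lesssim\frac1{\rho^2}$. 3. $\|\partial_0^{e_j+e_k+e_l}\phi_1^\rho\|_{H^1}\lesssim\frac1{\rho^2}$ and $\partial_0^{e_j+e_k+e_l}\lambda_1^\rho=0$. 4. $\|\partial_0^\beta\phi_1^\rho\|_{H^1}\lesssim1$ for all multiindices $\beta$ with $|\beta|\ge4$. 5. $|\partial_0^\beta\lambda_1^\rho|\lesssim\rho^2$ for $|\beta|=4$, and $|\partial_0^\beta\lambda_1^\rho|\lesssim1$ for $|\beta|>4$.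
   Context: $Y=[0,2\pi)^d$, $Y'=[-\frac12,\frac12)^d$. $A(y)$ is a $d\times d$ matrix with real, bounded, measurable entries on $\mathbb{R}^d$ that is symmetric, $Y$-periodic ($A(y+2\pi p)=A(y)$ for all $p\in\mathbb{Z}^d$, a.e. $y$), and elliptic: there is $\alpha>0$ with $A(y)\xi\cdot\xi\ge\alpha|\xi|^2$ for all $\xi\in\mathbb{R}^d$, a.e. $y$. $H^s_\sharp(Y)$ is the Sobolev space of $Y$-periodic functions, identified with $H^s$ of the torus $\mathbb{R}^d/2\pi\mathbb{Z}^d$; the $H^1$ norm is that of $H^1_\sharp(Y)$; $\mathcal{M}_Y(u)=\frac1{|Y|}\int_Yu\,dy$; $e_j$ is the $j$-th standard unit vector. For $\rho>0$, $\eta\in Y'$ let $\mathcal{A}^\rho(\eta)=\rho^2(\nabla+i\eta)^4-(\nabla+i\eta)\cdot A(y)(\nabla+i\eta)$, acting on $Y$-periodic functions and associated with the form $a^\rho[\eta](u,v)=\int_Y A(\nabla+i\eta)u\cdot\overline{(\nabla+i\eta)v}\,dy+\rho^2\int_Y(\nabla+i\eta)^2u\,\overline{(\nabla+i\eta)^2v}\,dy$ on $H^2_\sharp(Y)$, where $(\nabla+i\eta)^2u=\Delta u+2i\eta\cdot\nabla u-|\eta|^2u$. $\lambda_1^\rho(\eta)$ is its lowest eigenvalue in $L^2_\sharp(Y)$ and $\phi_1^\rho(\cdot;\eta)$ a corresponding eigenfunction. In a neighbourhood of $\eta=0$, $\lambda_1^\rho$ is analytic and $\phi_1^\rho(\cdot;\eta)$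 is chosen analytic in $\eta$ with values in $H^2_\sharp(Y)$ and normalized by $\mathcal{M}_Y(\phi_1^\rho(\cdot;\eta))=(2\pi)^{-d/2}$. For a multiindex $\beta$, $\partial_0^\beta$ denotes the derivative $\partial_{\eta_1}^{\beta_1}\cdots\partial_{\eta_d}^{\beta_d}$ with respect to $\eta$ evaluated at $\eta=0$, and $|\beta|=\beta_1+\dots+\beta_d$. The notation $X\lesssim Z$ means $X\le CZ$ with a constant $C$ independent of $\rho\in[1,\infty)$ (it may depend on $\beta$, $d$ and $A$). *)

theory Defs
  imports "HOL-Analysis.Analysis"
begin

section \<open>Multiindices and classical partial derivatives\<close>

text \<open>A multiindex is a vector of type \<^typ>\<open>nat ^ 'd\<close>; the unit multiindex is \<open>axis j 1\<close>.
  The linear order on the index type only serves to list the coordinates as in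
  \<open>\<partial>\<^sub>1 \<dots> \<partial>\<^sub>1 \<partial>\<^sub>2 \<dots> \<partial>\<^sub>d\<close>.\<close>

definition mi_size :: "nat ^ 'd \<Rightarrow> nat" where
  "mi_size \<beta> = (\<Sum>j\<in>UNIV. \<beta> $ j)"

definition mi_power :: "real ^ 'd \<Rightarrow> nat ^ 'd \<Rightarrow> real" where
  "mi_power x \<beta> = (\<Prod>j\<in>UNIV. x $ j ^ (\<beta> $ j))"

definition mi_list :: "nat ^ 'd::{finite,linorder} \<Rightarrow> 'd::{finite,linorder} list" where
  "mi_list \<beta> = concat (map (\<lambda>j. replicate (\<beta> $ j) j) (sorted_list_of_set UNIV))"

definition pd :: "'d \<Rightarrow> (real ^ 'd \<Rightarrow> 'a::real_normed_vector) \<Rightarrow> real ^ 'd \<Rightarrow> 'a" where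
  "pd j f x = vector_derivative (\<lambda>t. f (x + t *\<^sub>R axis j 1)) (at 0)"

definition mi_pd ::
  "nat ^ 'd::{finite,linorder} \<Rightarrow> (real ^ 'd::{finite,linorder} \<Rightarrow> 'a::real_normed_vector)
     \<Rightarrow> real ^ 'd::{finite,linorder} \<Rightarrow> 'a" where
  "mi_pd \<beta> f = foldr pd (mi_list \<beta>) f"

definition real_analytic_at :: "(real ^ 'd \<Rightarrow> real) \<Rightarrow> real ^ 'd \<Rightarrow> bool" where
  "real_analytic_at f x0 \<longleftrightarrow>
     (\<exists>c r. r > 0 \<and> (\<forall>x\<in>ball x0 r. ((\<lambda>\<beta>. c \<beta> * mi_power (x - x0) \<beta>) has_sum f x) UNIV))"

definition smooth :: "(real ^ 'd \<Rightarrow> complex) \<Rightarrow> bool" where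
  "smooth \<psi> \<longleftrightarrow> (\<forall>js x. foldr pd js \<psi> differentiable (at x))"


section \<open>Periodic functions and Sobolev spaces on the torus\<close>

text \<open>Functions stand for their classes modulo equality almost everywhere.\<close>

definition cell :: "(real ^ 'd) set" where
  "cell = {y. \<forall>i. 0 \<le> y $ i \<and> y $ i < 2 * pi}"

definition periodic :: "(real ^ 'd \<Rightarrow> 'a) \<Rightarrow> bool" where
  "periodic f \<longleftrightarrow>
     (\<forall>p. (\<forall>i. p $ i \<in> \<int>) \<longrightarrow> (AE y in lebesgue. f (y + (2 * pi) *\<^sub>R p) = f y))"

definition mean :: "(real ^ 'd \<Rightarrow> 'a::{banach,second_countable_topology}) \<Rightarrow> 'a" where
  "mean u = (1 / measure lebesgue (cell :: (real ^ 'd) set)) *\<^sub>R (LINT y|lebesgue_on cell. u y)"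

definition L2_per :: "(real ^ 'd \<Rightarrow> complex) set" where
  "L2_per = {u. u \<in> borel_measurable lebesgue \<and> periodic u \<and>
                integrable (lebesgue_on cell) (\<lambda>y. (cmod (u y))\<^sup>2)}"

definition L2_inner :: "(real ^ 'd \<Rightarrow> complex) \<Rightarrow> (real ^ 'd \<Rightarrow> complex) \<Rightarrow> complex" where
  "L2_inner u v = (LINT y|lebesgue_on cell. u y * cnj (v y))"

definition L2_norm :: "(real ^ 'd \<Rightarrow> complex) \<Rightarrow> real" where
  "L2_norm u = sqrt (LINT y|lebesgue_on cell. (cmod (u y))\<^sup>2)"

text \<open>Weak derivatives on the torus: the test functions are smooth and periodic, so that
  there is no boundary term and no jump across the faces of the cell is allowed.\<close>

definition is_weak_pd :: "'d \<Rightarrow> (real ^ 'd \<Rightarrow> complex) \<Rightarrow> (real ^ 'd \<Rightarrow> complex) \<Rightarrow> bool" where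
  "is_weak_pd j u g \<longleftrightarrow>
     (\<forall>\<psi>. smooth \<psi> \<and> periodic \<psi> \<longrightarrow>
        (LINT y|lebesgue_on cell. u y * pd j \<psi> y) = - (LINT y|lebesgue_on cell. g y * \<psi> y))"

definition weak_pd :: "'d \<Rightarrow> (real ^ 'd \<Rightarrow> complex) \<Rightarrow> real ^ 'd \<Rightarrow> complex" where
  "weak_pd j u = (SOME g. g \<in> L2_per \<and> is_weak_pd j u g)"

definition H1_per :: "(real ^ 'd \<Rightarrow> complex) set" where
  "H1_per = {u \<in> L2_per. \<forall>j. \<exists>g\<in>L2_per. is_weak_pd j u g}"

definition H2_per :: "(real ^ 'd \<Rightarrow> complex) set" where
  "H2_per = {u \<in> H1_per. \<forall>j. weak_pd j u \<in> H1_per}"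

definition H1_norm :: "(real ^ 'd \<Rightarrow> complex) \<Rightarrow> real" where
  "H1_norm u = sqrt ((L2_norm u)\<^sup>2 + (\<Sum>j\<in>UNIV. (L2_norm (weak_pd j u))\<^sup>2))"

definition H2_norm :: "(real ^ 'd \<Rightarrow> complex) \<Rightarrow> real" where
  "H2_norm u = sqrt ((L2_norm u)\<^sup>2 + (\<Sum>j\<in>UNIV. (L2_norm (weak_pd j u))\<^sup>2)
     + (\<Sum>j\<in>UNIV. \<Sum>k\<in>UNIV. (L2_norm (weak_pd j (weak_pd k u)))\<^sup>2))"


section \<open>Analyticity and derivatives of maps with values in \<open>H\<^sup>2\<close>\<close>

text \<open>In the next definitions all limits are limits in the norm of \<open>H\<^sup>2\<close>; the power series
  converges unconditionally, as for \<open>has_sum\<close>.\<close>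

definition H2_analytic_at ::
  "(real ^ 'd \<Rightarrow> real ^ 'd \<Rightarrow> complex) \<Rightarrow> real ^ 'd \<Rightarrow> bool" where
  "H2_analytic_at f x0 \<longleftrightarrow>
     (\<exists>c r. r > 0 \<and> (\<forall>\<beta>. c \<beta> \<in> H2_per) \<and>
        (\<forall>x\<in>ball x0 r. f x \<in> H2_per \<and>
           ((\<lambda>F. H2_norm (\<lambda>y. f x y - (\<Sum>\<beta>\<in>F. complex_of_real (mi_power (x - x0) \<beta>) * c \<beta> y)))
              \<longlongrightarrow> 0) (finite_subsets_at_top UNIV)))"

definition H2_pd ::
  "'d \<Rightarrow> (real ^ 'd \<Rightarrow> real ^ 'd \<Rightarrow> complex) \<Rightarrow> real ^ 'd \<Rightarrow> real ^ 'd \<Rightarrow> complex" where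
  "H2_pd j f x = (SOME g. g \<in> H2_per \<and>
     ((\<lambda>t. H2_norm (\<lambda>y. (f (x + t *\<^sub>R axis j 1) y - f x y) / complex_of_real t - g y))
        \<longlongrightarrow> 0) (at 0))"

definition mi_H2_pd ::
  "nat ^ 'd::{finite,linorder}
     \<Rightarrow> (real ^ 'd::{finite,linorder} \<Rightarrow> real ^ 'd::{finite,linorder} \<Rightarrow> complex)
     \<Rightarrow> real ^ 'd::{finite,linorder} \<Rightarrow> real ^ 'd::{finite,linorder} \<Rightarrow> complex" where
  "mi_H2_pd \<beta> f = foldr H2_pd (mi_list \<beta>) f"


section \<open>The shifted operator and its lowest eigenvalue\<close>

definition coefficient_matrix :: "(real ^ 'd \<Rightarrow> real ^ 'd ^ 'd) \<Rightarrow> bool" where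
  "coefficient_matrix A \<longleftrightarrow>
     (\<forall>i j. (\<lambda>y. A y $ i $ j) \<in> borel_measurable lebesgue) \<and>
     (\<exists>M. AE y in lebesgue. \<forall>i j. \<bar>A y $ i $ j\<bar> \<le> M) \<and>
     (AE y in lebesgue. transpose (A y) = A y) \<and>
     periodic A \<and>
     (\<exists>\<alpha>>0. AE y in lebesgue. \<forall>\<xi>. (A y *v \<xi>) \<bullet> \<xi> \<ge> \<alpha> * (norm \<xi>)\<^sup>2)"

text \<open>Component \<open>j\<close> of \<open>(\<nabla> + i\<eta>)u\<close>, and \<open>(\<nabla> + i\<eta>)\<^sup>2u\<close>.\<close>

definition shifted_grad ::
  "real ^ 'd \<Rightarrow> (real ^ 'd \<Rightarrow> complex) \<Rightarrow> 'd \<Rightarrow> real ^ 'd \<Rightarrow> complex" where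
  "shifted_grad \<eta> u j y = weak_pd j u y + \<i> * complex_of_real (\<eta> $ j) * u y"

definition shifted_lap :: "real ^ 'd \<Rightarrow> (real ^ 'd \<Rightarrow> complex) \<Rightarrow> real ^ 'd \<Rightarrow> complex" where
  "shifted_lap \<eta> u y = (\<Sum>j\<in>UNIV. weak_pd j (weak_pd j u) y)
     + 2 * \<i> * (\<Sum>j\<in>UNIV. complex_of_real (\<eta> $ j) * weak_pd j u y)
     - complex_of_real ((norm \<eta>)\<^sup>2) * u y"

definition bloch_form ::
  "(real ^ 'd \<Rightarrow> real ^ 'd ^ 'd) \<Rightarrow> real \<Rightarrow> real ^ 'd
     \<Rightarrow> (real ^ 'd \<Rightarrow> complex) \<Rightarrow> (real ^ 'd \<Rightarrow> complex) \<Rightarrow> complex" where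
  "bloch_form A \<rho> \<eta> u v =
     (LINT y|lebesgue_on cell. (\<Sum>j\<in>UNIV. \<Sum>k\<in>UNIV.
        complex_of_real (A y $ j $ k) * shifted_grad \<eta> u k y * cnj (shifted_grad \<eta> v j y)))
     + complex_of_real (\<rho>\<^sup>2) * (LINT y|lebesgue_on cell. shifted_lap \<eta> u y * cnj (shifted_lap \<eta> v y))"

definition eigenfunction ::
  "(real ^ 'd \<Rightarrow> real ^ 'd ^ 'd) \<Rightarrow> real \<Rightarrow> real ^ 'd \<Rightarrow> real \<Rightarrow> (real ^ 'd \<Rightarrow> complex) \<Rightarrow> bool" where
  "eigenfunction A \<rho> \<eta> \<mu> u \<longleftrightarrow>
     u \<in> H2_per \<and> \<not> (AE y in lebesgue. u y = 0) \<and>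
     (\<forall>v\<in>H2_per. bloch_form A \<rho> \<eta> u v = complex_of_real \<mu> * L2_inner u v)"

definition lambda1 :: "(real ^ 'd \<Rightarrow> real ^ 'd ^ 'd) \<Rightarrow> real \<Rightarrow> real ^ 'd \<Rightarrow> real" where
  "lambda1 A \<rho> \<eta> = (LEAST \<mu>. \<exists>u. eigenfunction A \<rho> \<eta> \<mu> u)"

text \<open>An analytic normalized choice of the first eigenfunction near \<open>\<eta> = 0\<close>; the neighbourhood
  may depend on \<open>\<rho>\<close>.\<close>

definition ground_branch ::
  "(real ^ 'd \<Rightarrow> real ^ 'd ^ 'd) \<Rightarrow> real \<Rightarrow> (real ^ 'd \<Rightarrow> real ^ 'd \<Rightarrow> complex) \<Rightarrow> bool" where
  "ground_branch A \<rho> \<phi> \<longleftrightarrow>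
     (\<exists>U. open U \<and> 0 \<in> U \<and>
        (\<forall>\<eta>\<in>U. real_analytic_at (lambda1 A \<rho>) \<eta> \<and> H2_analytic_at \<phi> \<eta> \<and>
           eigenfunction A \<rho> \<eta> (lambda1 A \<rho> \<eta>) (\<phi> \<eta>) \<and>
           mean (\<phi> \<eta>) = complex_of_real ((2 * pi) powr (- real CARD('d) / 2))))"

end

theory Submission
  imports Defs
begin

text \<open>
  Fix a direction \<open>\<xi>\<close> and follow the branch along the line \<open>\<eta> = t \<xi>\<close>. There
  \<open>\<phi>(t \<xi>) = \<Sum> t^m p_m\<close> and \<open>\<lambda>(t \<xi>) = \<Sum> t^m l_m\<close>, and the Bloch form is a polynomial
  \<open>\<Sum> t^i b_i\<close> of degree 4 in \<open>t\<close>. Comparing powers of \<open>t\<close> in the weak eigenvalue equation gives, for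
  every test function \<open>v\<close>, the recursion

    \<open>b_0(p_m, v) + b_1(p_{m-1}, v) + \<dots> + b_m(p_0, v) = l_0 \<langle>p_m, v\<rangle> + \<dots> + l_m \<langle>p_0, v\<rangle>\<close>.

  The function \<open>p_0\<close> has eigenvalue 0, hence zero energy, and is a constant \<open>e\<close>; the normalization of the
  mean gives \<open>p_m\<close> zero mean for \<open>m \<ge> 1\<close>. Three observations turn the recursion into bounds, by induction on \<open>m\<close>
  (\<open>coeff_bound_step\<close>).

  First, on functions of zero mean \<open>b_0(v, v) \<ge> \<rho>^2 |\<Delta> v|^2\<close> controls \<open>\<rho>^2\<close> times the square of the full
  \<open>H\<^sup>2\<close> norm; this is Parseval's identity and \<open>1 + |n|^2 + |n|^4 \<le> 3 |n|^4\<close> for \<open>n \<noteq> 0\<close>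
  (\<open>H2_norm_le_laplace\<close>). Second, the \<open>b_i\<close> are of size \<open>\<rho>^2\<close>, but \<open>b_i(e, v)\<close> and \<open>b_i(v, e)\<close> are
  bounded independently of \<open>\<rho>\<close> when \<open>v\<close> has zero mean: the part of \<open>b_i\<close> with the factor \<open>\<rho>^2\<close> then
  pairs a constant with \<open>\<Delta> v\<close>, \<open>\<xi> \<cdot> \<nabla> v\<close> or \<open>v\<close>, all of zero mean (\<open>lap_inner_const\<close>). Hence
  for \<open>m \<le> 3\<close> the test function \<open>p_m\<close> gives \<open>\<rho>^2 |p_m| \<lesssim> 1\<close>: the constant \<open>p_0\<close> enters without the
  factor \<open>\<rho>^2\<close> and the other coefficients are already of size \<open>\<rho>^{-2}\<close>. For \<open>m \<ge> 4\<close> the bound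
  \<open>\<rho>^2\<close> for every term on the right gives \<open>|p_m| \<lesssim> 1\<close>. Third, the test function \<open>e\<close> isolates \<open>l_m\<close>
  (\<open>eigenvalue_coeff\<close>), and the only contribution of size \<open>\<rho>^2\<close> is \<open>b_4(e, e)\<close>; so \<open>l_4 \<lesssim> \<rho>^2\<close>
  while the other \<open>l_m\<close> are bounded, and \<open>l_2\<close> is the mean of \<open>A \<xi> \<cdot> \<xi>\<close> up to \<open>b_1(p_1, e)\<close>, which
  is of size \<open>\<rho>^{-2}\<close>. The \<open>l_m\<close> with odd \<open>m\<close> vanish because complex conjugation maps eigenfunctions
  at \<open>\<eta>\<close> to eigenfunctions at \<open>-\<eta>\<close>, so that the first eigenvalue is even in \<open>\<eta>\<close>
  (\<open>lambda1_even\<close>).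

  To return to mixed derivatives, \<open>\<partial>_0^\<beta>\<close> is \<open>\<beta>!\<close> times the coefficient of \<open>\<eta>^\<beta>\<close>, and a coefficient of
  the homogeneous polynomial \<open>p_m\<close> in \<open>\<xi>\<close> is a linear combination of its values at finitely many
  \<open>\<xi>\<close> with weights depending on \<open>\<beta>\<close> only (\<open>coeff_from_homog_part\<close>). The calculus of \<open>H\<^sup>2\<close>-valued
  functions takes place in the type \<open>h2\<close> of classes modulo equality almost everywhere, a real inner
  product space whose norm is the \<open>H\<^sup>2\<close> norm. Partial derivatives exist there because the branch has a
  power series at every point of a neighbourhood of 0; termwise differentiation then identifies them
  (\<open>has_sum_partial\<close>).
\<close>

section \<open>Power series in several variables with values in a normed space\<close>

text \<open>Sums are unconditional, as in the two notions of analyticity to which this is applied: those of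
  the eigenvalue (real values) and of the eigenfunction (values in \<open>h2\<close>).\<close>

definition has_power_series ::
  "(nat ^ 'd \<Rightarrow> 'a::real_normed_vector) \<Rightarrow> (real ^ 'd \<Rightarrow> 'a) \<Rightarrow> real ^ 'd \<Rightarrow> bool" where
  "has_power_series c f x0 \<longleftrightarrow>
     (\<exists>r>0. \<forall>x\<in>ball x0 r. ((\<lambda>\<beta>. mi_power (x - x0) \<beta> *\<^sub>R c \<beta>) has_sum f x) UNIV)"

text \<open>The difference quotient is kept explicit because remainders of series are estimated termwise in
  it.\<close>

definition has_pd :: "'d \<Rightarrow> (real ^ 'd \<Rightarrow> 'a::real_normed_vector) \<Rightarrow> real ^ 'd \<Rightarrow> 'a \<Rightarrow> bool" where
  "has_pd j f x D \<longleftrightarrow> ((\<lambda>t. (1/t) *\<^sub>R (f (x + t *\<^sub>R axis j 1) - f x)) \<longlongrightarrow> D) (at 0)"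

text \<open>The partial derivative of the monomial with exponent \<open>\<beta>\<close> in direction
  \<open>j\<close>. If \<open>\<beta>\<close> vanishes at \<open>j\<close>, the factor in front makes up for
  the truncated subtraction.\<close>

definition mi_dpower :: "'d \<Rightarrow> real ^ 'd \<Rightarrow> nat ^ 'd \<Rightarrow> real" where
  "mi_dpower j h \<beta> = real (\<beta> $ j) * mi_power h (\<beta> - axis j 1)"

lemma has_pd_iff:
  "has_pd j f x D \<longleftrightarrow> ((\<lambda>t. f (x + t *\<^sub>R axis j 1)) has_vector_derivative D) (at 0)"
proof -
  have eq: "norm (f (x + t *\<^sub>R axis j 1) - f x - t *\<^sub>R D) / norm t
      = norm ((1/t) *\<^sub>R (f (x + t *\<^sub>R axis j 1) - f x) - D)" if "t \<noteq> 0" for t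
  proof -
    have "(1/t) *\<^sub>R (f (x + t *\<^sub>R axis j 1) - f x) - D
        = (1/t) *\<^sub>R (f (x + t *\<^sub>R axis j 1) - f x - t *\<^sub>R D)"
      using that by (simp add: scaleR_diff_right)
    then show ?thesis by simp
  qed
  have "((\<lambda>t. f (x + t *\<^sub>R axis j 1)) has_vector_derivative D) (at 0) \<longleftrightarrow>
      ((\<lambda>t. norm (f (x + t *\<^sub>R axis j 1) - f x - t *\<^sub>R D) / norm t) \<longlongrightarrow> 0) (at 0)"
    unfolding has_vector_derivative_def has_derivative_iff_norm
    by (simp add: bounded_linear_scaleR_left)
  also have "\<dots> \<longleftrightarrow> ((\<lambda>t. norm ((1/t) *\<^sub>R (f (x + t *\<^sub>R axis j 1) - f x) - D)) \<longlongrightarrow> 0) (at 0)"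
    by (intro filterlim_cong refl) (use eq in \<open>simp add: eventually_at exI[of _ 1]\<close>)
  also have "\<dots> \<longleftrightarrow> has_pd j f x D"
    unfolding has_pd_def by (simp only: tendsto_norm_zero_iff LIM_zero_iff)
  finally show ?thesis by simp
qed

lemma pd_eqI: "has_pd j f x D \<Longrightarrow> pd j f x = D"
  unfolding pd_def has_pd_iff by (rule vector_derivative_at)

lemma has_pd_cong:
  assumes "open U" "x \<in> U" "\<And>y. y \<in> U \<Longrightarrow> f y = g y"
  shows "has_pd j f x D \<longleftrightarrow> has_pd j g x D"
proof -
  have "((\<lambda>t. x + t *\<^sub>R axis j (1::real)) \<longlongrightarrow> x + 0 *\<^sub>R axis j 1) (at 0)"
    by (intro tendsto_intros)
  then have "eventually (\<lambda>t. x + t *\<^sub>R axis j 1 \<in> U) (at 0)"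
    using assms(1,2) by (auto dest!: topological_tendstoD)
  then show ?thesis
    unfolding has_pd_def using assms by (intro filterlim_cong) (auto elim!: eventually_mono)
qed

lemma power_diff_bound:
  fixes a b :: real
  assumes "\<bar>a\<bar> \<le> s" "\<bar>b\<bar> \<le> s"
  shows "\<bar>a ^ n - b ^ n\<bar> \<le> real n * s ^ (n - 1) * \<bar>a - b\<bar>"
proof (induction n)
  case (Suc n)
  have s: "s \<ge> 0" using assms by linarith
  have "a ^ Suc n - b ^ Suc n = a * (a ^ n - b ^ n) + (a - b) * b ^ n"
    by (simp add: algebra_simps)
  then have "\<bar>a ^ Suc n - b ^ Suc n\<bar> \<le> \<bar>a\<bar> * \<bar>a ^ n - b ^ n\<bar> + \<bar>a - b\<bar> * \<bar>b\<bar> ^ n"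
    by (metis abs_mult abs_triangle_ineq power_abs)
  also have "\<dots> \<le> s * (real n * s ^ (n - 1) * \<bar>a - b\<bar>) + \<bar>a - b\<bar> * s ^ n"
    using assms s Suc by (intro add_mono mult_mono power_mono) auto
  also have "\<dots> = real (Suc n) * s ^ (Suc n - 1) * \<bar>a - b\<bar>"
    by (cases n) (auto simp: algebra_simps)
  finally show ?case .
qed auto

lemma mi_power_split:
  "mi_power h \<beta> = h $ j ^ (\<beta> $ j) * (\<Prod>i\<in>UNIV - {j}. h $ i ^ (\<beta> $ i))"
  unfolding mi_power_def by (rule prod.remove) auto

lemma mi_size_split: "mi_size \<beta> = \<beta> $ j + (\<Sum>i\<in>UNIV - {j}. \<beta> $ i)"
  unfolding mi_size_def by (rule sum.remove) auto

lemma mi_component_le: "\<beta> $ i \<le> mi_size \<beta>"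
  unfolding mi_size_def by (rule member_le_sum) auto

lemma abs_prod_power_le:
  fixes h :: "real ^ 'd"
  assumes "\<And>i. i \<in> S \<Longrightarrow> \<bar>h $ i\<bar> \<le> s"
  shows "\<bar>\<Prod>i\<in>S. h $ i ^ (\<beta> $ i)\<bar> \<le> s ^ (\<Sum>i\<in>S. \<beta> $ i)"
proof -
  have "\<bar>\<Prod>i\<in>S. h $ i ^ (\<beta> $ i)\<bar> = (\<Prod>i\<in>S. \<bar>h $ i\<bar> ^ (\<beta> $ i))"
    by (simp add: abs_prod power_abs)
  also have "\<dots> \<le> (\<Prod>i\<in>S. s ^ (\<beta> $ i))"
    using assms by (intro prod_mono) (auto intro!: power_mono)
  finally show ?thesis by (simp add: power_sum)
qed

lemma mi_power_bound:
  assumes "\<And>i. \<bar>h $ i\<bar> \<le> s"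
  shows "\<bar>mi_power h \<beta>\<bar> \<le> s ^ mi_size \<beta>"
  unfolding mi_power_def mi_size_def using assms by (intro abs_prod_power_le) auto

lemma mi_dpower_split:
  "mi_dpower j h \<beta> = real (\<beta> $ j) * h $ j ^ (\<beta> $ j - 1) * (\<Prod>i\<in>UNIV - {j}. h $ i ^ (\<beta> $ i))"
proof -
  have "(\<Prod>i\<in>UNIV - {j}. h $ i ^ ((\<beta> - axis j 1) $ i)) = (\<Prod>i\<in>UNIV - {j}. h $ i ^ (\<beta> $ i))"
    by (rule prod.cong) (auto simp: axis_def)
  then show ?thesis unfolding mi_dpower_def mi_power_split[of _ _ j] by (simp add: axis_def)
qed

lemma mi_power_diff_bound:
  assumes "\<And>i. \<bar>h $ i\<bar> \<le> s" "\<bar>h $ j + t\<bar> \<le> s"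
  shows "\<bar>mi_power (h + t *\<^sub>R axis j 1) \<beta> - mi_power h \<beta>\<bar>
    \<le> \<bar>t\<bar> * (real (mi_size \<beta>) * s ^ (mi_size \<beta> - 1))"
proof -
  have s: "s \<ge> 0" using assms(2) by linarith
  let ?P = "\<Prod>i\<in>UNIV - {j}. h $ i ^ (\<beta> $ i)" and ?m = "\<Sum>i\<in>UNIV - {j}. \<beta> $ i"
  have P: "(\<Prod>i\<in>UNIV - {j}. (h + t *\<^sub>R axis j 1) $ i ^ (\<beta> $ i)) = ?P"
    by (rule prod.cong) (auto simp: axis_def)
  have "mi_power (h + t *\<^sub>R axis j 1) \<beta> - mi_power h \<beta>
      = ((h $ j + t) ^ (\<beta> $ j) - h $ j ^ (\<beta> $ j)) * ?P"
    unfolding mi_power_split[of _ _ j] P by (simp add: algebra_simps)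
  also have "\<bar>\<dots>\<bar> \<le> (real (\<beta> $ j) * s ^ (\<beta> $ j - 1) * \<bar>t\<bar>) * s ^ ?m"
    unfolding abs_mult
    using power_diff_bound[OF assms(2) assms(1)[of j], of "\<beta> $ j"] abs_prod_power_le[of "UNIV - {j}" h s \<beta>] assms s
    by (intro mult_mono) auto
  also have "\<dots> \<le> \<bar>t\<bar> * (real (mi_size \<beta>) * s ^ (mi_size \<beta> - 1))"
  proof (cases "\<beta> $ j = 0")
    case False
    then have "s ^ (\<beta> $ j - 1) * s ^ ?m = s ^ (mi_size \<beta> - 1)"
      unfolding mi_size_split[of \<beta> j] by (simp flip: power_add)
    moreover have "\<bar>t\<bar> * (real (\<beta> $ j) * s ^ (mi_size \<beta> - 1)) \<le> \<bar>t\<bar> * (real (mi_size \<beta>) * s ^ (mi_size \<beta> - 1))"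
      using s by (intro mult_left_mono mult_right_mono) (auto simp: mi_component_le)
    ultimately show ?thesis by (simp add: mult_ac)
  qed (use s in auto)
  finally show ?thesis .
qed

lemma has_pd_mi_power: "has_pd j (\<lambda>x. mi_power x \<beta>) h (mi_dpower j h \<beta>)"
proof -
  let ?P = "\<Prod>i\<in>UNIV - {j}. h $ i ^ (\<beta> $ i)"
  have P: "(\<Prod>i\<in>UNIV - {j}. (h + t *\<^sub>R axis j 1) $ i ^ (\<beta> $ i)) = ?P" for t
    by (rule prod.cong) (auto simp: axis_def)
  have eq: "(\<lambda>t. mi_power (h + t *\<^sub>R axis j 1) \<beta>) = (\<lambda>t. (h $ j + t) ^ (\<beta> $ j) * ?P)"
    unfolding mi_power_split[of _ _ j] P by simp
  show ?thesis
    unfolding has_pd_iff eq mi_dpower_split has_real_derivative_iff_has_vector_derivative[symmetric]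
    by (auto intro!: derivative_eq_intros)
qed

lemma finite_mi_le: "finite {\<beta>::nat^'d. \<forall>i. \<beta> $ i \<le> N}"
proof -
  have "{\<beta>::nat^'d. \<forall>i. \<beta> $ i \<le> N} \<subseteq> vec_lambda ` (PiE UNIV (\<lambda>_. {..N}))"
  proof
    fix \<beta> :: "nat^'d" assume "\<beta> \<in> {\<beta>. \<forall>i. \<beta> $ i \<le> N}"
    then show "\<beta> \<in> vec_lambda ` (PiE UNIV (\<lambda>_. {..N}))"
      by (intro image_eqI[of _ _ "vec_nth \<beta>"]) auto
  qed
  then show ?thesis by (rule finite_subset) (auto intro!: finite_PiE)
qed

lemma finite_mi_size: "finite {\<beta>::nat^'d. mi_size \<beta> = m}"
  by (rule finite_subset[OF _ finite_mi_le[of m]]) (auto intro: mi_component_le)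

text \<open>A sum over a finite set of multiindices is at most the sum over a grid \<open>{0..N}^d\<close>,
  which is a product of \<open>d\<close> geometric sums.\<close>

lemma summable_on_geometric_mi:
  fixes q :: real
  assumes "0 \<le> q" "q < 1"
  shows "(\<lambda>\<beta>::nat^'d. q ^ mi_size \<beta>) summable_on UNIV"
proof (rule nonneg_bdd_above_summable_on)
  show "bdd_above (sum (\<lambda>\<beta>::nat^'d. q ^ mi_size \<beta>) ` {F. F \<subseteq> UNIV \<and> finite F})"
  proof (rule bdd_aboveI2)
    fix F :: "(nat^'d) set" assume "F \<in> {F. F \<subseteq> UNIV \<and> finite F}"
    then have F: "finite F" by simp
    define N where "N = Max (insert 0 (mi_size ` F))"
    have N: "\<beta> $ i \<le> N" if "\<beta> \<in> F" for \<beta> i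
    proof -
      have "mi_size \<beta> \<le> N" unfolding N_def using F that by (intro Max_ge) auto
      then show ?thesis using mi_component_le[of \<beta> i] by linarith
    qed
    have "(\<Sum>\<beta>\<in>F. q ^ mi_size \<beta>) = (\<Sum>g\<in>vec_nth ` F. \<Prod>i\<in>UNIV. q ^ g i)"
      by (subst sum.reindex) (auto simp: inj_on_def vec_eq_iff mi_size_def power_sum)
    also have "\<dots> \<le> (\<Sum>g\<in>PiE (UNIV::'d set) (\<lambda>_. {..N}). \<Prod>i\<in>UNIV. q ^ g i)"
      using assms by (intro sum_mono2 finite_PiE prod_nonneg) (auto dest: N)
    also have "\<dots> = (\<Prod>i\<in>(UNIV::'d set). \<Sum>k\<le>N. q ^ k)"
      by (subst prod_sum_PiE) auto
    also have "\<dots> \<le> (\<Prod>i\<in>(UNIV::'d set). 1 / (1 - q))"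
    proof (intro prod_mono conjI)
      show "(\<Sum>k\<le>N. q ^ k) \<le> 1 / (1 - q)"
        using assms geometric_sums[of q] sum_le_suminf[of "\<lambda>n. q ^ n" "{..N}"]
        by (auto simp: sums_iff)
    qed (use assms in \<open>auto intro!: sum_nonneg\<close>)
    finally show "(\<Sum>\<beta>\<in>F. q ^ mi_size \<beta>) \<le> (1 / (1 - q)) ^ CARD('d)" by simp
  qed
qed (use assms in auto)

lemma summable_on_size_geometric_mi:
  "(\<lambda>\<beta>::nat^'d. real (mi_size \<beta>) * (1/2) ^ mi_size \<beta>) summable_on UNIV"
proof (rule summable_on_comparison_test)
  show "(\<lambda>\<beta>::nat^'d. 2 * (3/4) ^ mi_size \<beta> :: real) summable_on UNIV"
    by (intro summable_on_cmult_right summable_on_geometric_mi) auto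
  fix \<beta> :: "nat^'d"
  have "real (mi_size \<beta>) \<le> 2 * (3/2) ^ mi_size \<beta>"
    using Bernoulli_inequality[of "1/2::real" "mi_size \<beta>"] by simp
  then have "real (mi_size \<beta>) * (1/2) ^ mi_size \<beta> \<le> 2 * (3/2) ^ mi_size \<beta> * (1/2) ^ mi_size \<beta>"
    by (rule mult_right_mono) auto
  also have "\<dots> = 2 * (3/4) ^ mi_size \<beta>" by (simp flip: power_mult_distrib)
  finally show "real (mi_size \<beta>) * (1/2) ^ mi_size \<beta> \<le> 2 * (3/4) ^ mi_size \<beta>" .
qed auto

lemma norm_has_sum_le:
  fixes f :: "'b \<Rightarrow> 'a::real_normed_vector"
  assumes "(f has_sum x) A" "\<And>i. i \<in> A \<Longrightarrow> norm (f i) \<le> g i" "g summable_on A"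
  shows "norm x \<le> infsum g A"
proof (rule tendsto_upperbound)
  show "((\<lambda>F. norm (sum f F)) \<longlongrightarrow> norm x) (finite_subsets_at_top A)"
    using assms(1) unfolding has_sum_def by (rule tendsto_norm)
  show "\<forall>\<^sub>F F in finite_subsets_at_top A. norm (sum f F) \<le> infsum g A"
  proof (rule eventually_finite_subsets_at_top_weakI)
    fix F assume F: "finite F" "F \<subseteq> A"
    have "norm (sum f F) \<le> (\<Sum>i\<in>F. g i)"
      using F assms(2) by (intro sum_norm_le) auto
    also have "\<dots> \<le> infsum g A"
      using F assms order_trans[OF norm_ge_zero assms(2)] by (intro finite_sum_le_infsum) auto
    finally show "norm (sum f F) \<le> infsum g A" .
  qed
qed simp

lemma has_sum_terms_bounded:
  fixes f :: "'b \<Rightarrow> 'a::real_normed_vector"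
  assumes "(f has_sum x) A"
  obtains M where "M \<ge> 0" "\<And>i. i \<in> A \<Longrightarrow> norm (f i) \<le> M"
proof -
  have "eventually (\<lambda>F. dist (sum f F) x < 1) (finite_subsets_at_top A)"
    using assms unfolding has_sum_def tendsto_iff by auto
  then obtain F0 where F0: "finite F0" "F0 \<subseteq> A"
    and d: "\<And>F. finite F \<Longrightarrow> F0 \<subseteq> F \<Longrightarrow> F \<subseteq> A \<Longrightarrow> dist (sum f F) x < 1"
    unfolding eventually_finite_subsets_at_top by metis
  define M where "M = 2 + (\<Sum>i\<in>F0. norm (f i))"
  have "norm (f i) \<le> M" if "i \<in> A" for i
  proof (cases "i \<in> F0")
    case True
    then have "norm (f i) \<le> (\<Sum>i\<in>F0. norm (f i))" using F0 by (intro member_le_sum) auto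
    then show ?thesis by (simp add: M_def)
  next
    case False
    have "f i = sum f (insert i F0) - sum f F0" using False F0 by simp
    then have "norm (f i) \<le> dist (sum f (insert i F0)) x + dist (sum f F0) x"
      by (metis dist_norm dist_triangle2)
    also have "\<dots> \<le> 2" using d[of "insert i F0"] d[of F0] F0 that by force
    finally show ?thesis by (simp add: M_def sum_nonneg add_increasing2)
  qed
  moreover have "M \<ge> 0" by (simp add: M_def sum_nonneg)
  ultimately show ?thesis using that by blast
qed

text \<open>The terms at a corner \<open>(s, \<dots>, s)\<close> of a cube inside the ball of convergence are
  bounded, which gives geometric decay of the terms on every smaller cube.\<close>

lemma has_power_series_bounds:
  assumes "has_power_series c f x0"
  obtains s M where "s > 0" "M \<ge> 0" "\<And>\<beta>. norm (c \<beta>) * s ^ mi_size \<beta> \<le> M"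
    "\<And>x. (\<And>i. \<bar>(x - x0) $ i\<bar> \<le> s) \<Longrightarrow> ((\<lambda>\<beta>. mi_power (x - x0) \<beta> *\<^sub>R c \<beta>) has_sum f x) UNIV"
proof -
  obtain r where r: "r > 0"
    and hs: "\<And>x. x \<in> ball x0 r \<Longrightarrow> ((\<lambda>\<beta>. mi_power (x - x0) \<beta> *\<^sub>R c \<beta>) has_sum f x) UNIV"
    using assms unfolding has_power_series_def by blast
  \<comment> \<open>The Euclidean norm is at most the sum of the moduli of the coordinates, so this cube lies
    inside the ball.\<close>
  define s where "s = r / (real CARD('a) + 1)"
  have s: "s > 0" using r by (simp add: s_def)
  have inball: "x \<in> ball x0 r" if "\<And>i. \<bar>(x - x0) $ i\<bar> \<le> s" for x
  proof -
    have "norm (x - x0) \<le> (\<Sum>i\<in>UNIV. \<bar>(x - x0) $ i\<bar>)" by (rule norm_le_l1_cart)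
    also have "\<dots> \<le> (\<Sum>i\<in>(UNIV::'a set). s)" using that by (intro sum_mono) auto
    also have "\<dots> = real CARD('a) * s" by simp
    also have "\<dots> < r" using r by (simp add: s_def field_simps)
    finally show ?thesis by (simp add: dist_norm norm_minus_commute)
  qed
  define x1 where "x1 = x0 + (\<chi> i. s)"
  have p: "mi_power (x1 - x0) \<beta> = s ^ mi_size \<beta>" for \<beta>
    by (simp add: x1_def mi_power_def mi_size_def power_sum)
  have x1: "x1 \<in> ball x0 r" by (rule inball) (use s in \<open>simp add: x1_def\<close>)
  have "\<exists>M\<ge>0. \<forall>\<beta>. norm (mi_power (x1 - x0) \<beta> *\<^sub>R c \<beta>) \<le> M"
    by (rule has_sum_terms_bounded[OF hs[OF x1]]) auto
  then obtain M where M: "M \<ge> 0" "\<And>\<beta>. norm (mi_power (x1 - x0) \<beta> *\<^sub>R c \<beta>) \<le> M" by blast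
  show ?thesis
    by (rule that[OF s M(1)]) (use M(2) s p hs inball in \<open>auto simp: mult.commute\<close>)
qed

lemma real_mi_size_split_pow:
  fixes s :: real
  assumes "s > 0"
  shows "real n * (s / 2) ^ (n - 1) = (2 / s) * s ^ n * (real n * (1/2) ^ n)"
  using assms by (cases n) (auto simp: power_divide field_simps)

text \<open>Termwise differentiation. If \<open>x\<close> and \<open>x + t e_j\<close> lie in a cube of half
  the size, the difference quotients of the terms are dominated by a fixed summable family, so the difference
  quotient of the remainder after a finite set \<open>F\<close> of terms is at most the tail of that family
  outside \<open>F\<close>, uniformly in \<open>t\<close>. The derivative \<open>D\<close> is assumed to exist
  and only its value is computed.\<close>

lemma has_sum_partial:
  assumes ps: "has_power_series c f x0"
  shows "\<exists>r>0. \<forall>x\<in>ball x0 r. \<forall>D. has_pd j f x D \<longrightarrow>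
           ((\<lambda>\<beta>. mi_dpower j (x - x0) \<beta> *\<^sub>R c \<beta>) has_sum D) UNIV"
proof -
  obtain s M where s: "s > 0" and M: "M \<ge> 0" "\<And>\<beta>. norm (c \<beta>) * s ^ mi_size \<beta> \<le> M"
    and hs: "\<And>x. (\<And>i. \<bar>(x - x0) $ i\<bar> \<le> s) \<Longrightarrow>
                 ((\<lambda>\<beta>. mi_power (x - x0) \<beta> *\<^sub>R c \<beta>) has_sum f x) UNIV"
    using has_power_series_bounds[OF ps] by blast
  \<comment> \<open>Bounds the \<open>\<beta>\<close>-th difference quotient on the cube of half-width
    \<open>s / 2\<close>.\<close>
  define a where "a \<beta> = (2 / s) * M * (real (mi_size \<beta>) * (1/2) ^ mi_size \<beta>)" for \<beta> :: "nat^'a"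
  have a: "a summable_on UNIV"
    unfolding a_def by (intro summable_on_cmult_right summable_on_size_geometric_mi)
  have "((\<lambda>\<beta>. mi_dpower j (x - x0) \<beta> *\<^sub>R c \<beta>) has_sum D) UNIV"
    if x: "x \<in> ball x0 (s/4)" and D: "has_pd j f x D" for x D
  proof -
    define h where "h = x - x0"
    have h: "\<bar>h $ i\<bar> \<le> s / 4" for i
      using component_le_norm_cart[of h i] x by (simp add: h_def dist_norm norm_minus_commute)
    have tail: "norm (D - (\<Sum>\<beta>\<in>F. mi_dpower j h \<beta> *\<^sub>R c \<beta>)) \<le> infsum a (- F)" if F: "finite F" for F
    proof -
      define q where "q t \<beta> = (1/t) * (mi_power (h + t *\<^sub>R axis j 1) \<beta> - mi_power h \<beta>)" for t \<beta>
      define L where "L t = (1/t) *\<^sub>R (f (x + t *\<^sub>R axis j 1) - f x) - (\<Sum>\<beta>\<in>F. q t \<beta> *\<^sub>R c \<beta>)" for t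
      have "(L \<longlongrightarrow> D - (\<Sum>\<beta>\<in>F. mi_dpower j h \<beta> *\<^sub>R c \<beta>)) (at 0)"
        unfolding L_def q_def
        using D has_pd_mi_power[of j _ h] unfolding has_pd_def
        by (intro tendsto_diff tendsto_sum tendsto_scaleR tendsto_const) auto
      then have lim: "((\<lambda>t. norm (L t)) \<longlongrightarrow> norm (D - (\<Sum>\<beta>\<in>F. mi_dpower j h \<beta> *\<^sub>R c \<beta>))) (at 0)"
        by (rule tendsto_norm)
      have bd: "norm (L t) \<le> infsum a (- F)" if t: "t \<noteq> 0" "\<bar>t\<bar> < s / 4" for t
      proof -
        have ht: "\<bar>h $ i + t * axis j 1 $ i\<bar> \<le> s / 2" for i
        proof -
          have "\<bar>h $ i + t * axis j 1 $ i\<bar> \<le> \<bar>h $ i\<bar> + \<bar>t\<bar>"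
            by (cases "i = j") (simp_all add: axis_def abs_triangle_ineq)
          then show ?thesis using h[of i] t by linarith
        qed
        have 1: "((\<lambda>\<beta>. mi_power (h + t *\<^sub>R axis j 1) \<beta> *\<^sub>R c \<beta>) has_sum f (x + t *\<^sub>R axis j 1)) UNIV"
        proof -
          have eq: "x + t *\<^sub>R axis j 1 - x0 = h + t *\<^sub>R axis j 1" by (simp add: h_def)
          have "\<bar>(h + t *\<^sub>R axis j 1) $ i\<bar> \<le> s" for i using ht[of i] s by simp
          then show ?thesis by (rule hs[of "x + t *\<^sub>R axis j 1", unfolded eq])
        qed
        have 2: "((\<lambda>\<beta>. mi_power h \<beta> *\<^sub>R c \<beta>) has_sum f x) UNIV"
        proof -
          have "\<bar>h $ i\<bar> \<le> s" for i using h[of i] s by linarith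
          then show ?thesis using hs[of x] by (simp add: h_def)
        qed
        have "((\<lambda>\<beta>. mi_power (h + t *\<^sub>R axis j 1) \<beta> *\<^sub>R c \<beta> + - (mi_power h \<beta> *\<^sub>R c \<beta>))
            has_sum (f (x + t *\<^sub>R axis j 1) + - f x)) UNIV"
          using 1 2 by (intro has_sum_add) (auto simp: has_sum_uminus)
        then have "((\<lambda>\<beta>. (1/t) *\<^sub>R (mi_power (h + t *\<^sub>R axis j 1) \<beta> *\<^sub>R c \<beta> + - (mi_power h \<beta> *\<^sub>R c \<beta>)))
            has_sum ((1/t) *\<^sub>R (f (x + t *\<^sub>R axis j 1) + - f x))) UNIV"
          by (intro has_sum_scaleR)
        then have "((\<lambda>\<beta>. q t \<beta> *\<^sub>R c \<beta>) has_sum ((1/t) *\<^sub>R (f (x + t *\<^sub>R axis j 1) - f x))) UNIV"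
          by (simp add: q_def scaleR_left_diff_distrib scaleR_diff_right diff_divide_distrib)
        then have "((\<lambda>\<beta>. q t \<beta> *\<^sub>R c \<beta>) has_sum L t) (UNIV - F)"
          unfolding L_def by (rule has_sum_Diff) (use F in \<open>auto intro: has_sum_finiteI\<close>)
        then have "((\<lambda>\<beta>. q t \<beta> *\<^sub>R c \<beta>) has_sum L t) (- F)"
          by (simp add: Compl_eq_Diff_UNIV)
        then show ?thesis
        proof (rule norm_has_sum_le)
          show "a summable_on - F" using a by (rule summable_on_subset) auto
          fix \<beta>
          have "\<bar>mi_power (h + t *\<^sub>R axis j 1) \<beta> - mi_power h \<beta>\<bar>
              \<le> \<bar>t\<bar> * (real (mi_size \<beta>) * (s/2) ^ (mi_size \<beta> - 1))"
          proof (rule mi_power_diff_bound)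
            show "\<bar>h $ i\<bar> \<le> s / 2" for i using h[of i] s by linarith
            show "\<bar>h $ j + t\<bar> \<le> s / 2" using ht[of j] by (simp add: axis_def)
          qed
          then have "\<bar>q t \<beta>\<bar> \<le> real (mi_size \<beta>) * (s/2) ^ (mi_size \<beta> - 1)"
            using t by (simp add: q_def abs_mult field_simps)
          also have "\<dots> = (2 / s) * s ^ mi_size \<beta> * (real (mi_size \<beta>) * (1/2) ^ mi_size \<beta>)"
            by (rule real_mi_size_split_pow[OF s])
          finally have "norm (q t \<beta> *\<^sub>R c \<beta>)
              \<le> (2 / s) * s ^ mi_size \<beta> * (real (mi_size \<beta>) * (1/2) ^ mi_size \<beta>) * norm (c \<beta>)"
            unfolding norm_scaleR real_norm_def by (rule mult_right_mono) simp
          also have "\<dots> = (2 / s) * (norm (c \<beta>) * s ^ mi_size \<beta>) * (real (mi_size \<beta>) * (1/2) ^ mi_size \<beta>)"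
            by (simp add: mult_ac)
          also have "\<dots> \<le> a \<beta>"
            unfolding a_def using s M by (intro mult_right_mono mult_left_mono) auto
          finally show "norm (q t \<beta> *\<^sub>R c \<beta>) \<le> a \<beta>" .
        qed
      qed
      have "eventually (\<lambda>t. norm (L t) \<le> infsum a (- F)) (at 0)"
        unfolding eventually_at using bd s by (intro exI[of _ "s/4"]) auto
      then show ?thesis using lim by (intro tendsto_upperbound) auto
    qed
    have "((\<lambda>F. infsum a UNIV - sum a F) \<longlongrightarrow> infsum a UNIV - infsum a UNIV) (finite_subsets_at_top UNIV)"
      using has_sum_infsum[OF a] unfolding has_sum_def by (intro tendsto_intros)
    moreover have "infsum a (- F) = infsum a UNIV - sum a F" if "finite F" for F
      using infsum_Diff[of a UNIV F] a that by (simp add: Compl_eq_Diff_UNIV)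
    then have ev: "\<forall>\<^sub>F F in finite_subsets_at_top UNIV. infsum a UNIV - sum a F = infsum a (- F)"
      by (intro eventually_finite_subsets_at_top_weakI) simp
    ultimately have "((\<lambda>F. infsum a (- F)) \<longlongrightarrow> 0) (finite_subsets_at_top UNIV)"
      using Lim_transform_eventually[OF _ ev] by simp
    then have "((\<lambda>F. (\<Sum>\<beta>\<in>F. mi_dpower j h \<beta> *\<^sub>R c \<beta>) - D) \<longlongrightarrow> 0) (finite_subsets_at_top UNIV)"
      by (rule Lim_null_comparison[rotated])
        (use tail in \<open>auto simp: norm_minus_commute intro!: eventually_finite_subsets_at_top_weakI\<close>)
    then show ?thesis unfolding has_sum_def h_def by (simp add: LIM_zero_iff)
  qed
  then show ?thesis using s by (intro exI[of _ "s/4"]) auto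
qed

text \<open>The coefficients of the partial derivative in direction \<open>j\<close> of the power series with
  coefficients \<open>c\<close>.\<close>

definition shift_coeffs :: "'d \<Rightarrow> (nat ^ 'd \<Rightarrow> 'a::real_normed_vector) \<Rightarrow> nat ^ 'd \<Rightarrow> 'a" where
  "shift_coeffs j c \<gamma> = real (\<gamma> $ j + 1) *\<^sub>R c (\<gamma> + axis j 1)"

lemma has_power_series_partial:
  assumes ps: "has_power_series c f x0" and U: "open U" "x0 \<in> U"
    and D: "\<And>x. x \<in> U \<Longrightarrow> has_pd j f x (D x)"
  shows "has_power_series (shift_coeffs j c) D x0"
proof -
  obtain r where r: "r > 0"
    and hs: "\<And>x D. x \<in> ball x0 r \<Longrightarrow> has_pd j f x D \<Longrightarrow>
           ((\<lambda>\<beta>. mi_dpower j (x - x0) \<beta> *\<^sub>R c \<beta>) has_sum D) UNIV"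
    using has_sum_partial[OF ps, of j] by blast
  obtain e where e: "e > 0" "ball x0 e \<subseteq> U" using U openE by blast
  have "((\<lambda>\<beta>. mi_power (x - x0) \<beta> *\<^sub>R shift_coeffs j c \<beta>) has_sum D x) UNIV"
    if x: "x \<in> ball x0 (min r e)" for x
  proof -
    let ?g = "\<lambda>\<gamma>::nat^'a. \<gamma> + axis j 1"
    have inj: "inj ?g" by (auto intro!: injI)
    have "x \<in> ball x0 r" "x \<in> U" using x e by auto
    then have "((\<lambda>\<beta>. mi_dpower j (x - x0) \<beta> *\<^sub>R c \<beta>) has_sum D x) UNIV"
      using hs D by blast
    then have "((\<lambda>\<beta>. mi_dpower j (x - x0) \<beta> *\<^sub>R c \<beta>) has_sum D x) (range ?g)"
    proof (rule has_sum_cong_neutral[THEN iffD1, rotated -1])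
      fix \<beta> :: "nat^'a" assume "\<beta> \<in> UNIV - range ?g"
      then have "\<beta> $ j = 0"
        by (auto simp: image_iff vec_eq_iff axis_def dest!: spec[of _ "\<beta> - axis j 1"] split: if_splits)
      then show "mi_dpower j (x - x0) \<beta> *\<^sub>R c \<beta> = 0" by (simp add: mi_dpower_def)
    qed auto
    then have "((\<lambda>\<beta>. mi_dpower j (x - x0) \<beta> *\<^sub>R c \<beta>) \<circ> ?g has_sum D x) UNIV"
      using inj by (subst (asm) has_sum_reindex) auto
    then show ?thesis
      by (simp add: o_def mi_dpower_def shift_coeffs_def mult.commute axis_def[of j "Suc 0"] add.commute)
  qed
  then show ?thesis unfolding has_power_series_def using r e by (intro exI[of _ "min r e"]) auto
qed

lemma has_power_series_at_0:
  assumes ps: "has_power_series c f x0"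
  shows "f x0 = c 0"
proof -
  have "((\<lambda>\<beta>. mi_power (x0 - x0) \<beta> *\<^sub>R c \<beta>) has_sum f x0) UNIV"
    using ps centre_in_ball[of x0] unfolding has_power_series_def by blast
  moreover have "mi_power 0 \<beta> = 0" if "\<beta> \<noteq> 0" for \<beta> :: "nat^'a"
  proof -
    from that obtain i where "\<beta> $ i \<noteq> 0" by (auto simp: vec_eq_iff)
    then show ?thesis by (simp add: mi_power_split[of _ _ i])
  qed
  then have "((\<lambda>\<beta>. mi_power (x0 - x0) \<beta> *\<^sub>R c \<beta>) has_sum f x0) UNIV
      \<longleftrightarrow> ((\<lambda>\<beta>. mi_power (x0 - x0) \<beta> *\<^sub>R c \<beta>) has_sum f x0) {0}"
    by (intro has_sum_cong_neutral) auto
  ultimately have "((\<lambda>\<beta>. mi_power (x0 - x0) \<beta> *\<^sub>R c \<beta>) has_sum f x0) {0}" by blast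
  moreover have "((\<lambda>\<beta>. mi_power (x0 - x0) \<beta> *\<^sub>R c \<beta>) has_sum c 0) {0}"
    by (rule has_sum_finiteI) (auto simp: mi_power_def)
  ultimately show ?thesis by (rule has_sum_unique)
qed

text \<open>Along the \<open>j\<close>-th axis the monomials not divisible by \<open>x_j^2\<close> vanish
  except for \<open>1\<close> and \<open>x_j\<close>, and the remaining terms are dominated by
  \<open>t^2\<close> times a convergent series.\<close>

lemma has_power_series_has_pd:
  assumes ps: "has_power_series c f x0"
  shows "has_pd j f x0 (c (axis j 1))"
proof -
  obtain s M where s: "s > 0" and M: "M \<ge> 0" "\<And>\<beta>. norm (c \<beta>) * s ^ mi_size \<beta> \<le> M"
    and hs: "\<And>x. (\<And>i. \<bar>(x - x0) $ i\<bar> \<le> s) \<Longrightarrow>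
                 ((\<lambda>\<beta>. mi_power (x - x0) \<beta> *\<^sub>R c \<beta>) has_sum f x) UNIV"
    using has_power_series_bounds[OF ps] by blast
  define a where "a \<beta> = (4 / s^2) * M * (1/2) ^ mi_size \<beta>" for \<beta> :: "nat^'a"
  have a: "a summable_on UNIV"
    unfolding a_def by (intro summable_on_cmult_right summable_on_geometric_mi) auto
  let ?e = "axis j (1::nat)"
  define F where "F = {0, ?e}"
  have e0: "?e \<noteq> 0" by (auto simp: vec_eq_iff axis_def)
  have S2: "(\<Sum>\<beta>\<in>F. g \<beta>) = g 0 + g ?e" for g :: "nat^'a \<Rightarrow> 'b"
    using e0 unfolding F_def by simp
  have p0: "mi_power h 0 = 1" for h :: "real^'a" by (simp add: mi_power_def)
  have pe: "mi_power (t *\<^sub>R axis j 1) ?e = t" for t :: real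
  proof -
    have "(\<Prod>i\<in>UNIV - {j}. (t *\<^sub>R axis j (1::real)) $ i ^ (?e $ i)) = 1"
      by (rule prod.neutral) (auto simp: axis_def)
    then show ?thesis unfolding mi_power_split[of _ _ j] by (simp add: axis_def)
  qed
  have 0: "f x0 = c 0" using ps by (rule has_power_series_at_0)
  have bd: "norm ((1/t) *\<^sub>R (f (x0 + t *\<^sub>R axis j 1) - f x0) - c ?e) \<le> \<bar>t\<bar> * infsum a (- F)"
    if t: "t \<noteq> 0" "\<bar>t\<bar> < s / 2" for t
  proof -
    have ti: "\<bar>(t *\<^sub>R axis j (1::real)) $ i\<bar> \<le> \<bar>t\<bar>" for i by (auto simp: axis_def)
    have "((\<lambda>\<beta>. mi_power (t *\<^sub>R axis j 1) \<beta> *\<^sub>R c \<beta>) has_sum f (x0 + t *\<^sub>R axis j 1)) UNIV"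
    proof -
      have "\<bar>(t *\<^sub>R axis j (1::real)) $ i\<bar> \<le> s" for i using ti[of i] t by linarith
      then show ?thesis using hs[of "x0 + t *\<^sub>R axis j 1"] by simp
    qed
    then have "((\<lambda>\<beta>. mi_power (t *\<^sub>R axis j 1) \<beta> *\<^sub>R c \<beta>)
        has_sum (f (x0 + t *\<^sub>R axis j 1) - (\<Sum>\<beta>\<in>F. mi_power (t *\<^sub>R axis j 1) \<beta> *\<^sub>R c \<beta>))) (UNIV - F)"
      by (rule has_sum_Diff) (auto simp: F_def intro: has_sum_finiteI)
    moreover have "(\<Sum>\<beta>\<in>F. mi_power (t *\<^sub>R axis j 1) \<beta> *\<^sub>R c \<beta>) = f x0 + t *\<^sub>R c ?e"
      unfolding S2 p0 pe 0 by simp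
    ultimately have "((\<lambda>\<beta>. mi_power (t *\<^sub>R axis j 1) \<beta> *\<^sub>R c \<beta>)
        has_sum (f (x0 + t *\<^sub>R axis j 1) - f x0 - t *\<^sub>R c ?e)) (- F)"
      by (simp only: diff_diff_add Compl_eq_Diff_UNIV)
    then have "norm (f (x0 + t *\<^sub>R axis j 1) - f x0 - t *\<^sub>R c ?e) \<le> infsum (\<lambda>\<beta>. t^2 * a \<beta>) (- F)"
    proof (rule norm_has_sum_le)
      show "(\<lambda>\<beta>. t^2 * a \<beta>) summable_on - F"
        by (rule summable_on_cmult_right[OF summable_on_subset[OF a]]) simp
      fix \<beta> assume \<beta>: "\<beta> \<in> - F"
      show "norm (mi_power (t *\<^sub>R axis j 1) \<beta> *\<^sub>R c \<beta>) \<le> t^2 * a \<beta>"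
      proof (cases "mi_size \<beta> \<ge> 2")
        case True
        then obtain n where n: "mi_size \<beta> = n + 2" using le_Suc_ex by (metis add.commute)
        have "\<bar>mi_power (t *\<^sub>R axis j 1) \<beta>\<bar> \<le> \<bar>t\<bar> ^ mi_size \<beta>" using ti by (rule mi_power_bound)
        also have "\<dots> = t^2 * \<bar>t\<bar> ^ n" by (simp add: n power_add power2_eq_square)
        also have "\<dots> \<le> t^2 * (s/2) ^ n"
          using t by (intro mult_left_mono power_mono) auto
        also have "\<dots> = t^2 * ((4/s^2) * s ^ mi_size \<beta> * (1/2) ^ mi_size \<beta>)"
          using s by (simp add: n power_add power_divide field_simps power2_eq_square)
        finally have "norm (mi_power (t *\<^sub>R axis j 1) \<beta> *\<^sub>R c \<beta>)
            \<le> t^2 * ((4/s^2) * s ^ mi_size \<beta> * (1/2) ^ mi_size \<beta>) * norm (c \<beta>)"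
          unfolding norm_scaleR by (rule mult_right_mono) simp
        also have "\<dots> = t^2 * ((4/s^2) * (norm (c \<beta>) * s ^ mi_size \<beta>) * (1/2) ^ mi_size \<beta>)"
          by (simp add: mult_ac)
        also have "\<dots> \<le> t^2 * a \<beta>"
          unfolding a_def using M by (intro mult_left_mono mult_right_mono) auto
        finally show ?thesis .
      next
        case False
        have "\<exists>i. i \<noteq> j \<and> \<beta> $ i \<noteq> 0"
        proof (rule ccontr)
          assume A: "\<not> (\<exists>i. i \<noteq> j \<and> \<beta> $ i \<noteq> 0)"
          then have "mi_size \<beta> = \<beta> $ j" by (auto simp: mi_size_split[of \<beta> j])
          then have "\<beta> $ j = 0 \<or> \<beta> $ j = 1" using False by linarith
          then have "\<beta> = 0 \<or> \<beta> = ?e"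
          proof
            assume "\<beta> $ j = 0"
            then have "\<beta> $ i = 0" for i using A by (cases "i = j") auto
            then show ?thesis by (simp add: vec_eq_iff)
          next
            assume "\<beta> $ j = 1"
            then have "\<beta> $ i = ?e $ i" for i using A by (cases "i = j") (auto simp: axis_def)
            then show ?thesis by (simp add: vec_eq_iff)
          qed
          then have "\<beta> \<in> F" by (auto simp: F_def)
          then show False using \<beta> by simp
        qed
        then obtain i where "i \<noteq> j" "\<beta> $ i \<noteq> 0" by blast
        then have "mi_power (t *\<^sub>R axis j 1) \<beta> = 0"
          by (simp add: mi_power_split[of _ _ i] axis_def)
        then show ?thesis using M s by (simp add: a_def)
      qed
    qed
    also have "\<dots> = t^2 * infsum a (- F)" by (rule infsum_cmult_right')
    finally have *: "norm (f (x0 + t *\<^sub>R axis j 1) - f x0 - t *\<^sub>R c ?e) \<le> t^2 * infsum a (- F)" .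
    let ?d = "f (x0 + t *\<^sub>R axis j 1) - f x0 - t *\<^sub>R c ?e"
    have "(1/t) *\<^sub>R (f (x0 + t *\<^sub>R axis j 1) - f x0) - c ?e = (1/t) *\<^sub>R ?d"
      using t by (simp add: scaleR_diff_right)
    then have "norm ((1/t) *\<^sub>R (f (x0 + t *\<^sub>R axis j 1) - f x0) - c ?e) = norm ?d / \<bar>t\<bar>"
      by (simp only: norm_scaleR) simp
    also have "\<dots> \<le> t^2 * infsum a (- F) / \<bar>t\<bar>" using * by (rule divide_right_mono) simp
    also have "\<dots> = \<bar>t\<bar> * infsum a (- F)" using t by (simp add: power2_eq_square field_simps abs_if)
    finally show ?thesis .
  qed
  have "((\<lambda>t. \<bar>t\<bar> * infsum a (- F)) \<longlongrightarrow> \<bar>0\<bar> * infsum a (- F)) (at 0)"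
    by (intro tendsto_intros)
  then have lim: "((\<lambda>t. \<bar>t\<bar> * infsum a (- F)) \<longlongrightarrow> 0) (at 0)" by simp
  have "((\<lambda>t. (1/t) *\<^sub>R (f (x0 + t *\<^sub>R axis j 1) - f x0) - c ?e) \<longlongrightarrow> 0) (at 0)"
  proof (rule Lim_null_comparison[OF _ lim])
    show "\<forall>\<^sub>F t in at 0. norm ((1/t) *\<^sub>R (f (x0 + t *\<^sub>R axis j 1) - f x0) - c ?e) \<le> \<bar>t\<bar> * infsum a (- F)"
      unfolding eventually_at using bd s by (intro exI[of _ "s/2"]) auto
  qed
  then show ?thesis unfolding has_pd_def by (simp add: LIM_zero_iff)
qed

definition mi_fact :: "nat ^ 'd \<Rightarrow> real" where
  "mi_fact \<beta> = (\<Prod>j\<in>UNIV. fact (\<beta> $ j))"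

definition mi_count :: "'d list \<Rightarrow> nat ^ 'd" where
  "mi_count js = (\<chi> j. count_list js j)"

lemma mi_fact_pos: "mi_fact \<beta> > 0"
  unfolding mi_fact_def by (intro prod_pos) auto

lemma mi_fact_Suc: "mi_fact (\<gamma> + axis j 1) = real (\<gamma> $ j + 1) * mi_fact \<gamma>"
proof -
  have "(\<Prod>i\<in>UNIV - {j}. fact ((\<gamma> + axis j 1) $ i)) = (\<Prod>i\<in>UNIV - {j}. fact (\<gamma> $ i) :: real)"
    by (rule prod.cong) (auto simp: axis_def)
  then show ?thesis
    unfolding mi_fact_def prod.remove[OF finite UNIV_I, of _ j]
    by (simp add: axis_def)
qed

text \<open>After multiplication by factorials, iterated differentiation is a mere shift of the index.\<close>

lemma foldr_shift_coeffs:
  "mi_fact \<gamma> *\<^sub>R foldr shift_coeffs js c \<gamma> = mi_fact (\<gamma> + mi_count js) *\<^sub>R c (\<gamma> + mi_count js)"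
proof (induction js arbitrary: \<gamma>)
  case (Cons j js)
  have cnt: "\<gamma> + mi_count (j # js) = (\<gamma> + axis j 1) + mi_count js"
    by (auto simp: mi_count_def vec_eq_iff axis_def)
  have "mi_fact \<gamma> *\<^sub>R foldr shift_coeffs (j # js) c \<gamma>
      = mi_fact (\<gamma> + axis j 1) *\<^sub>R foldr shift_coeffs js c (\<gamma> + axis j 1)"
    by (simp only: foldr.simps o_def shift_coeffs_def mi_fact_Suc scaleR_scaleR mult.commute)
  then show ?case unfolding cnt using Cons by simp
qed (auto simp: mi_count_def vec_eq_iff zero_vec_def[symmetric])

lemma foldr_shift_coeffs_0: "foldr shift_coeffs js c 0 = mi_fact (mi_count js) *\<^sub>R c (mi_count js)"
  using foldr_shift_coeffs[of 0 js c] by (simp add: mi_fact_def)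

lemma mi_count_mi_list: "mi_count (mi_list \<beta>) = \<beta>"
proof -
  have count_list_rep: "count_list (replicate n x) y = (if x = y then n else 0)" for n x and y :: 'a
    by (induction n) auto
  have "count_list (concat (map (\<lambda>j. replicate (\<beta> $ j) j) xs)) i = (if i \<in> set xs then \<beta> $ i else 0)"
    if "distinct xs" for xs i
    using that by (induction xs) (auto simp: count_list_append count_list_rep)
  then show ?thesis
    by (simp add: mi_count_def mi_list_def vec_eq_iff)
qed

text \<open>The assumption at all points of \<open>U\<close> feeds the induction: it provides the partial
  derivative of the current function at every point near \<open>x\<close>, and termwise differentiation
  provides the power series of that derivative.\<close>

lemma has_power_series_foldr_pd:
  fixes f :: "real^'d \<Rightarrow> 'a::real_normed_vector"
  assumes U: "open U" and f: "\<And>x. x \<in> U \<Longrightarrow> has_power_series (c x) f x"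
  shows "x \<in> U \<Longrightarrow> has_power_series (foldr shift_coeffs js (c x)) (foldr pd js f) x"
proof (induction js arbitrary: x)
  case (Cons j js)
  have "has_pd j (foldr pd js f) y (pd j (foldr pd js f) y)" if "y \<in> U" for y
    using has_power_series_has_pd[OF Cons.IH[OF that], of j] by (simp add: pd_eqI)
  from has_power_series_partial[OF Cons.IH[OF Cons.prems] U Cons.prems this]
  show ?case by simp
qed (use f in auto)

lemma foldr_pd_at_center:
  fixes f :: "real^'d \<Rightarrow> 'a::real_normed_vector"
  assumes "open U" "\<And>x. x \<in> U \<Longrightarrow> has_power_series (c x) f x" "x \<in> U"
  shows "foldr pd js f x = mi_fact (mi_count js) *\<^sub>R c x (mi_count js)"
  using has_power_series_at_0[OF has_power_series_foldr_pd[OF assms, of js]]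
  by (simp add: foldr_shift_coeffs_0)

section \<open>Restriction to lines and recovery of the coefficients\<close>

text \<open>If the coefficients below \<open>n\<close> agree, the difference of the two series divided by
  \<open>t^n\<close> is zero for \<open>t \<noteq> 0\<close>, and its limit at 0 is the difference of the
  \<open>n\<close>-th coefficients.\<close>

lemma real_powser_unique:
  fixes a b :: "nat \<Rightarrow> real"
  assumes r: "r > 0"
    and a: "\<And>t. \<bar>t\<bar> < r \<Longrightarrow> (\<lambda>n. a n * t ^ n) sums f t"
    and b: "\<And>t. \<bar>t\<bar> < r \<Longrightarrow> (\<lambda>n. b n * t ^ n) sums f t"
  shows "a n = b n"
proof (induction n rule: less_induct)
  case (less n)
  define c where "c k = a (k + n) - b (k + n)" for k
  have "(\<lambda>k. c k * t ^ k) sums 0" if t: "t \<noteq> 0" "norm t < r" for t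
  proof -
    have "(\<lambda>k. a k * t ^ k - b k * t ^ k) sums (f t - f t)"
      using t by (intro sums_diff a b) auto
    then have "(\<lambda>k. (a k - b k) * t ^ k) sums 0" by (simp add: algebra_simps)
    then have "(\<lambda>k. (a (k + n) - b (k + n)) * t ^ (k + n)) sums (0 - (\<Sum>k<n. (a k - b k) * t ^ k))"
      by (rule sums_split_initial_segment)
    then have "(\<lambda>k. c k * t ^ (k + n)) sums 0" using less by (simp add: c_def)
    then have "(\<lambda>k. c k * t ^ (k + n) * (1 / t ^ n)) sums (0 * (1 / t ^ n))" by (rule sums_mult2)
    then show ?thesis using t by (simp add: power_add)
  qed
  then have "((\<lambda>t. 0) \<longlongrightarrow> c 0) (at (0::real))" by (rule powser_limit_0_strong[OF r])
  then have "c 0 = 0" by (simp add: tendsto_const_iff)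
  then show ?case by (simp add: c_def)
qed

text \<open>The coefficient of \<open>t^m\<close> of the power series on the line
  \<open>t \<xi>\<close>.\<close>

definition homog_part :: "(nat ^ 'd \<Rightarrow> 'a::real_normed_vector) \<Rightarrow> real ^ 'd \<Rightarrow> nat \<Rightarrow> 'a" where
  "homog_part c \<xi> m = (\<Sum>\<beta> | mi_size \<beta> = m. mi_power \<xi> \<beta> *\<^sub>R c \<beta>)"

lemma mi_power_scaleR: "mi_power (t *\<^sub>R \<xi>) \<beta> = t ^ mi_size \<beta> * mi_power \<xi> \<beta>"
  by (simp add: mi_power_def mi_size_def power_mult_distrib prod.distrib power_sum)

lemma has_power_series_line:
  fixes f :: "real ^ 'd \<Rightarrow> real"
  assumes ps: "has_power_series c f 0"
  shows "\<exists>r>0. \<forall>t. \<bar>t\<bar> < r \<longrightarrow> summable (\<lambda>m. norm (homog_part c \<xi> m * t ^ m)) \<and>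
            (\<lambda>m. homog_part c \<xi> m * t ^ m) sums f (t *\<^sub>R \<xi>)"
proof -
  obtain r where r: "r > 0"
    and hs: "\<And>x. x \<in> ball 0 r \<Longrightarrow> ((\<lambda>\<beta>. mi_power x \<beta> *\<^sub>R c \<beta>) has_sum f x) UNIV"
    using ps unfolding has_power_series_def by auto
  have "summable (\<lambda>m. norm (homog_part c \<xi> m * t ^ m)) \<and>
            (\<lambda>m. homog_part c \<xi> m * t ^ m) sums f (t *\<^sub>R \<xi>)"
    if t: "\<bar>t\<bar> < r / (norm \<xi> + 1)" for t
  proof -
    have "norm (t *\<^sub>R \<xi>) \<le> \<bar>t\<bar> * (norm \<xi> + 1)" by (simp add: mult_left_mono)
    also have "\<dots> < r" using t by (simp add: pos_less_divide_eq add_nonneg_pos)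
    finally have "((\<lambda>\<beta>. mi_power (t *\<^sub>R \<xi>) \<beta> *\<^sub>R c \<beta>) has_sum f (t *\<^sub>R \<xi>)) UNIV"
      by (intro hs) simp
    also have "((\<lambda>\<beta>. mi_power (t *\<^sub>R \<xi>) \<beta> *\<^sub>R c \<beta>) has_sum f (t *\<^sub>R \<xi>)) UNIV \<longleftrightarrow>
        ((\<lambda>(m, \<beta>). mi_power (t *\<^sub>R \<xi>) \<beta> *\<^sub>R c \<beta>) has_sum f (t *\<^sub>R \<xi>))
          (Sigma UNIV (\<lambda>m. {\<beta>. mi_size \<beta> = m}))"
      by (rule has_sum_reindex_bij_witness[of _ snd "\<lambda>\<beta>. (mi_size \<beta>, \<beta>)"]) auto
    finally have "((\<lambda>m. homog_part c \<xi> m * t ^ m) has_sum f (t *\<^sub>R \<xi>)) UNIV"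
    proof (rule has_sum_Sigma[rotated])
      show "uniformly_continuous_on UNIV (\<lambda>(x::real, y). x + y)"
        using isUCont_plus[where 'a=real] by simp
      fix m
      show "((\<lambda>\<beta>. case (m, \<beta>) of (m, \<beta>) \<Rightarrow> mi_power (t *\<^sub>R \<xi>) \<beta> *\<^sub>R c \<beta>)
          has_sum homog_part c \<xi> m * t ^ m) {\<beta>. mi_size \<beta> = m}"
        unfolding homog_part_def sum_distrib_right
        by (rule has_sum_finiteI) (auto simp: finite_mi_size mi_power_scaleR intro!: sum.cong)
    qed
    then have hs: "((\<lambda>m. homog_part c \<xi> m * t ^ m) has_sum f (t *\<^sub>R \<xi>)) UNIV" .
    then have "(\<lambda>m. norm (homog_part c \<xi> m * t ^ m)) summable_on UNIV"
      by (subst summable_on_iff_abs_summable_on_real[symmetric]) (rule has_sum_imp_summable)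
    then show ?thesis
      using has_sum_imp_sums[OF hs] summable_on_imp_summable by blast
  qed
  then show ?thesis using r
    by (intro exI[of _ "r / (norm \<xi> + 1)"]) (auto intro!: divide_pos_pos add_nonneg_pos)
qed

lemma has_power_series_bounded_linear:
  assumes "has_power_series c f x0" "bounded_linear h"
  shows "has_power_series (\<lambda>\<beta>. h (c \<beta>)) (\<lambda>x. h (f x)) x0"
proof -
  interpret bounded_linear h by fact
  from assms(1) obtain r where r: "r > 0"
    and hs: "\<And>x. x \<in> ball x0 r \<Longrightarrow> ((\<lambda>\<beta>. mi_power (x - x0) \<beta> *\<^sub>R c \<beta>) has_sum f x) UNIV"
    unfolding has_power_series_def by blast
  have "((\<lambda>\<beta>. mi_power (x - x0) \<beta> *\<^sub>R h (c \<beta>)) has_sum h (f x)) UNIV" if "x \<in> ball x0 r" for x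
    using has_sum_bounded_linear[OF assms(2) hs[OF that]] by (simp add: scaleR)
  then show ?thesis unfolding has_power_series_def using r by blast
qed

lemma homog_part_linear:
  assumes "bounded_linear h"
  shows "homog_part (\<lambda>\<beta>. h (c \<beta>)) \<xi> m = h (homog_part c \<xi> m)"
proof -
  interpret bounded_linear h by fact
  show ?thesis by (simp add: homog_part_def sum scaleR)
qed

text \<open>The weight at the node \<open>x\<close> is the coefficient of \<open>X^b\<close> in the Lagrange
  basis polynomial of \<open>x\<close> for the nodes \<open>0, \<dots>, m\<close>, because the interpolation
  polynomial of \<open>X^k\<close> is \<open>X^k\<close>.\<close>

lemma dual_moments:
  assumes b: "b \<le> m"
  shows "\<exists>w::nat \<Rightarrow> real. \<forall>k\<le>m. (\<Sum>x\<le>m. w x * real x ^ k) = (if k = b then 1 else 0)"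
proof -
  define l :: "nat \<Rightarrow> real poly"
    where "l x = (\<Prod>y\<in>{..m} - {x}. smult (1 / (real x - real y)) [:- real y, 1:])" for x
  have poly_l: "poly (l x) (real z) = (if z = x then 1 else 0)" if "x \<le> m" "z \<le> m" for x z
  proof (cases "z = x")
    case True
    then show ?thesis by (auto simp: l_def poly_prod simp flip: diff_divide_distrib intro!: prod.neutral)
  next
    case False
    then show ?thesis using that by (auto simp: l_def poly_prod intro!: prod_zero)
  qed
  have deg_l: "degree (l x) \<le> m" if "x \<le> m" for x
  proof -
    have "degree (l x) \<le> (\<Sum>y\<in>{..m} - {x}. 1)"
      unfolding l_def by (rule order_trans[OF degree_prod_sum_le]) (auto intro!: sum_mono)
    also have "\<dots> = m" using that by simp
    finally show ?thesis .
  qed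
  have "(\<Sum>x\<le>m. poly.coeff (l x) b * real x ^ k) = (if k = b then 1 else 0)" if k: "k \<le> m" for k
  proof -
    have "(\<Sum>x\<le>m. smult (real x ^ k) (l x)) = monom 1 k"
    proof (rule poly_eqI_degree[of "real ` {..m}"])
      have card: "card (real ` {..m}) = Suc m" by (simp add: card_image inj_on_def)
      show "card (real ` {..m}) > degree (monom (1::real) k)" using k card by (simp add: degree_monom_eq)
      have "degree (\<Sum>x\<le>m. smult (real x ^ k) (l x)) \<le> m"
        by (rule degree_sum_le) (use deg_l in \<open>auto intro: order_trans[OF degree_smult_le]\<close>)
      then show "card (real ` {..m}) > degree (\<Sum>x\<le>m. smult (real x ^ k) (l x))" using card by simp
      fix z assume "z \<in> real ` {..m}"
      then obtain n where n: "z = real n" "n \<le> m" by auto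
      have "poly (\<Sum>x\<le>m. smult (real x ^ k) (l x)) z = (\<Sum>x\<le>m. if x = n then real n ^ k else 0)"
        unfolding poly_sum
      proof (rule sum.cong)
        fix x assume "x \<in> {..m}"
        then show "poly (smult (real x ^ k) (l x)) z = (if x = n then real n ^ k else 0)"
          using n poly_l[of x n] by auto
      qed simp
      also have "\<dots> = poly (monom 1 k) z"
        using n by (simp add: poly_monom)
      finally show "poly (\<Sum>x\<le>m. smult (real x ^ k) (l x)) z = poly (monom 1 k) z" .
    qed
    then have "poly.coeff (\<Sum>x\<le>m. smult (real x ^ k) (l x)) b = poly.coeff (monom 1 k) b" by simp
    then show ?thesis by (simp add: coeff_sum mult.commute)
  qed
  then show ?thesis by (intro exI[of _ "\<lambda>x. poly.coeff (l x) b"]) auto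
qed

text \<open>In a monomial of degree \<open>m\<close> every variable has an exponent at most \<open>m\<close>,
  so products of the weights of \<open>dual_moments\<close> on the grid \<open>{0..m}^d\<close> pick out one
  monomial. The weights and the grid do not depend on \<open>c\<close>; this makes the constants of the
  theorem uniform.\<close>

lemma coeff_from_homog_part:
  fixes \<beta> :: "nat ^ 'd"
  shows "\<exists>w X. finite X \<and>
    (\<forall>c :: nat ^ 'd \<Rightarrow> 'a::real_normed_vector. c \<beta> = (\<Sum>\<xi>\<in>X. w \<xi> *\<^sub>R homog_part c \<xi> (mi_size \<beta>)))"
proof -
  define m where "m = mi_size \<beta>"
  have "\<forall>i. \<exists>w::nat \<Rightarrow> real. \<forall>k\<le>m. (\<Sum>x\<le>m. w x * real x ^ k) = (if k = \<beta> $ i then 1 else 0)"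
    by (intro allI dual_moments) (simp add: m_def mi_component_le)
  from choice[OF this] obtain v :: "'d \<Rightarrow> nat \<Rightarrow> real" where
    v: "\<And>i k. k \<le> m \<Longrightarrow> (\<Sum>x\<le>m. v i x * real x ^ k) = (if k = \<beta> $ i then 1 else 0)" by auto
  define G where "G = PiE (UNIV :: 'd set) (\<lambda>_. {..m})"
  define p where "p g = (\<chi> i. real (g i))" for g :: "'d \<Rightarrow> nat"
  \<comment> \<open>On the grid, the floor recovers the integer coordinates.\<close>
  define w where "w \<xi> = (\<Prod>i\<in>UNIV. v i (nat \<lfloor>\<xi> $ i\<rfloor>))" for \<xi> :: "real ^ 'd"
  have finG: "finite G" unfolding G_def by (intro finite_PiE) auto
  have inj: "inj_on p G"
    by (auto simp: inj_on_def p_def vec_eq_iff fun_eq_iff)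
  have mom: "(\<Sum>\<xi>\<in>p ` G. w \<xi> * mi_power \<xi> \<gamma>) = (if \<gamma> = \<beta> then 1 else 0)" if \<gamma>: "mi_size \<gamma> = m" for \<gamma>
  proof -
    have "(\<Sum>\<xi>\<in>p ` G. w \<xi> * mi_power \<xi> \<gamma>) = (\<Sum>g\<in>G. \<Prod>i\<in>UNIV. v i (g i) * real (g i) ^ (\<gamma> $ i))"
      by (subst sum.reindex[OF inj]) (auto simp: w_def p_def mi_power_def prod.distrib)
    also have "\<dots> = (\<Prod>i\<in>UNIV. \<Sum>x\<le>m. v i x * real x ^ (\<gamma> $ i))"
      unfolding G_def by (subst prod_sum_PiE) auto
    also have "\<dots> = (\<Prod>i\<in>UNIV. if \<gamma> $ i = \<beta> $ i then 1 else 0)"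
      using v mi_component_le[of \<gamma>] \<gamma> by (intro prod.cong) auto
    also have "\<dots> = (if \<gamma> = \<beta> then 1 else 0)"
      by (auto simp: vec_eq_iff)
    finally show ?thesis .
  qed
  have "c \<beta> = (\<Sum>\<xi>\<in>p ` G. w \<xi> *\<^sub>R homog_part c \<xi> m)" for c :: "nat ^ 'd \<Rightarrow> 'a"
  proof -
    have "(\<Sum>\<xi>\<in>p ` G. w \<xi> *\<^sub>R homog_part c \<xi> m)
        = (\<Sum>\<gamma> | mi_size \<gamma> = m. (\<Sum>\<xi>\<in>p ` G. w \<xi> * mi_power \<xi> \<gamma>) *\<^sub>R c \<gamma>)"
      unfolding homog_part_def scaleR_sum_right scaleR_sum_left
      by (subst sum.swap) simp
    also have "\<dots> = (\<Sum>\<gamma> | mi_size \<gamma> = m. if \<gamma> = \<beta> then c \<gamma> else 0)"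
      by (rule sum.cong) (auto simp: mom)
    also have "\<dots> = c \<beta>" by (simp add: finite_mi_size m_def)
    finally show ?thesis by simp
  qed
  then show ?thesis using finG unfolding m_def by (intro exI[of _ w] exI[of _ "p ` G"]) auto
qed

section \<open>Bounds for the perturbation recursion\<close>

text \<open>Taylor coefficients \<open>p\<close>, \<open>l\<close> of a branch of eigenvectors and eigenvalues
  of the form with Taylor coefficients \<open>b\<close>, with respect to the inner product \<open>L\<close>.
  The unperturbed eigenvector is \<open>e\<close>, and \<open>Z\<close> is its complement. The forms are of
  size \<open>\<rho>\<^sup>2\<close>, except that they are bounded as soon as one argument is
  \<open>e\<close>; only \<open>b 4 e e\<close> may be of size \<open>\<rho>\<^sup>2\<close> again.\<close>

locale perturbation_data =
  fixes K \<rho> :: real and Z :: "'h::real_normed_vector set" and e :: 'h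
    and b :: "nat \<Rightarrow> 'h \<Rightarrow> 'h \<Rightarrow> real" and L :: "'h \<Rightarrow> 'h \<Rightarrow> real"
    and p :: "nat \<Rightarrow> 'h" and l :: "nat \<Rightarrow> real"
  assumes K: "K \<ge> 0" and \<rho>: "\<rho> \<ge> 1"
    and recursion: "\<And>m v. (\<Sum>i\<le>m. b i (p (m - i)) v) = (\<Sum>i\<le>m. l i * L (p (m - i)) v)"
    and b_le: "\<And>i u v. \<bar>b i u v\<bar> \<le> K * \<rho>\<^sup>2 * norm u * norm v"
    and b_e_left: "\<And>i v. v \<in> Z \<Longrightarrow> \<bar>b i e v\<bar> \<le> K * norm v"
    and b_e_right: "\<And>i v. v \<in> Z \<Longrightarrow> \<bar>b i v e\<bar> \<le> K * norm v"
    and b0_e: "\<And>v. b 0 v e = 0"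
    and b_e_e: "\<And>i. i \<noteq> 4 \<Longrightarrow> \<bar>b i e e\<bar> \<le> K"
    and coercive: "\<And>v. v \<in> Z \<Longrightarrow> \<rho>\<^sup>2 * (norm v)\<^sup>2 \<le> K * b 0 v v"
    and L_e_left: "\<And>v. v \<in> Z \<Longrightarrow> L e v = 0" and L_e_right: "\<And>v. v \<in> Z \<Longrightarrow> L v e = 0"
    and L_e_e: "K * L e e \<ge> 1" and L_le: "\<And>u v. \<bar>L u v\<bar> \<le> norm u * norm v"
    and norm_e: "norm e \<le> K"
    and p0: "p 0 = e" and p_Z: "\<And>m. m \<ge> 1 \<Longrightarrow> p m \<in> Z"
    and l0: "l 0 = 0"
begin

text \<open>The recursion with the test function \<open>e\<close>: all pairings \<open>L (p (m - i)) e\<close>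
  vanish except for \<open>i = m\<close>.\<close>

lemma eigenvalue_coeff:
  assumes m: "m \<ge> 1"
  shows "l m * L e e = (\<Sum>i\<in>{1..m}. b i (p (m - i)) e)"
proof -
  have "(\<Sum>i\<le>m. l i * L (p (m - i)) e) = l m * L e e + (\<Sum>i\<in>{..m} - {m}. l i * L (p (m - i)) e)"
    by (subst sum.remove[of _ m]) (auto simp: p0)
  also have "(\<Sum>i\<in>{..m} - {m}. l i * L (p (m - i)) e) = 0"
    by (intro sum.neutral ballI) (auto simp: L_e_right p_Z)
  also have "(\<Sum>i\<le>m. l i * L (p (m - i)) e) = (\<Sum>i\<le>m. b i (p (m - i)) e)"
    by (rule recursion[symmetric])
  also have "{..m} = insert 0 {1..m}" by auto
  finally show ?thesis by (simp add: b0_e)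
qed

text \<open>For the first bound the recursion is tested with \<open>p m\<close>. The term with
  \<open>p 0 = e\<close> has no factor \<open>\<rho>\<^sup>2\<close>, and for \<open>m \<le> 3\<close> the
  factor \<open>\<rho>\<^sup>2\<close> of the other terms is absorbed by \<open>p 1\<close> and
  \<open>p 2\<close>; coercivity then gains \<open>\<rho>\<^sup>2\<close>. The second bound estimates the
  right-hand side of \<open>eigenvalue_coeff\<close>.\<close>

lemma coeff_bound_step:
  assumes m: "m \<ge> 1" and D: "D \<ge> 0"
    and P: "\<And>i. i < m \<Longrightarrow> norm (p i) \<le> D * (if i \<in> {1..3} then 1 / \<rho>\<^sup>2 else 1)"
    and l: "\<And>i. i < m \<Longrightarrow> \<bar>l i\<bar> \<le> D * (if i = 4 then \<rho>\<^sup>2 else 1)"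
  shows "norm (p m) \<le> K * real (m + 1) * (K * (1 + D) + D * D) * (if m \<in> {1..3} then 1 / \<rho>\<^sup>2 else 1)"
    and "\<bar>l m\<bar> \<le> K * real m * (K * K * K + K + K * D) * (if m = 4 then \<rho>\<^sup>2 else 1)"
proof -
  have \<rho>2: "\<rho>\<^sup>2 \<ge> 1" using \<rho> by (simp add: one_le_power)
  have \<rho>2': "1 / \<rho>\<^sup>2 \<le> 1" using \<rho>2 by (simp add: divide_le_eq_1)
  \<comment> \<open>The size of the right-hand side of the recursion, before division by
    \<open>\<rho>\<^sup>2\<close>.\<close>
  define \<sigma> where "\<sigma> = (if m \<le> 3 then 1 else \<rho>\<^sup>2)"
  have \<sigma>: "\<sigma> \<ge> 1" using \<rho>2 by (auto simp: \<sigma>_def)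
  have pD: "norm (p i) \<le> D" if "i < m" for i
  proof -
    have "D * (if i \<in> {1..3} then 1 / \<rho>\<^sup>2 else 1) \<le> D * 1"
      using D \<rho>2' by (intro mult_left_mono) auto
    then show ?thesis using P[OF that] by linarith
  qed
  have term_b: "\<bar>b i (p (m - i)) (p m)\<bar> \<le> K * (1 + D) * \<sigma> * norm (p m)" if i: "i \<in> {1..m}" for i
  proof (cases "i = m")
    case True
    have "\<bar>b i (p (m - i)) (p m)\<bar> \<le> K * norm (p m)"
      using True b_e_left p_Z m by (simp add: p0)
    also have "\<dots> = K * 1 * 1 * norm (p m)" by simp
    also have "\<dots> \<le> K * (1 + D) * \<sigma> * norm (p m)"
      using K D \<sigma> by (intro mult_right_mono mult_mono) auto
    finally show ?thesis by simp
  next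
    case False
    then have mi: "m - i < m" "1 \<le> m - i" using i by auto
    have "\<rho>\<^sup>2 * norm (p (m - i)) \<le> D * \<sigma>"
    proof (cases "m \<le> 3")
      case True
      then have "norm (p (m - i)) \<le> D / \<rho>\<^sup>2" using P[OF mi(1)] mi by auto
      then have "\<rho>\<^sup>2 * norm (p (m - i)) \<le> \<rho>\<^sup>2 * (D / \<rho>\<^sup>2)" by (intro mult_left_mono) auto
      then show ?thesis using \<rho> True by (simp add: \<sigma>_def)
    next
      case False
      have "\<rho>\<^sup>2 * norm (p (m - i)) \<le> \<rho>\<^sup>2 * D" using pD[OF mi(1)] by (intro mult_left_mono) auto
      then show ?thesis using False by (simp add: \<sigma>_def mult.commute)
    qed
    then have "K * (\<rho>\<^sup>2 * norm (p (m - i))) * norm (p m) \<le> K * ((1 + D) * \<sigma>) * norm (p m)"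
      using K \<sigma> by (intro mult_right_mono mult_left_mono) (auto intro: order_trans simp: algebra_simps)
    then show ?thesis using b_le[of i "p (m - i)" "p m"] by (simp add: mult.assoc)
  qed
  have term_l: "\<bar>l i * L (p (m - i)) (p m)\<bar> \<le> D * D * \<sigma> * norm (p m)" if i: "i \<le> m" for i
  proof -
    consider "i = m" | "i = 0" | "1 \<le> i" "i < m" using i by linarith
    then show ?thesis
    proof cases
      case 1
      then show ?thesis using L_e_left p_Z m D \<sigma> by (simp add: p0)
    next
      case 2
      then show ?thesis using l0 D \<sigma> by simp
    next
      case 3
      have "\<bar>l i\<bar> \<le> D * \<sigma>"
      proof -
        have "D * (if i = 4 then \<rho>\<^sup>2 else 1) \<le> D * \<sigma>"
          using 3 D \<rho>2 by (intro mult_left_mono) (auto simp: \<sigma>_def)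
        then show ?thesis using l[OF 3(2)] by linarith
      qed
      moreover have "norm (p (m - i)) \<le> D" using pD[of "m - i"] 3 by auto
      then have "\<bar>L (p (m - i)) (p m)\<bar> \<le> D * norm (p m)"
        using L_le order_trans mult_right_mono norm_ge_zero by metis
      ultimately have "\<bar>l i\<bar> * \<bar>L (p (m - i)) (p m)\<bar> \<le> (D * \<sigma>) * (D * norm (p m))"
        using D \<sigma> by (intro mult_mono) auto
      then show ?thesis by (simp add: abs_mult mult_ac)
    qed
  qed
  have "b 0 (p m) (p m) = (\<Sum>i\<le>m. l i * L (p (m - i)) (p m)) - (\<Sum>i\<in>{1..m}. b i (p (m - i)) (p m))"
  proof -
    have "(\<Sum>i\<le>m. b i (p (m - i)) (p m)) = b 0 (p m) (p m) + (\<Sum>i\<in>{1..m}. b i (p (m - i)) (p m))"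
      by (subst sum.remove[of _ 0]) (auto intro!: arg_cong2[of _ _ _ _ sum])
    then show ?thesis using recursion[of m "p m"] by simp
  qed
  also have "\<dots> \<le> \<bar>\<Sum>i\<le>m. l i * L (p (m - i)) (p m)\<bar> + \<bar>\<Sum>i\<in>{1..m}. b i (p (m - i)) (p m)\<bar>"
    by linarith
  also have "\<dots> \<le> (\<Sum>i\<le>m. D * D * \<sigma> * norm (p m)) + (\<Sum>i\<in>{1..m}. K * (1 + D) * \<sigma> * norm (p m))"
    using term_b term_l by (intro add_mono order_trans[OF sum_abs] sum_mono) auto
  also have "\<dots> = real (m + 1) * (D * D * \<sigma> * norm (p m)) + real m * (K * (1 + D) * \<sigma> * norm (p m))"
    by simp
  also have "\<dots> \<le> real (m + 1) * (D * D * \<sigma> * norm (p m)) + real (m + 1) * (K * (1 + D) * \<sigma> * norm (p m))"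
    using K D \<sigma> by (intro add_left_mono mult_right_mono) auto
  also have "\<dots> = real (m + 1) * (K * (1 + D) + D * D) * \<sigma> * norm (p m)"
    by (simp add: algebra_simps)
  finally have "K * b 0 (p m) (p m) \<le> K * (real (m + 1) * (K * (1 + D) + D * D) * \<sigma> * norm (p m))"
    using K by (rule mult_left_mono)
  then have "\<rho>\<^sup>2 * (norm (p m))\<^sup>2 \<le> K * (real (m + 1) * (K * (1 + D) + D * D) * \<sigma> * norm (p m))"
    using coercive[OF p_Z[OF m]] by linarith
  then have *: "norm (p m) * norm (p m) \<le> (K * real (m + 1) * (K * (1 + D) + D * D) * (\<sigma> / \<rho>\<^sup>2)) * norm (p m)"
    using \<rho>2 by (simp add: field_simps power2_eq_square)
  have "norm (p m) \<le> K * real (m + 1) * (K * (1 + D) + D * D) * (\<sigma> / \<rho>\<^sup>2)"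
  proof (cases "norm (p m) = 0")
    case True
    show ?thesis unfolding True using K D \<sigma> by (intro mult_nonneg_nonneg divide_nonneg_nonneg) auto
  next
    case False
    then show ?thesis using * by (simp only: mult_le_cancel_right) auto
  qed
  also have "\<sigma> / \<rho>\<^sup>2 = (if m \<in> {1..3} then 1 / \<rho>\<^sup>2 else 1)"
    using m \<rho> by (auto simp: \<sigma>_def)
  finally show "norm (p m) \<le> K * real (m + 1) * (K * (1 + D) + D * D) * (if m \<in> {1..3} then 1 / \<rho>\<^sup>2 else 1)" .

  define \<tau> where "\<tau> = (if m = 4 then \<rho>\<^sup>2 else 1)"
  have \<tau>: "\<tau> \<ge> 1" using \<rho>2 by (auto simp: \<tau>_def)
  have term_e: "\<bar>b i (p (m - i)) e\<bar> \<le> (K * K * K + K + K * D) * \<tau>" if i: "i \<in> {1..m}" for i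
  proof (cases "i = m")
    case True
    have "\<bar>b m e e\<bar> \<le> (K * K * K + K) * \<tau>"
    proof (cases "m = 4")
      case True
      have "\<bar>b m e e\<bar> \<le> K * \<rho>\<^sup>2 * norm e * norm e" by (rule b_le)
      also have "\<dots> \<le> K * \<rho>\<^sup>2 * K * K" using K norm_e by (intro mult_mono) auto
      also have "\<dots> \<le> (K * K * K + K) * \<tau>" using True K by (simp add: \<tau>_def algebra_simps)
      finally show ?thesis .
    next
      case False
      then have "\<bar>b m e e\<bar> \<le> K" by (rule b_e_e)
      also have "\<dots> \<le> (K * K * K + K) * \<tau>" using False K by (simp add: \<tau>_def)
      finally show ?thesis .
    qed
    also have "\<dots> \<le> (K * K * K + K + K * D) * \<tau>" using K D \<tau> by (intro mult_right_mono) auto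
    finally show ?thesis using True by (simp add: p0)
  next
    case False
    then have mi: "m - i < m" "1 \<le> m - i" using i by auto
    have "\<bar>b i (p (m - i)) e\<bar> \<le> K * norm (p (m - i))" using b_e_right p_Z mi by blast
    also have "\<dots> \<le> (K * D) * 1" using K pD[OF mi(1)] by (simp add: mult_left_mono)
    also have "\<dots> \<le> (K * K * K + K + K * D) * \<tau>" using K D \<tau> by (intro mult_mono) auto
    finally show ?thesis .
  qed
  have "\<bar>l m\<bar> * 1 \<le> \<bar>l m\<bar> * (K * L e e)" using L_e_e by (intro mult_left_mono) auto
  also have "\<dots> = K * \<bar>l m * L e e\<bar>"
  proof -
    have "K * L e e = K * \<bar>L e e\<bar>"
      using L_e_e K by (cases "L e e \<ge> 0") (auto simp: mult_nonneg_nonpos dest: not_le_imp_less mult_nonneg_nonpos[of K "L e e"])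
    then have "\<bar>l m\<bar> * (K * L e e) = \<bar>l m\<bar> * (K * \<bar>L e e\<bar>)" by (rule arg_cong)
    then show ?thesis by (simp only: abs_mult mult_ac)
  qed
  also have "\<dots> \<le> K * (\<Sum>i\<in>{1..m}. (K * K * K + K + K * D) * \<tau>)"
    unfolding eigenvalue_coeff[OF m] using K term_e
    by (intro mult_left_mono order_trans[OF sum_abs] sum_mono) auto
  finally show "\<bar>l m\<bar> \<le> K * real m * (K * K * K + K + K * D) * (if m = 4 then \<rho>\<^sup>2 else 1)"
    by (simp add: \<tau>_def mult_ac)
qed

lemma second_eigenvalue_coeff:
  "\<bar>l 2 * L e e - b 2 e e\<bar> \<le> K * norm (p 1)"
proof -
  have "l 2 * L e e = (\<Sum>i\<in>{1..2}. b i (p (2 - i)) e)" by (rule eigenvalue_coeff) simp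
  also have "{1..2::nat} = {1, 2}" by auto
  finally have "l 2 * L e e - b 2 e e = b 1 (p 1) e" by (simp add: p0)
  then show ?thesis using b_e_right[OF p_Z[of 1]] by simp
qed

end

text \<open>\<open>K\<close> is fixed before \<open>C\<close> and everything else after it, so that
  \<open>C\<close> is independent of \<open>\<rho>\<close> and of the branch.\<close>

lemma coeff_bounds:
  "\<exists>C\<ge>0. \<forall>\<rho> (Z :: 'h::real_normed_vector set) e b L p l. perturbation_data K \<rho> Z e b L p l \<longrightarrow>
     norm (p m) \<le> C * (if m \<in> {1..3} then 1 / \<rho>\<^sup>2 else 1) \<and>
     \<bar>l m\<bar> \<le> C * (if m = 4 then \<rho>\<^sup>2 else 1)"
proof (induction m rule: less_induct)
  case (less m)
  show ?case
  proof (cases "m = 0")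
    case True
    have "norm (p m) \<le> \<bar>K\<bar> * (if m \<in> {1..3} then 1 / \<rho>\<^sup>2 else 1) \<and>
        \<bar>l m\<bar> \<le> \<bar>K\<bar> * (if m = 4 then \<rho>\<^sup>2 else 1)"
      if "perturbation_data K \<rho> Z e b L p l" for \<rho> and Z :: "'h set" and e b L p l
    proof -
      interpret perturbation_data K \<rho> Z e b L p l by fact
      show ?thesis using True l0 p0 norm_e by auto
    qed
    then show ?thesis by (intro exI[of _ "\<bar>K\<bar>"]) auto
  next
    case False
    obtain C where C: "\<And>i. i < m \<Longrightarrow> C i \<ge> 0"
      "\<And>i \<rho> (Z :: 'h set) e b L p l. i < m \<Longrightarrow> perturbation_data K \<rho> Z e b L p l \<Longrightarrow>
         norm (p i) \<le> C i * (if i \<in> {1..3} then 1 / \<rho>\<^sup>2 else 1) \<and>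
         \<bar>l i\<bar> \<le> C i * (if i = 4 then \<rho>\<^sup>2 else 1)"
      using less by metis
    define D where "D = (\<Sum>i<m. C i)"
    have D: "D \<ge> 0" unfolding D_def using C(1) by (intro sum_nonneg) auto
    have CD: "C i \<le> D" if "i < m" for i
      unfolding D_def using C(1) that by (intro member_le_sum) auto
    define B1 B2 where "B1 = K * real (m + 1) * (K * (1 + D) + D * D)"
      and "B2 = K * real m * (K * K * K + K + K * D)"
    have "norm (p m) \<le> (\<bar>B1\<bar> + \<bar>B2\<bar>) * (if m \<in> {1..3} then 1 / \<rho>\<^sup>2 else 1) \<and>
        \<bar>l m\<bar> \<le> (\<bar>B1\<bar> + \<bar>B2\<bar>) * (if m = 4 then \<rho>\<^sup>2 else 1)"
      if data: "perturbation_data K \<rho> Z e b L p l" for \<rho> and Z :: "'h set" and e b L p l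
    proof -
      interpret perturbation_data K \<rho> Z e b L p l by fact
      have P: "norm (p i) \<le> D * (if i \<in> {1..3} then 1 / \<rho>\<^sup>2 else 1)" if i: "i < m" for i
        using C(2)[OF i data] mult_right_mono[OF CD[OF i], of "if i \<in> {1..3} then 1 / \<rho>\<^sup>2 else 1"]
        by (auto intro: order_trans)
      have l: "\<bar>l i\<bar> \<le> D * (if i = 4 then \<rho>\<^sup>2 else 1)" if i: "i < m" for i
        using C(2)[OF i data] mult_right_mono[OF CD[OF i], of "if i = 4 then \<rho>\<^sup>2 else 1"]
        by (auto intro: order_trans)
      have m: "m \<ge> 1" using False by simp
      note step = coeff_bound_step[OF m D P l, folded B1_def B2_def]
      have "norm (p m) \<le> B1 * (if m \<in> {1..3} then 1 / \<rho>\<^sup>2 else 1)" by (rule step(1))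
      also have "\<dots> \<le> (\<bar>B1\<bar> + \<bar>B2\<bar>) * (if m \<in> {1..3} then 1 / \<rho>\<^sup>2 else 1)"
        by (rule mult_right_mono) auto
      finally have 1: "norm (p m) \<le> (\<bar>B1\<bar> + \<bar>B2\<bar>) * (if m \<in> {1..3} then 1 / \<rho>\<^sup>2 else 1)" .
      have "\<bar>l m\<bar> \<le> B2 * (if m = 4 then \<rho>\<^sup>2 else 1)" by (rule step(2))
      also have "\<dots> \<le> (\<bar>B1\<bar> + \<bar>B2\<bar>) * (if m = 4 then \<rho>\<^sup>2 else 1)"
        by (rule mult_right_mono) auto
      finally show ?thesis using 1 by blast
    qed
    then show ?thesis by (intro exI[of _ "\<bar>B1\<bar> + \<bar>B2\<bar>"]) auto
  qed
qed

section \<open>Integration over the cell and trigonometric monomials\<close>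

abbreviation cellM :: "(real ^ 'd) measure" where
  "cellM \<equiv> lebesgue_on cell"

lemma cell_borel [measurable]: "cell \<in> sets borel"
proof -
  have "cell = (\<Inter>i. {y::real^'d. 0 \<le> y $ i} \<inter> {y. y $ i < 2 * pi})"
    by (auto simp: cell_def)
  also have "\<dots> \<in> sets borel"
    by (intro sets.countable_INT'' sets.Int) auto
  finally show ?thesis .
qed

lemma cell_lebesgue [simp]: "cell \<in> sets lebesgue" "cell \<inter> space lebesgue \<in> sets lebesgue"
  using cell_borel by auto

lemma cell_subset_cbox: "cell \<subseteq> cbox 0 (\<chi> i. 2 * pi)"
  by (auto simp: cell_def mem_box_cart less_imp_le)

lemma box_subset_cell: "box 0 (\<chi> i. 2 * pi) \<subseteq> cell"
  by (auto simp: cell_def mem_box_cart less_imp_le)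

lemma cell_lmeasurable: "cell \<in> lmeasurable"
  using cell_subset_cbox by (rule bounded_set_imp_lmeasurable[OF bounded_subset[OF bounded_cbox]]) simp

lemma finite_measure_cellM: "finite_measure cellM"
  using cell_lmeasurable by (rule finite_measure_lebesgue_on)

text \<open>A function of the index type, like \<open>CARD\<close>.\<close>

definition vol :: "'d::finite itself \<Rightarrow> real" where
  "vol _ = measure lebesgue (cell :: (real ^ 'd::finite) set)"

lemma measure_cellM: "measure cellM (space (cellM :: (real^'d) measure)) = vol TYPE('d)"
  by (simp add: vol_def measure_restrict_space)

lemma vol_pos: "vol TYPE('d::finite) > 0"
proof -
  let ?b = "(\<chi> i. 2 * pi) :: real ^ 'd"
  have "box 0 ?b \<noteq> {}" by (simp add: interval_ne_empty_cart)
  then have "\<not> negligible (box 0 ?b)" by (rule open_not_negligible[OF open_box])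
  then have "\<not> negligible (cell :: (real^'d) set)"
    using box_subset_cell negligible_subset by blast
  then have "measure lebesgue (cell :: (real^'d) set) \<noteq> 0"
    using cell_lmeasurable negligible_iff_measure0 by blast
  then show ?thesis by (simp add: vol_def zero_less_measure_iff)
qed

lemma integral_cellM_borel:
  fixes f :: "real ^ 'd \<Rightarrow> 'b::{banach, second_countable_topology}"
  assumes "f \<in> borel_measurable borel"
  shows "(LINT y|cellM. f y) = (LINT y|lborel. indicator cell y *\<^sub>R f y)"
proof -
  have "(LINT y|cellM. f y) = (LINT y|lebesgue. indicator cell y *\<^sub>R f y)"
    by (rule integral_restrict_space) simp
  also have "\<dots> = (LINT y|lborel. indicator cell y *\<^sub>R f y)"
    using assms by (intro integral_completion) measurable
  finally show ?thesis .
qed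

lemma integrable_bounded_continuous:
  fixes f :: "real ^ 'd \<Rightarrow> complex"
  assumes "continuous_on UNIV f" "B \<subseteq> cbox a b" and [measurable]: "B \<in> sets borel"
  shows "integrable lborel (\<lambda>y. indicator B y *\<^sub>R f y)"
proof -
  have "integrable lborel (\<lambda>y. indicator (cbox a b) y *\<^sub>R f y)"
    using assms by (intro borel_integrable_compact compact_cbox) (auto intro: continuous_on_subset)
  then have "integrable lborel (\<lambda>y. indicator B y *\<^sub>R (indicator (cbox a b) y *\<^sub>R f y))"
    by (rule integrable_mult_indicator[rotated]) simp
  also have "(\<lambda>y. indicator B y *\<^sub>R (indicator (cbox a b) y *\<^sub>R f y)) = (\<lambda>y. indicator B y *\<^sub>R f y)"
    using assms(2) by (auto simp: indicator_def fun_eq_iff)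
  finally show ?thesis .
qed

lemma continuous_integrable_cell:
  fixes f :: "real ^ 'd \<Rightarrow> complex"
  assumes "continuous_on UNIV f"
  shows "integrable cellM f"
proof -
  have "f \<in> borel_measurable borel" using assms by (rule borel_measurable_continuous_onI)
  moreover have "integrable lborel (\<lambda>y. indicator cell y *\<^sub>R f y)"
    using assms cell_subset_cbox by (rule integrable_bounded_continuous) simp
  ultimately show ?thesis
    by (subst integrable_restrict_space) (auto simp: integrable_completion)
qed

lemma lborel_integral_shift:
  fixes f :: "real ^ 'd \<Rightarrow> complex"
  assumes "f \<in> borel_measurable borel"
  shows "(LINT y|lborel. f (y + a)) = (LINT y|lborel. f y)"
proof -
  have "(LINT y|lborel. f y) = (LINT y|distr lborel borel ((+) a). f y)"
    by (simp add: lborel_distr_plus)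
  also have "\<dots> = (LINT y|lborel. f (a + y))"
    using assms by (intro integral_distr) auto
  finally show ?thesis by (simp add: add.commute)
qed

lemma periodic_shift:
  assumes "periodic f"
  shows "AE y in lborel. f (y + (2 * pi) *\<^sub>R axis j 1) = f y"
  using assms unfolding periodic_def AE_completion_iff by (auto simp: axis_def)

text \<open>The shifted cell is cut along the face \<open>y_j = 2 \<pi>\<close>; the part beyond the face is
  moved back by one period.\<close>

lemma integral_cell_shift:
  fixes f :: "real ^ 'd \<Rightarrow> complex"
  assumes f: "continuous_on UNIV f" and per: "periodic f" and s: "0 \<le> s" "s \<le> 2 * pi"
  shows "(LINT y|cellM. f (y + s *\<^sub>R axis j 1)) = (LINT y|cellM. f y)"
proof -
  let ?e = "axis j 1 :: real ^ 'd"
  have [measurable]: "f \<in> borel_measurable borel" using f by (rule borel_measurable_continuous_onI)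
  have [measurable]: "(\<lambda>y::real^'d. y $ j) \<in> borel_measurable borel"
    by (intro borel_measurable_continuous_onI continuous_intros)
  \<comment> \<open>The shifted cell is the union of \<open>A\<close> and \<open>C\<close>, and
    \<open>C\<close> is \<open>B\<close> moved by one period.\<close>
  define A B C where "A = cell \<inter> {y. y $ j \<ge> s}"
    and "B = cell \<inter> {y. y $ j < s}" and "C = {y. y - (2 * pi) *\<^sub>R ?e \<in> B}"
  have [measurable]: "A \<in> sets borel" "B \<in> sets borel" unfolding A_def B_def by measurable
  have [measurable]: "C \<in> sets borel"
  proof -
    have "C = (\<lambda>y. y - (2 * pi) *\<^sub>R ?e) -` B \<inter> space borel" by (auto simp: C_def)
    also have "\<dots> \<in> sets borel" by measurable
    finally show ?thesis .
  qed
  have int: "integrable lborel (\<lambda>y. indicator S y *\<^sub>R f y)"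
    if "S \<in> {A, B, C}" for S
  proof (rule integrable_bounded_continuous[OF f])
    show "S \<subseteq> cbox 0 (\<chi> i. 4 * pi)"
    proof
      fix y assume "y \<in> S"
      have "0 \<le> y $ i \<and> y $ i \<le> 4 * pi" for i
      proof -
        consider "y \<in> cell" | "y - (2 * pi) *\<^sub>R ?e \<in> cell" using \<open>y \<in> S\<close> \<open>S \<in> {A, B, C}\<close>
          by (auto simp: A_def B_def C_def)
        then show ?thesis
        proof cases
          case 1
          then have "0 \<le> y $ i" "y $ i < 2 * pi" by (auto simp: cell_def)
          then show ?thesis using pi_gt_zero by linarith
        next
          case 2
          then have "0 \<le> (y - (2 * pi) *\<^sub>R ?e) $ i" "(y - (2 * pi) *\<^sub>R ?e) $ i < 2 * pi"
            by (auto simp: cell_def)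
          then show ?thesis using pi_gt_zero by (cases "i = j") (auto simp: axis_def)
        qed
      qed
      then show "y \<in> cbox 0 (\<chi> i. 4 * pi)" by (simp add: mem_box_cart)
    qed
    show "S \<in> sets borel" using that by auto
  qed
  have "(LINT y|cellM. f (y + s *\<^sub>R ?e)) = (LINT y|lborel. indicator cell y *\<^sub>R f (y + s *\<^sub>R ?e))"
    by (rule integral_cellM_borel) measurable
  also have "\<dots> = (LINT y|lborel. (\<lambda>z. indicator cell (z - s *\<^sub>R ?e) *\<^sub>R f z) (y + s *\<^sub>R ?e))"
    by simp
  also have "\<dots> = (LINT y|lborel. indicator cell (y - s *\<^sub>R ?e) *\<^sub>R f y)"
    by (rule lborel_integral_shift) measurable
  also have "\<dots> = (LINT y|lborel. indicator A y *\<^sub>R f y + indicator C y *\<^sub>R f y)"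
  proof (rule Bochner_Integration.integral_cong[OF refl])
    fix y :: "real ^ 'd"
    have cellj: "z \<in> cell \<longleftrightarrow> (\<forall>i. i \<noteq> j \<longrightarrow> 0 \<le> z $ i \<and> z $ i < 2 * pi) \<and> 0 \<le> z $ j \<and> z $ j < 2 * pi" for z
      unfolding cell_def mem_Collect_eq by (metis)
    have A: "y \<in> A \<longleftrightarrow> (\<forall>i. i \<noteq> j \<longrightarrow> 0 \<le> y $ i \<and> y $ i < 2 * pi) \<and> s \<le> y $ j \<and> y $ j < 2 * pi"
      using s by (auto simp: A_def cellj)
    have C: "y \<in> C \<longleftrightarrow> (\<forall>i. i \<noteq> j \<longrightarrow> 0 \<le> y $ i \<and> y $ i < 2 * pi) \<and> 2 * pi \<le> y $ j \<and> y $ j < 2 * pi + s"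
      using s by (auto simp: C_def B_def cellj axis_def)
    have D: "y - s *\<^sub>R ?e \<in> cell \<longleftrightarrow>
        (\<forall>i. i \<noteq> j \<longrightarrow> 0 \<le> y $ i \<and> y $ i < 2 * pi) \<and> s \<le> y $ j \<and> y $ j < 2 * pi + s"
      by (auto simp: cellj axis_def)
    show "indicator cell (y - s *\<^sub>R ?e) *\<^sub>R f y = indicator A y *\<^sub>R f y + indicator C y *\<^sub>R f y"
      unfolding indicator_def A C D using s by auto
  qed
  also have "\<dots> = (LINT y|lborel. indicator A y *\<^sub>R f y) + (LINT y|lborel. indicator C y *\<^sub>R f y)"
    by (intro Bochner_Integration.integral_add int) auto
  also have "(LINT y|lborel. indicator C y *\<^sub>R f y)
      = (LINT y|lborel. (\<lambda>z. indicator C z *\<^sub>R f z) (y + (2 * pi) *\<^sub>R ?e))"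
    by (rule lborel_integral_shift[symmetric]) measurable
  also have "\<dots> = (LINT y|lborel. indicator B y *\<^sub>R f y)"
    using periodic_shift[OF per, of j]
    by (intro integral_cong_AE) (auto simp: C_def indicator_def elim!: eventually_mono)
  also have "(LINT y|lborel. indicator A y *\<^sub>R f y) + (LINT y|lborel. indicator B y *\<^sub>R f y)
      = (LINT y|lborel. indicator A y *\<^sub>R f y + indicator B y *\<^sub>R f y)"
    by (intro Bochner_Integration.integral_add[symmetric] int) auto
  also have "\<dots> = (LINT y|lborel. indicator cell y *\<^sub>R f y)"
    by (rule Bochner_Integration.integral_cong[OF refl]) (auto simp: A_def B_def indicator_def)
  also have "\<dots> = (LINT y|cellM. f y)"
    by (rule integral_cellM_borel[symmetric]) measurable
  finally show ?thesis .
qed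

lemma smooth_differentiable: "smooth \<psi> \<Longrightarrow> \<psi> differentiable (at x)"
  unfolding smooth_def by (metis foldr.simps(1) id_apply)

lemma smooth_pd: "smooth \<psi> \<Longrightarrow> smooth (pd j \<psi>)"
  unfolding smooth_def
proof (intro allI)
  fix js x assume "\<forall>js x. foldr pd js \<psi> differentiable (at x)"
  then have "foldr pd (js @ [j]) \<psi> differentiable (at x)" by blast
  then show "foldr pd js (pd j \<psi>) differentiable (at x)" by simp
qed

lemma smooth_continuous: "smooth \<psi> \<Longrightarrow> continuous_on S \<psi>"
  by (meson continuous_at_imp_continuous_on differentiable_imp_continuous_within smooth_differentiable)

lemma differentiable_pd:
  assumes "\<psi> differentiable (at (x + t *\<^sub>R axis j 1))"
  shows "((\<lambda>t. \<psi> (x + t *\<^sub>R axis j 1)) has_vector_derivative pd j \<psi> (x + t *\<^sub>R axis j 1)) (at t)"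
proof -
  obtain D where D: "(\<psi> has_derivative D) (at (x + t *\<^sub>R axis j 1))"
    using assms unfolding differentiable_def by blast
  have *: "((\<lambda>s. \<psi> (y + s *\<^sub>R axis j 1)) has_vector_derivative D (axis j 1)) (at u)"
    if "y + u *\<^sub>R axis j 1 = x + t *\<^sub>R axis j 1" for y u
  proof -
    interpret bounded_linear D using D by (rule has_derivative_bounded_linear)
    have "((\<lambda>s. y + s *\<^sub>R axis j 1) has_derivative (\<lambda>s. s *\<^sub>R axis j 1)) (at u)"
      by (auto intro!: derivative_eq_intros)
    from has_derivative_compose[OF this, of \<psi> D] D that
    show ?thesis by (simp add: has_vector_derivative_def scaleR)
  qed
  have "pd j \<psi> (x + t *\<^sub>R axis j 1) = D (axis j 1)"
    unfolding pd_def by (rule vector_derivative_at) (rule *, simp)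
  then show ?thesis using *[of x t] by simp
qed

text \<open>The difference quotients have integral zero by shift invariance, and they are dominated by the
  maximum of the derivative on a slightly larger box.\<close>

lemma integral_pd_zero:
  assumes sm: "smooth \<psi>" and per: "periodic \<psi>"
  shows "(LINT y|cellM. pd j \<psi> y) = 0"
proof -
  let ?e = "axis j 1 :: real ^ 'a"
  define q where "q n y = real (Suc n) *\<^sub>R (\<psi> (y + (1 / real (Suc n)) *\<^sub>R ?e) - \<psi> y)" for n y
  have cont: "continuous_on UNIV \<psi>" using sm by (rule smooth_continuous)
  have contpd: "continuous_on UNIV (pd j \<psi>)" using sm by (intro smooth_continuous smooth_pd)
  have contq: "continuous_on UNIV (q n)" for n
    unfolding q_def by (intro continuous_intros continuous_on_compose2[OF cont]) auto
  have q0: "(LINT y|cellM. q n y) = 0" for n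
  proof -
    have i1: "integrable cellM \<psi>" using cont by (rule continuous_integrable_cell)
    have i2: "integrable cellM (\<lambda>y. \<psi> (y + (1 / real (Suc n)) *\<^sub>R ?e))"
      by (intro continuous_integrable_cell continuous_on_compose2[OF cont] continuous_intros) auto
    have "1 / real (Suc n) \<le> 1" by simp
    then have "1 / real (Suc n) \<le> 2 * pi" using pi_gt3 by linarith
    then have "(LINT y|cellM. \<psi> (y + (1 / real (Suc n)) *\<^sub>R ?e)) = (LINT y|cellM. \<psi> y)"
      by (intro integral_cell_shift[OF cont per]) auto
    then show ?thesis unfolding q_def using i1 i2 by simp
  qed
  define K where "K = cbox (0 :: real ^ 'a) (\<chi> i. 2 * pi + 1)"
  have "compact (pd j \<psi> ` K)" unfolding K_def
    using contpd by (intro compact_continuous_image) (auto intro: continuous_on_subset)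
  then obtain B where B: "\<And>y. y \<in> K \<Longrightarrow> norm (pd j \<psi> y) \<le> B"
    using compact_imp_bounded bounded_iff by (metis imageI)
  have "(\<lambda>n. LINT y|cellM. q n y) \<longlonglongrightarrow> (LINT y|cellM. pd j \<psi> y)"
  proof (rule integral_dominated_convergence[where w="\<lambda>_. B"])
    show "pd j \<psi> \<in> borel_measurable cellM" "q n \<in> borel_measurable cellM" for n
      using continuous_integrable_cell[OF contpd] continuous_integrable_cell[OF contq[of n]] by auto
    show "integrable cellM (\<lambda>_. B)" by (rule finite_measure.integrable_const[OF finite_measure_cellM])
    show "AE y in cellM. (\<lambda>n. q n y) \<longlonglongrightarrow> pd j \<psi> y"
    proof (rule AE_I2)
      fix y
      have "has_pd j \<psi> y (pd j \<psi> y)"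
        using differentiable_pd[of \<psi> y 0 j] smooth_differentiable[OF sm] by (simp add: has_pd_iff)
      then have L: "((\<lambda>t. (1 / t) *\<^sub>R (\<psi> (y + t *\<^sub>R ?e) - \<psi> y)) \<longlongrightarrow> pd j \<psi> y) (at 0)"
        by (simp add: has_pd_def)
      have "filterlim (\<lambda>n. 1 / real (Suc n)) (at 0) sequentially"
        unfolding filterlim_at using LIMSEQ_inverse_real_of_nat by (auto simp: inverse_eq_divide)
      from filterlim_compose[OF L this] show "(\<lambda>n. q n y) \<longlonglongrightarrow> pd j \<psi> y"
        by (simp add: q_def)
    qed
    show "AE y in cellM. norm (q n y) \<le> B" for n
    proof (rule AE_I2)
      fix y :: "real ^ 'a" assume "y \<in> space cellM"
      then have y: "y \<in> cell" by simp
      let ?t = "1 / real (Suc n)"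
      have t: "0 < ?t" "?t \<le> 1" by auto
      have der: "((\<lambda>t. \<psi> (y + t *\<^sub>R ?e)) has_derivative (\<lambda>h. h *\<^sub>R pd j \<psi> (y + t *\<^sub>R ?e))) (at t)" for t
        using differentiable_pd[of \<psi> y t j] smooth_differentiable[OF sm]
        by (simp add: has_vector_derivative_def)
      have "continuous_on {0..?t} (\<lambda>t. \<psi> (y + t *\<^sub>R ?e))"
        by (intro continuous_on_compose2[OF cont] continuous_intros) auto
      from mvt_general[OF t(1) this der] obtain x where x: "x \<in> {0<..<?t}"
        and le: "norm (\<psi> (y + ?t *\<^sub>R ?e) - \<psi> (y + 0 *\<^sub>R ?e)) \<le> norm ((?t - 0) *\<^sub>R pd j \<psi> (y + x *\<^sub>R ?e))"
        by blast
      have "y + x *\<^sub>R ?e \<in> K"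
      proof -
        have "0 \<le> y $ i + x * ?e $ i \<and> y $ i + x * ?e $ i \<le> 2 * pi + 1" for i
        proof -
          have "0 \<le> y $ i" "y $ i < 2 * pi" using y by (auto simp: cell_def)
          moreover have "0 < x" "x < ?t" using x by (auto simp only: greaterThanLessThan_iff)
          then have "0 \<le> x" "x \<le> 1" using t(2) by linarith+
          then have "0 \<le> x * ?e $ i" "x * ?e $ i \<le> 1" by (auto simp: axis_def)
          ultimately show ?thesis by linarith
        qed
        then show ?thesis by (simp add: K_def mem_box_cart)
      qed
      then have "norm (pd j \<psi> (y + x *\<^sub>R ?e)) \<le> B" by (rule B)
      then have "?t * norm (pd j \<psi> (y + x *\<^sub>R ?e)) \<le> ?t * B"
        by (intro mult_left_mono) auto
      then have "norm (\<psi> (y + ?t *\<^sub>R ?e) - \<psi> y) \<le> ?t * B"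
        using le by simp
      then have "real (Suc n) * norm (\<psi> (y + ?t *\<^sub>R ?e) - \<psi> y) \<le> real (Suc n) * (?t * B)"
        by (intro mult_left_mono) auto
      then show "norm (q n y) \<le> B" by (simp add: q_def)
    qed
  qed
  then show ?thesis unfolding q0 by (simp add: LIMSEQ_const_iff)
qed

definition trig :: "int ^ 'd \<Rightarrow> real ^ 'd \<Rightarrow> complex" where
  "trig n y = cis (\<Sum>j\<in>UNIV. of_int (n $ j) * y $ j)"

lemma trig_0 [simp]: "trig 0 y = 1"
  by (simp add: trig_def)

lemma norm_trig [simp]: "cmod (trig n y) = 1"
  by (simp add: trig_def)

lemma trig_add: "trig (m + n) y = trig m y * trig n y"
  by (simp add: trig_def cis_mult sum.distrib algebra_simps)

lemma cnj_trig: "cnj (trig n y) = trig (- n) y"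
  by (simp add: trig_def cis_cnj sum_negf)

lemma continuous_trig: "continuous_on S (trig n)"
  unfolding trig_def by (intro continuous_intros)

lemma periodic_trig: "periodic (trig n)"
proof -
  have "trig n (y + (2 * pi) *\<^sub>R p) = trig n y" if "\<forall>i. p $ i \<in> \<int>" for y p
  proof -
    have "(\<Sum>j\<in>UNIV. of_int (n $ j) * p $ j) \<in> \<int>" using that by (intro Ints_sum Ints_mult) auto
    then obtain k where k: "(\<Sum>j\<in>UNIV. of_int (n $ j) * p $ j) = of_int k" by (elim Ints_cases)
    have "(\<Sum>j\<in>UNIV. of_int (n $ j) * (y + (2 * pi) *\<^sub>R p) $ j)
        = (\<Sum>j\<in>UNIV. of_int (n $ j) * y $ j) + 2 * pi * (\<Sum>j\<in>UNIV. of_int (n $ j) * p $ j)"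
      by (simp add: sum.distrib sum_distrib_left algebra_simps)
    then show ?thesis unfolding trig_def k by (simp add: cis_multiple_2pi flip: cis_mult)
  qed
  then show ?thesis by (auto simp: periodic_def)
qed

lemma has_derivative_trig:
  "(trig n has_derivative (\<lambda>h. (\<Sum>j\<in>UNIV. of_int (n $ j) * h $ j) *\<^sub>R (\<i> * trig n y))) (at y)"
  unfolding trig_def by (auto intro!: derivative_eq_intros bounded_linear_imp_has_derivative bounded_linear_vec_nth)

lemma pd_cmult_trig: "pd j (\<lambda>y. c * trig n y) = (\<lambda>y. c * (\<i> * of_int (n $ j)) * trig n y)"
proof
  fix y
  have "((\<lambda>y. c * trig n y) has_derivative
      (\<lambda>h. c * ((\<Sum>j\<in>UNIV. of_int (n $ j) * h $ j) *\<^sub>R (\<i> * trig n y)))) (at (y + 0 *\<^sub>R axis j 1))"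
    using has_derivative_trig[of n y] by (auto intro!: derivative_eq_intros)
  moreover have "((\<lambda>s. y + s *\<^sub>R axis j 1) has_derivative (\<lambda>s. s *\<^sub>R axis j 1)) (at 0)"
    by (auto intro!: derivative_eq_intros)
  ultimately have "((\<lambda>s. c * trig n (y + s *\<^sub>R axis j 1)) has_derivative
      (\<lambda>s. c * ((\<Sum>i\<in>UNIV. of_int (n $ i) * (s *\<^sub>R axis j 1) $ i) *\<^sub>R (\<i> * trig n y)))) (at 0)"
    by (rule has_derivative_compose[rotated])
  also have "(\<lambda>s. c * ((\<Sum>i\<in>UNIV. of_int (n $ i) * (s *\<^sub>R axis j 1) $ i) *\<^sub>R (\<i> * trig n y)))
      = (\<lambda>s. s *\<^sub>R (c * (\<i> * of_int (n $ j)) * trig n y))"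
    by (simp add: axis_def if_distrib cong: if_cong) (simp add: scaleR_conv_of_real algebra_simps)
  finally show "pd j (\<lambda>y. c * trig n y) y = c * (\<i> * of_int (n $ j)) * trig n y"
    unfolding pd_def by (intro vector_derivative_at) (simp add: has_vector_derivative_def)
qed

lemma pd_trig: "pd j (trig n) = (\<lambda>y. \<i> * of_int (n $ j) * trig n y)"
  using pd_cmult_trig[of j 1 n] by simp

lemma smooth_trig: "smooth (trig n)"
proof -
  have "\<exists>c. foldr pd js (trig n) = (\<lambda>y. c * trig n y)" for js
  proof (induction js)
    case Nil
    show ?case by (intro exI[of _ 1]) simp
  next
    case (Cons j js)
    then show ?case by (auto simp: pd_cmult_trig)
  qed
  moreover have "(\<lambda>y. c * trig n y) differentiable (at x)" for c x
    using has_derivative_trig[of n x] by (intro derivative_intros) (auto simp: differentiable_def)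
  ultimately show ?thesis unfolding smooth_def by metis
qed

lemma integral_trig: "(LINT y|cellM. trig n y) = (if n = 0 then of_real (vol TYPE('d)) else 0)"
  for n :: "int ^ 'd"
proof (cases "n = 0")
  case True
  then show ?thesis
    using measure_cellM[where 'd='d] by (simp add: scaleR_conv_of_real)
next
  case False
  then obtain j where j: "n $ j \<noteq> 0" by (auto simp: vec_eq_iff)
  have "(LINT y|cellM. \<i> * of_int (n $ j) * trig n y) = 0"
    using integral_pd_zero[OF smooth_trig periodic_trig, of j n] by (simp add: pd_trig)
  then show ?thesis using j False by simp
qed

section \<open>Square-integrable functions on the cell\<close>

text \<open>Periodicity is left out because integrals over the cell do not see it.\<close>

definition L2_cell :: "(real ^ 'd \<Rightarrow> complex) set" where
  "L2_cell = {u. u \<in> borel_measurable cellM \<and> integrable cellM (\<lambda>y. (cmod (u y))\<^sup>2)}"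

lemma L2_per_imp_L2_cell: "u \<in> L2_per \<Longrightarrow> u \<in> L2_cell"
  by (auto simp: L2_per_def L2_cell_def measurable_restrict_space1)

lemma L2_cell_measurable [measurable_dest]: "u \<in> L2_cell \<Longrightarrow> u \<in> borel_measurable cellM"
  by (simp add: L2_cell_def)

lemma L2_cell_norm_mult:
  assumes u: "u \<in> L2_cell" and v: "v \<in> L2_cell"
  shows "integrable cellM (\<lambda>y. cmod (u y) * cmod (v y))"
proof (rule Bochner_Integration.integrable_bound)
  note [measurable] = L2_cell_measurable[OF u] L2_cell_measurable[OF v]
  show "integrable cellM (\<lambda>y. (cmod (u y))\<^sup>2 + (cmod (v y))\<^sup>2)"
    using u v by (auto simp: L2_cell_def)
  show "(\<lambda>y. cmod (u y) * cmod (v y)) \<in> borel_measurable cellM" by measurable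
  have "\<bar>a * b\<bar> \<le> \<bar>a\<^sup>2 + b\<^sup>2\<bar>" if "a \<ge> 0" "b \<ge> 0" for a b :: real
  proof -
    have "0 \<le> a * b" using that by simp
    then show ?thesis using sum_squares_bound[of a b] by linarith
  qed
  then show "AE y in cellM. norm (cmod (u y) * cmod (v y)) \<le> norm ((cmod (u y))\<^sup>2 + (cmod (v y))\<^sup>2)"
    by (intro AE_I2) (simp only: real_norm_def norm_ge_zero)
qed

lemma L2_cell_mult:
  assumes u: "u \<in> L2_cell" and v: "v \<in> L2_cell"
  shows "integrable cellM (\<lambda>y. u y * cnj (v y))"
proof (rule Bochner_Integration.integrable_bound[OF L2_cell_norm_mult[OF u v]])
  note [measurable] = L2_cell_measurable[OF u] L2_cell_measurable[OF v]
  have [measurable]: "(\<lambda>y. cnj (v y)) \<in> borel_measurable cellM"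
    by (rule borel_measurable_continuous_on[OF _ L2_cell_measurable[OF v]]) (intro continuous_intros)
  show "(\<lambda>y. u y * cnj (v y)) \<in> borel_measurable cellM" by measurable
qed (simp add: norm_mult)

lemma L2_cell_bmult:
  assumes u: "u \<in> L2_cell" and [measurable]: "a \<in> borel_measurable cellM"
    and M: "AE y in cellM. cmod (a y) \<le> M"
  shows "(\<lambda>y. a y * u y) \<in> L2_cell"
proof -
  note [measurable] = L2_cell_measurable[OF u]
  have "integrable cellM (\<lambda>y. (cmod (a y * u y))\<^sup>2)"
  proof (rule Bochner_Integration.integrable_bound)
    show "integrable cellM (\<lambda>y. M\<^sup>2 * (cmod (u y))\<^sup>2)" using u by (simp add: L2_cell_def)
    show "AE y in cellM. norm ((cmod (a y * u y))\<^sup>2) \<le> norm (M\<^sup>2 * (cmod (u y))\<^sup>2)"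
      using M
    proof eventually_elim
      case (elim y)
      then have "(cmod (a y))\<^sup>2 \<le> M\<^sup>2" by (intro power_mono) auto
      then show ?case by (simp add: norm_mult power_mult_distrib mult_right_mono)
    qed
  qed measurable
  then show ?thesis by (simp add: L2_cell_def)
qed

lemma L2_cell_cmult: "u \<in> L2_cell \<Longrightarrow> (\<lambda>y. c * u y) \<in> L2_cell"
  by (rule L2_cell_bmult[where M="cmod c"]) auto

lemma L2_cell_add:
  assumes u: "u \<in> L2_cell" and v: "v \<in> L2_cell"
  shows "(\<lambda>y. u y + v y) \<in> L2_cell"
proof -
  note [measurable] = L2_cell_measurable[OF u] L2_cell_measurable[OF v]
  have "integrable cellM (\<lambda>y. (cmod (u y + v y))\<^sup>2)"
  proof (rule Bochner_Integration.integrable_bound)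
    show "integrable cellM (\<lambda>y. 2 * (cmod (u y))\<^sup>2 + 2 * (cmod (v y))\<^sup>2)"
      using u v by (simp add: L2_cell_def)
    have "(cmod (u y + v y))\<^sup>2 \<le> 2 * (cmod (u y))\<^sup>2 + 2 * (cmod (v y))\<^sup>2" for y
    proof -
      have "(cmod (u y + v y))\<^sup>2 \<le> (cmod (u y) + cmod (v y))\<^sup>2"
        by (intro power_mono norm_triangle_ineq) auto
      also have "\<dots> \<le> 2 * (cmod (u y))\<^sup>2 + 2 * (cmod (v y))\<^sup>2"
        using sum_squares_bound[of "cmod (u y)" "cmod (v y)"] by (simp add: power2_sum)
      finally show ?thesis .
    qed
    then show "AE y in cellM. norm ((cmod (u y + v y))\<^sup>2) \<le> norm (2 * (cmod (u y))\<^sup>2 + 2 * (cmod (v y))\<^sup>2)"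
      by simp
  qed measurable
  then show ?thesis by (simp add: L2_cell_def)
qed

lemma L2_cell_diff:
  assumes "u \<in> L2_cell" "v \<in> L2_cell"
  shows "(\<lambda>y. u y - v y) \<in> L2_cell"
  using L2_cell_add[OF assms(1) L2_cell_cmult[OF assms(2), of "-1"]] by simp

lemma L2_cell_bounded:
  assumes "a \<in> borel_measurable cellM" "AE y in cellM. cmod (a y) \<le> M"
  shows "a \<in> L2_cell"
proof -
  have "(\<lambda>_. 1) \<in> L2_cell"
    using finite_measure.integrable_const[OF finite_measure_cellM, of "1::real"] by (simp add: L2_cell_def)
  from L2_cell_bmult[OF this assms] show ?thesis by simp
qed

lemma L2_cell_trig [simp]: "trig n \<in> L2_cell"
  by (rule L2_cell_bounded[where M=1, OF borel_measurable_integrable[OF continuous_integrable_cell[OF continuous_trig]]])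
    simp

lemma L2_cell_0 [simp]: "(\<lambda>_. 0) \<in> L2_cell"
  by (simp add: L2_cell_def)

lemma L2_cell_sum: "(\<And>i. i \<in> F \<Longrightarrow> u i \<in> L2_cell) \<Longrightarrow> (\<lambda>y. \<Sum>i\<in>F. u i y) \<in> L2_cell"
  by (induction F rule: infinite_finite_induct) (auto intro: L2_cell_add)

lemma L2_cell_cnj: "u \<in> L2_cell \<Longrightarrow> (\<lambda>y. cnj (u y)) \<in> L2_cell"
  using borel_measurable_continuous_on[of cnj u cellM]
  by (simp add: L2_cell_def continuous_intros)

lemma L2_inner_add_left:
  "u \<in> L2_cell \<Longrightarrow> v \<in> L2_cell \<Longrightarrow> w \<in> L2_cell \<Longrightarrow>
    L2_inner (\<lambda>y. u y + v y) w = L2_inner u w + L2_inner v w"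
  unfolding L2_inner_def by (simp add: distrib_right L2_cell_mult)

lemma L2_inner_cmult_left: "L2_inner (\<lambda>y. c * u y) w = c * L2_inner u w"
  unfolding L2_inner_def by (simp add: mult.assoc)

lemma L2_inner_cnj: "L2_inner u v = cnj (L2_inner v u)"
proof -
  have "cnj (L2_inner v u) = (LINT y|cellM. cnj (v y * cnj (u y)))"
    unfolding L2_inner_def by (rule Bochner_Integration.integral_cnj[symmetric])
  then show ?thesis by (simp add: L2_inner_def mult.commute)
qed

lemma L2_inner_add_right:
  "u \<in> L2_cell \<Longrightarrow> v \<in> L2_cell \<Longrightarrow> w \<in> L2_cell \<Longrightarrow>
    L2_inner w (\<lambda>y. u y + v y) = L2_inner w u + L2_inner w v"
  by (subst (1 2 3) L2_inner_cnj) (simp add: L2_inner_add_left)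

lemma L2_inner_cmult_right: "L2_inner w (\<lambda>y. c * u y) = cnj c * L2_inner w u"
  by (subst (1 2) L2_inner_cnj) (simp add: L2_inner_cmult_left)

lemma L2_inner_0_left [simp]: "L2_inner (\<lambda>_. 0) w = 0"
  by (simp add: L2_inner_def)

lemma L2_inner_0_right [simp]: "L2_inner w (\<lambda>_. 0) = 0"
  by (simp add: L2_inner_def)

lemma L2_inner_sum_left:
  assumes "\<And>i. i \<in> F \<Longrightarrow> u i \<in> L2_cell" "w \<in> L2_cell"
  shows "L2_inner (\<lambda>y. \<Sum>i\<in>F. u i y) w = (\<Sum>i\<in>F. L2_inner (u i) w)"
  using assms by (induction F rule: infinite_finite_induct) (auto simp: L2_inner_add_left L2_cell_sum)

lemma L2_inner_sum_right:
  assumes "\<And>i. i \<in> F \<Longrightarrow> u i \<in> L2_cell" "w \<in> L2_cell"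
  shows "L2_inner w (\<lambda>y. \<Sum>i\<in>F. u i y) = (\<Sum>i\<in>F. L2_inner w (u i))"
  using assms by (induction F rule: infinite_finite_induct) (auto simp: L2_inner_add_right L2_cell_sum)

lemma L2_inner_cong_AE:
  assumes "u \<in> L2_cell" "u' \<in> L2_cell" "v \<in> L2_cell" "v' \<in> L2_cell"
    and "AE y in cellM. u y = u' y" "AE y in cellM. v y = v' y"
  shows "L2_inner u v = L2_inner u' v'"
  unfolding L2_inner_def
proof (rule integral_cong_AE)
  show "AE y in cellM. u y * cnj (v y) = u' y * cnj (v' y)"
    using assms(5,6) by eventually_elim simp
qed (intro borel_measurable_integrable[OF L2_cell_mult] assms)+

lemma L2_norm_sq: "(L2_norm u)\<^sup>2 = (LINT y|cellM. (cmod (u y))\<^sup>2)"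
  unfolding L2_norm_def by (simp add: Bochner_Integration.integral_nonneg)

lemma L2_norm_nonneg [simp]: "L2_norm u \<ge> 0"
  unfolding L2_norm_def by (simp add: Bochner_Integration.integral_nonneg)

lemma L2_inner_self: "L2_inner u u = of_real ((L2_norm u)\<^sup>2)"
  unfolding L2_inner_def L2_norm_sq by (simp add: complex_norm_square[symmetric] flip: of_real_power)

text \<open>The integral of \<open>(|u| - s |v|)\<^sup>2\<close> is nonnegative for all real
  \<open>s\<close>.\<close>

lemma L2_Cauchy_Schwarz:
  assumes u: "u \<in> L2_cell" and v: "v \<in> L2_cell"
  shows "cmod (L2_inner u v) \<le> L2_norm u * L2_norm v"
proof -
  define A C B where "A = (L2_norm u)\<^sup>2" and "C = (L2_norm v)\<^sup>2"
    and "B = (LINT y|cellM. cmod (u y) * cmod (v y))"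
  note int = L2_cell_norm_mult[OF u v] L2_cell_norm_mult[OF u u] L2_cell_norm_mult[OF v v]
  have quad: "0 \<le> A - 2 * s * B + s\<^sup>2 * C" for s
  proof -
    have "0 \<le> (LINT y|cellM. (cmod (u y) - s * cmod (v y))\<^sup>2)"
      by (rule Bochner_Integration.integral_nonneg) simp
    also have "\<dots> = (LINT y|cellM. cmod (u y) * cmod (u y) - 2 * s * (cmod (u y) * cmod (v y))
        + s\<^sup>2 * (cmod (v y) * cmod (v y)))"
      by (rule Bochner_Integration.integral_cong[OF refl]) (simp add: power2_eq_square algebra_simps)
    also have "\<dots> = A - 2 * s * B + s\<^sup>2 * C"
      unfolding A_def B_def C_def L2_norm_sq unfolding power2_eq_square using int by simp
    finally show ?thesis .
  qed
  have B0: "B \<ge> 0" unfolding B_def by (rule Bochner_Integration.integral_nonneg) simp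
  have "B\<^sup>2 \<le> A * C"
  proof (cases "C = 0")
    case True
    have "B = 0"
    proof (rule ccontr)
      assume "B \<noteq> 0"
      then have "B > 0" using B0 by simp
      then show False using quad[of "(A + 1) / (2 * B)"] True by (simp add: field_simps)
    qed
    then show ?thesis using True by simp
  next
    case False
    then have "C > 0" by (simp add: C_def)
    then show ?thesis using quad[of "B / C"] by (simp add: field_simps power2_eq_square)
  qed
  then have "B\<^sup>2 \<le> (L2_norm u * L2_norm v)\<^sup>2" by (simp add: A_def C_def power_mult_distrib)
  then have "B \<le> L2_norm u * L2_norm v" by (rule power2_le_imp_le) simp
  moreover have "cmod (L2_inner u v) \<le> B"
    unfolding L2_inner_def B_def
    by (rule order_trans[OF integral_norm_bound]) (simp add: norm_mult)
  ultimately show ?thesis by linarith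
qed

lemma L2_norm_eq_0:
  assumes "u \<in> L2_cell"
  shows "L2_norm u = 0 \<longleftrightarrow> (AE y in cellM. u y = 0)"
proof -
  have "L2_norm u = 0 \<longleftrightarrow> (LINT y|cellM. (cmod (u y))\<^sup>2) = 0"
    unfolding L2_norm_def by simp
  also have "\<dots> \<longleftrightarrow> (AE y in cellM. (cmod (u y))\<^sup>2 = 0)"
    using assms by (intro integral_nonneg_eq_0_iff_AE) (auto simp: L2_cell_def)
  finally show ?thesis by simp
qed

text \<open>The \<open>n\<close>-th Fourier coefficient, up to the factor \<open>vol\<close>.\<close>

definition fc :: "(real ^ 'd \<Rightarrow> complex) \<Rightarrow> int ^ 'd \<Rightarrow> complex" where
  "fc u n = L2_inner u (trig n)"

lemma L2_inner_trig:
  "L2_inner (trig m) (trig n) = (if m = n then of_real (vol TYPE('d)) else 0)"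
  for m n :: "int ^ 'd"
proof -
  have "L2_inner (trig m) (trig n) = (LINT y|cellM. trig (m - n) y)"
    unfolding L2_inner_def cnj_trig trig_add[symmetric] by simp
  then show ?thesis by (simp add: integral_trig)
qed

lemma trig_sum_L2_cell [simp]: "(\<lambda>y. \<Sum>n\<in>F. a n * trig n y) \<in> L2_cell"
  by (intro L2_cell_sum L2_cell_cmult L2_cell_trig)

text \<open>Completing the squares in the expansion of the norm. With \<open>a n = fc u n / V\<close> this is
  Bessel's inequality, and for other \<open>a\<close> it shows that this choice is the best
  approximation.\<close>

lemma dist_trig_sum:
  fixes u :: "real ^ 'd \<Rightarrow> complex"
  assumes u: "u \<in> L2_cell" and F: "finite F"
  defines "V \<equiv> vol TYPE('d)"
  shows "(L2_norm (\<lambda>y. u y - (\<Sum>n\<in>F. a n * trig n y)))\<^sup>2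
     = (L2_norm u)\<^sup>2 - (\<Sum>n\<in>F. (cmod (fc u n))\<^sup>2) / V + V * (\<Sum>n\<in>F. (cmod (a n - fc u n / V))\<^sup>2)"
proof -
  have V: "V > 0" unfolding V_def by (rule vol_pos)
  let ?T = "\<lambda>y. \<Sum>n\<in>F. a n * trig n y"
  let ?mT = "\<lambda>y. (-1) * ?T y"
  have T: "?T \<in> L2_cell" "?mT \<in> L2_cell" by (rule trig_sum_L2_cell) (intro L2_cell_cmult trig_sum_L2_cell)
  have uT: "L2_inner u ?T = (\<Sum>n\<in>F. cnj (a n) * fc u n)"
    by (subst L2_inner_sum_right) (auto intro: L2_cell_cmult u simp: L2_inner_cmult_right fc_def)
  have TT: "L2_inner ?T ?T = of_real (V * (\<Sum>n\<in>F. (cmod (a n))\<^sup>2))"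
  proof -
    have "L2_inner ?T ?T = (\<Sum>n\<in>F. a n * L2_inner (trig n) ?T)"
      by (subst L2_inner_sum_left) (auto intro: L2_cell_cmult simp: L2_inner_cmult_left)
    also have "\<dots> = (\<Sum>n\<in>F. a n * (\<Sum>m\<in>F. cnj (a m) * L2_inner (trig n) (trig m)))"
      by (subst L2_inner_sum_right) (auto intro: L2_cell_cmult simp: L2_inner_cmult_right)
    also have "\<dots> = (\<Sum>n\<in>F. a n * (cnj (a n) * of_real V))"
      using F by (intro sum.cong refl) (simp add: L2_inner_trig V_def if_distrib cong: if_cong)
    also have "\<dots> = of_real (V * (\<Sum>n\<in>F. (cmod (a n))\<^sup>2))"
      by (simp add: sum_distrib_left complex_norm_square mult_ac del: of_real_power)
    finally show ?thesis .
  qed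
  have "of_real ((L2_norm (\<lambda>y. u y - ?T y))\<^sup>2) = L2_inner (\<lambda>y. u y + ?mT y) (\<lambda>y. u y + ?mT y)"
    by (simp only: L2_inner_self) simp
  also have "\<dots> = L2_inner u u - L2_inner u ?T - cnj (L2_inner u ?T) + L2_inner ?T ?T"
    using u T L2_inner_cnj[of ?T u]
    by (simp only: L2_inner_add_left L2_inner_add_right L2_cell_add L2_inner_cmult_left
        L2_inner_cmult_right) simp
  also have "\<dots> = of_real ((L2_norm u)\<^sup>2 - (\<Sum>n\<in>F. 2 * Re (cnj (a n) * fc u n)) + V * (\<Sum>n\<in>F. (cmod (a n))\<^sup>2))"
    unfolding uT TT L2_inner_self
    by (simp add: complex_eq_iff sum_distrib_left algebra_simps sum_subtractf sum.distrib)
  finally have "(L2_norm (\<lambda>y. u y - ?T y))\<^sup>2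
      = (L2_norm u)\<^sup>2 - (\<Sum>n\<in>F. 2 * Re (cnj (a n) * fc u n)) + V * (\<Sum>n\<in>F. (cmod (a n))\<^sup>2)"
    by (simp only: of_real_eq_iff)
  also have "\<dots> = (L2_norm u)\<^sup>2 + (\<Sum>n\<in>F. V * (cmod (a n))\<^sup>2 - 2 * Re (cnj (a n) * fc u n))"
    by (simp add: sum_subtractf sum_distrib_left)
  also have "(\<Sum>n\<in>F. V * (cmod (a n))\<^sup>2 - 2 * Re (cnj (a n) * fc u n))
      = (\<Sum>n\<in>F. V * (cmod (a n - fc u n / V))\<^sup>2 - (cmod (fc u n))\<^sup>2 / V)"
  proof (rule sum.cong[OF refl])
    fix n
    show "V * (cmod (a n))\<^sup>2 - 2 * Re (cnj (a n) * fc u n)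
        = V * (cmod (a n - fc u n / V))\<^sup>2 - (cmod (fc u n))\<^sup>2 / V"
    proof -
      have "Re (a n - fc u n / V) = Re (a n) - Re (fc u n) / V" "Im (a n - fc u n / V) = Im (a n) - Im (fc u n) / V"
        by simp_all
      then show ?thesis unfolding cmod_power2 using V by (simp add: field_simps power2_eq_square)
    qed
  qed
  finally show ?thesis by (simp add: sum_subtractf sum_distrib_left sum_divide_distrib)
qed

text \<open>The inductive form makes closure under multiplication a double induction over monomials.\<close>

inductive_set trig_poly :: "(real ^ 'd \<Rightarrow> complex) set" where
  monomial: "(\<lambda>y. c * trig n y) \<in> trig_poly"
| add: "f \<in> trig_poly \<Longrightarrow> g \<in> trig_poly \<Longrightarrow> (\<lambda>y. f y + g y) \<in> trig_poly"

lemma trig_poly_mult: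
  assumes "f \<in> trig_poly" "g \<in> trig_poly"
  shows "(\<lambda>y. f y * g y) \<in> trig_poly"
  using assms(1)
proof induction
  case (monomial c n)
  show ?case using assms(2)
  proof induction
    case (monomial d m)
    have "(\<lambda>y. c * trig n y * (d * trig m y)) = (\<lambda>y. (c * d) * trig (n + m) y)"
      by (simp add: trig_add mult_ac)
    then show ?case by (simp add: trig_poly.monomial)
  next
    case (add f g)
    then show ?case using trig_poly.add[OF add.IH] by (simp add: algebra_simps)
  qed
next
  case (add f h)
  then show ?case using trig_poly.add[OF add.IH] by (simp add: algebra_simps)
qed

lemma trig_poly_cmult: "f \<in> trig_poly \<Longrightarrow> (\<lambda>y. c * f y) \<in> trig_poly"
  using trig_poly_mult[OF trig_poly.monomial[of c 0]] by simp

lemma trig_poly_sum: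
  assumes "f \<in> trig_poly"
  shows "\<exists>F a. finite F \<and> f = (\<lambda>y. \<Sum>n\<in>F. a n * trig n y)"
  using assms
proof induction
  case (monomial c n)
  show ?case by (intro exI[of _ "{n}"] exI[of _ "\<lambda>_. c"]) simp
next
  case (add f g)
  then obtain F a G b where F: "finite F" "f = (\<lambda>y. \<Sum>n\<in>F. a n * trig n y)"
    and G: "finite G" "g = (\<lambda>y. \<Sum>n\<in>G. b n * trig n y)" by blast
  define c where "c n = (if n \<in> F then a n else 0) + (if n \<in> G then b n else 0)" for n
  have "f y + g y = (\<Sum>n\<in>F \<union> G. c n * trig n y)" for y
  proof -
    have "f y = (\<Sum>n\<in>F \<union> G. (if n \<in> F then a n else 0) * trig n y)"
      unfolding F(2) using F G by (intro sum.mono_neutral_cong_left) auto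
    moreover have "g y = (\<Sum>n\<in>F \<union> G. (if n \<in> G then b n else 0) * trig n y)"
      unfolding G(2) using F G by (intro sum.mono_neutral_cong_left) auto
    ultimately show ?thesis by (simp add: c_def algebra_simps flip: sum.distrib)
  qed
  then show ?case using F G by (intro exI[of _ "F \<union> G"] exI[of _ c]) auto
qed

section \<open>Density of trigonometric polynomials and Parseval's identity\<close>

text \<open>Periodic continuous functions are the continuous functions on this compact set, on which the
  coordinates separate points, as the Stone-Weierstrass theorem requires.\<close>

definition torus :: "(complex ^ 'd) set" where
  "torus = {z. \<forall>j. cmod (z $ j) = 1}"

definition wrap :: "real ^ 'd \<Rightarrow> complex ^ 'd" where
  "wrap y = (\<chi> j. cis (y $ j))"

lemma wrap_in_torus: "wrap y \<in> torus"
  by (simp add: wrap_def torus_def)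

lemma compact_torus: "compact (torus :: (complex ^ 'd) set)"
proof -
  have "closed (torus :: (complex ^ 'd) set)"
  proof -
    have eq: "torus = (\<Inter>j. {z::complex ^ 'd. cmod (z $ j) = 1})" by (auto simp: torus_def)
    show ?thesis unfolding eq by (intro closed_INT ballI closed_Collect_eq continuous_intros)
  qed
  moreover have "bounded (torus :: (complex ^ 'd) set)"
    unfolding bounded_iff
  proof (intro exI ballI)
    fix z :: "complex ^ 'd" assume "z \<in> torus"
    then have "norm z \<le> (\<Sum>j\<in>(UNIV::'d set). 1)"
      unfolding norm_vec_def by (intro order_trans[OF L2_set_le_sum]) (auto simp: torus_def)
    then show "norm z \<le> real CARD('d)" by simp
  qed
  ultimately show ?thesis by (simp add: compact_eq_bounded_closed)
qed

lemma trig_axis: "trig (axis j k) y = cis (of_int k * y $ j)"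
proof -
  have "(\<Sum>i\<in>UNIV. of_int (axis j k $ i) * y $ i) = (\<Sum>i\<in>UNIV. if i = j then of_int k * y $ j else 0)"
    by (rule sum.cong) (auto simp: axis_def)
  then show ?thesis unfolding trig_def by simp
qed

lemma trig_poly_approx_real:
  fixes G :: "complex ^ 'd \<Rightarrow> real"
  assumes G: "continuous_on torus G" and e: "e > 0"
  shows "\<exists>T\<in>trig_poly. \<forall>y. cmod (of_real (G (wrap y)) - T y) < e"
proof -
  define P where "P f \<longleftrightarrow> continuous_on torus f \<and> (\<lambda>y. of_real (f (wrap y))) \<in> trig_poly"
    for f :: "complex ^ 'd \<Rightarrow> real"
  have "\<exists>g. P g \<and> (\<forall>x\<in>torus. \<bar>G x - g x\<bar> < e)"
  proof (rule Stone_Weierstrass_HOL[OF compact_torus])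
    show "P (\<lambda>x. c)" for c
      using trig_poly.monomial[of "of_real c" 0] by (simp add: P_def)
    show "continuous_on torus f" if "P f" for f using that by (simp add: P_def)
    show "P (\<lambda>x. f x + g x)" if "P f \<and> P g" for f g
      using that trig_poly.add[of "\<lambda>y. of_real (f (wrap y))" "\<lambda>y. of_real (g (wrap y))"]
      by (auto simp: P_def intro: continuous_intros)
    show "P (\<lambda>x. f x * g x)" if "P f \<and> P g" for f g
      using that trig_poly_mult[of "\<lambda>y. of_real (f (wrap y))" "\<lambda>y. of_real (g (wrap y))"]
      by (auto simp: P_def intro: continuous_intros)
    have Re: "P (\<lambda>z. Re (z $ j))" for j
    proof -
      have eq: "(\<lambda>y. of_real (Re (wrap y $ j))) = (\<lambda>y::real^'d. (1/2) * trig (axis j 1) y + (1/2) * trig (axis j (-1)) y)"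
        by (rule ext) (simp add: trig_axis wrap_def complex_eq_iff)
      show ?thesis unfolding P_def eq
        by (intro conjI continuous_intros trig_poly.add trig_poly.monomial)
    qed
    have Im: "P (\<lambda>z. Im (z $ j))" for j
    proof -
      have eq: "(\<lambda>y. of_real (Im (wrap y $ j))) = (\<lambda>y::real^'d. (- \<i>/2) * trig (axis j 1) y + (\<i>/2) * trig (axis j (-1)) y)"
        by (rule ext) (simp add: trig_axis wrap_def complex_eq_iff)
      show ?thesis unfolding P_def eq
        by (intro conjI continuous_intros trig_poly.add trig_poly.monomial)
    qed
    fix x y :: "complex ^ 'd" assume "x \<in> torus \<and> y \<in> torus \<and> x \<noteq> y"
    then obtain j where "Re (x $ j) \<noteq> Re (y $ j) \<or> Im (x $ j) \<noteq> Im (y $ j)"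
      by (auto simp: vec_eq_iff complex_eq_iff)
    then show "\<exists>f. P f \<and> f x \<noteq> f y" using Re[of j] Im[of j] by blast
  qed (use G e in auto)
  then obtain g where g: "P g" "\<And>x. x \<in> torus \<Longrightarrow> \<bar>G x - g x\<bar> < e" by blast
  then show ?thesis
    by (intro bexI[of _ "\<lambda>y. of_real (g (wrap y))"])
      (auto simp: P_def wrap_in_torus simp flip: of_real_diff)
qed

lemma trig_poly_approx:
  fixes G :: "complex ^ 'd \<Rightarrow> complex"
  assumes G: "continuous_on torus G" and e: "e > 0"
  shows "\<exists>T\<in>trig_poly. \<forall>y. cmod (G (wrap y) - T y) < e"
proof -
  have "continuous_on torus (\<lambda>z. Re (G z))" "continuous_on torus (\<lambda>z. Im (G z))"
    using G by (auto intro: continuous_intros)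
  then obtain R I where R: "R \<in> trig_poly" "\<And>y. cmod (of_real (Re (G (wrap y))) - R y) < e / 2"
    and I: "I \<in> trig_poly" "\<And>y. cmod (of_real (Im (G (wrap y))) - I y) < e / 2"
    using trig_poly_approx_real[where e="e/2"] e by (metis half_gt_zero)
  have "cmod (G (wrap y) - (R y + \<i> * I y)) < e" for y
  proof -
    have "G (wrap y) - (R y + \<i> * I y)
        = (of_real (Re (G (wrap y))) - R y) + \<i> * (of_real (Im (G (wrap y))) - I y)"
      by (subst complex_eq[of "G (wrap y)"]) (simp add: algebra_simps)
    also have "cmod \<dots> \<le> cmod (of_real (Re (G (wrap y))) - R y) + cmod (of_real (Im (G (wrap y))) - I y)"
      by (rule order_trans[OF norm_triangle_ineq]) (simp add: norm_mult)
    also have "\<dots> < e" using R(2)[of y] I(2)[of y] by linarith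
    finally show ?thesis .
  qed
  then show ?thesis using trig_poly.add[OF R(1) trig_poly_cmult[OF I(1), of \<i>]]
    by (intro bexI[of _ "\<lambda>y. R y + \<i> * I y"]) auto
qed

text \<open>Radial projection onto the disc of radius \<open>M\<close>: a continuous truncation, so that it
  can be applied to an approximating sequence of continuous functions.\<close>

definition radial_clamp :: "real \<Rightarrow> complex \<Rightarrow> complex" where
  "radial_clamp M z = (M / max M (cmod z)) *\<^sub>R z"

lemma continuous_radial_clamp: "M > 0 \<Longrightarrow> continuous_on S (radial_clamp M)"
  unfolding radial_clamp_def by (intro continuous_intros) (auto simp: max_def)

lemma norm_radial_clamp: "M > 0 \<Longrightarrow> cmod (radial_clamp M z) \<le> M"
  by (auto simp: radial_clamp_def max_def field_simps)

lemma radial_clamp_eq: "cmod z \<le> M \<Longrightarrow> M > 0 \<Longrightarrow> radial_clamp M z = z"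
  by (simp add: radial_clamp_def max_def)

lemma norm_diff_radial_clamp: "M > 0 \<Longrightarrow> cmod (z - radial_clamp M z) \<le> cmod z"
proof -
  assume M: "M > 0"
  have "z - radial_clamp M z = (1 - M / max M (cmod z)) *\<^sub>R z" by (simp add: radial_clamp_def scaleR_diff_left)
  moreover have "0 \<le> M / max M (cmod z)" "M / max M (cmod z) \<le> 1" using M by (auto simp: divide_le_eq_1)
  then have "\<bar>1 - M / max M (cmod z)\<bar> \<le> 1" by linarith
  ultimately show ?thesis by (simp add: mult_left_le_one_le)
qed

text \<open>Vanishes where a coordinate is 1, that is, on the faces of the cell, and tends to 1 elsewhere. It
  glues a function on the cell to a continuous function on the torus.\<close>

definition cutoff :: "nat \<Rightarrow> complex ^ 'd \<Rightarrow> real" where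
  "cutoff k z = (\<Prod>j\<in>UNIV. min 1 (real k * cmod (z $ j - 1)))"

lemma continuous_cutoff: "continuous_on S (cutoff k)"
  unfolding cutoff_def by (intro continuous_intros)

lemma cutoff_bounds: "0 \<le> cutoff k z" "cutoff k z \<le> 1"
  unfolding cutoff_def by (auto intro!: prod_nonneg prod_le_1)

lemma cutoff_eq_0: "z $ j = 1 \<Longrightarrow> cutoff k z = 0"
  unfolding cutoff_def by (rule prod_zero) (simp, rule bexI[of _ j], auto)

lemma cutoff_tendsto:
  fixes z :: "complex ^ 'd"
  assumes "\<And>j. z $ j \<noteq> 1"
  shows "(\<lambda>k. cutoff k z) \<longlonglongrightarrow> 1"
proof -
  have "(\<lambda>k. min 1 (real k * cmod (z $ j - 1))) \<longlonglongrightarrow> 1" for j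
  proof (rule tendsto_eventually)
    have c: "cmod (z $ j - 1) > 0" using assms[of j] by simp
    obtain N where N: "1 / cmod (z $ j - 1) \<le> real N" using real_arch_simple by blast
    show "\<forall>\<^sub>F k in sequentially. min 1 (real k * cmod (z $ j - 1)) = 1"
    proof (rule eventually_sequentiallyI[of N])
      fix k assume "N \<le> k"
      then have "1 / cmod (z $ j - 1) \<le> real k" using N by linarith
      then have "1 \<le> real k * cmod (z $ j - 1)" using c by (simp add: field_simps)
      then show "min 1 (real k * cmod (z $ j - 1)) = 1" by simp
    qed
  qed
  then have "(\<lambda>k. cutoff k z) \<longlonglongrightarrow> (\<Prod>j\<in>(UNIV::'d set). 1)"
    unfolding cutoff_def by (intro tendsto_prod) auto
  then show ?thesis by simp
qed

text \<open>Away from the faces the argument functions are continuous; at the faces the cutoff tends to zero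
  and \<open>g\<close> is bounded.\<close>

lemma continuous_on_torus_cutoff:
  fixes g :: "real ^ 'd \<Rightarrow> complex"
  assumes g: "continuous_on UNIV g" and M: "\<And>y. cmod (g y) \<le> M"
  shows "continuous_on torus (\<lambda>z. of_real (cutoff k z) * g (\<chi> j. Arg2pi (z $ j)))"
  unfolding continuous_on_def
proof
  fix z :: "complex ^ 'd" assume z: "z \<in> torus"
  have cut: "((\<lambda>w. cutoff k w) \<longlongrightarrow> cutoff k z) (at z within torus)"
    using bspec[OF continuous_cutoff[of torus k, unfolded continuous_on_def] z] by simp
  show "((\<lambda>z. of_real (cutoff k z) * g (\<chi> j. Arg2pi (z $ j))) \<longlongrightarrow>
      of_real (cutoff k z) * g (\<chi> j. Arg2pi (z $ j))) (at z within torus)"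
  proof (cases "\<exists>j. z $ j = 1")
    case True
    then have c0: "cutoff k z = 0" using cutoff_eq_0 by blast
    have "((\<lambda>w. cutoff k w * M) \<longlongrightarrow> cutoff k z * M) (at z within torus)"
      using cut by (rule tendsto_mult_right)
    then have lim: "((\<lambda>w. cutoff k w * M) \<longlongrightarrow> 0) (at z within torus)" by (simp only: c0 mult_zero_left)
    have le: "norm (of_real (cutoff k w) * g (\<chi> j. Arg2pi (w $ j))) \<le> cutoff k w * M" for w
      unfolding norm_mult norm_of_real abs_of_nonneg[OF cutoff_bounds(1)]
      using M cutoff_bounds(1) by (rule mult_left_mono)
    have "((\<lambda>w. of_real (cutoff k w) * g (\<chi> j. Arg2pi (w $ j))) \<longlongrightarrow> 0) (at z within torus)"
      by (rule Lim_null_comparison[OF always_eventually lim]) (use le in blast)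
    then show ?thesis by (simp add: c0)
  next
    case False
    have "((\<lambda>w. Arg2pi (w $ j)) \<longlongrightarrow> Arg2pi (z $ j)) (at z within torus)" for j
    proof -
      have "z $ j \<notin> \<real>\<^sub>\<ge>\<^sub>0"
      proof
        assume "z $ j \<in> \<real>\<^sub>\<ge>\<^sub>0"
        then obtain r where r: "z $ j = of_real r" "r \<ge> 0" by (auto simp: nonneg_Reals_def)
        then have "r = 1" using z by (auto simp: torus_def dest!: spec[of _ j])
        then show False using r False by auto
      qed
      then have "isCont Arg2pi (z $ j)" by (rule continuous_at_Arg2pi)
      moreover have "((\<lambda>w. w $ j) \<longlongrightarrow> z $ j) (at z within torus)" by (intro tendsto_intros)
      ultimately show ?thesis by (rule isCont_tendsto_compose)
    qed
    then have "((\<lambda>w. \<chi> j. Arg2pi (w $ j)) \<longlongrightarrow> (\<chi> j. Arg2pi (z $ j))) (at z within torus)"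
      by (intro vec_tendstoI) simp
    moreover have "isCont g (\<chi> j. Arg2pi (z $ j))"
      using g by (simp add: continuous_on_eq_continuous_at)
    ultimately have "((\<lambda>w. g (\<chi> j. Arg2pi (w $ j))) \<longlongrightarrow> g (\<chi> j. Arg2pi (z $ j))) (at z within torus)"
      by (intro isCont_tendsto_compose[of _ g])
    then show ?thesis using cut by (intro tendsto_intros)
  qed
qed

lemma AE_cellM_I:
  assumes "negligible N" "\<And>y. y \<in> cell \<Longrightarrow> y \<notin> N \<Longrightarrow> P y"
  shows "AE y in cellM. P y"
proof -
  have "N \<in> null_sets lebesgue" using assms(1) by (simp add: negligible_iff_null_sets)
  then have "AE y in lebesgue. y \<notin> N" by (rule AE_not_in)
  then have "AE y in lebesgue. y \<in> cell \<longrightarrow> P y" by eventually_elim (use assms(2) in auto)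
  then show ?thesis by (subst AE_restrict_space_iff) auto
qed

lemma cell_wrap_neq_1:
  assumes "y \<in> cell" "y $ j \<noteq> 0"
  shows "wrap y $ j \<noteq> 1"
proof
  assume "wrap y $ j = 1"
  then have "Arg2pi (cis (y $ j)) = 0" by (simp add: wrap_def Arg2pi_eq_0)
  moreover have "Arg2pi (cis (y $ j)) = y $ j"
    using assms by (intro Arg2pi_unique[of 1]) (auto simp: cell_def cis_conv_exp)
  ultimately show False using assms by simp
qed

lemma Arg2pi_wrap:
  assumes "y \<in> cell"
  shows "(\<chi> j. Arg2pi (wrap y $ j)) = y"
proof -
  have "Arg2pi (cis (y $ j)) = y $ j" for j
    using assms by (intro Arg2pi_unique[of 1]) (auto simp: cell_def cis_conv_exp)
  then show ?thesis by (simp add: wrap_def vec_eq_iff)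
qed

lemma trig_poly_measurable: "T \<in> trig_poly \<Longrightarrow> T \<in> L2_cell"
  using trig_poly_sum trig_sum_L2_cell by blast

text \<open>Three successive approximations, each within \<open>e/9\<close> in the squared norm:
  \<open>u\<close> by a truncation \<open>c\<close> of \<open>u\<close>; \<open>c\<close> by a continuous
  function on the torus, obtained from a sequence of continuous functions that converges to \<open>u\<close>
  almost everywhere; and that function uniformly by a trigonometric polynomial.\<close>

theorem trig_poly_dense:
  fixes u :: "real ^ 'd \<Rightarrow> complex"
  assumes u: "u \<in> L2_cell" and e: "e > 0"
  shows "\<exists>T\<in>trig_poly. (L2_norm (\<lambda>y. u y - T y))\<^sup>2 < e"
proof -
  note [measurable] = L2_cell_measurable[OF u]
  have intu: "integrable cellM (\<lambda>y. (cmod (u y))\<^sup>2)" using u by (simp add: L2_cell_def)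
  have meas_clamp: "(\<lambda>y. radial_clamp M (u y)) \<in> borel_measurable cellM" if "M > 0" for M
    using borel_measurable_continuous_on[OF continuous_radial_clamp[OF that] L2_cell_measurable[OF u]] .
  have "(\<lambda>n. LINT y|cellM. (cmod (u y - radial_clamp (real (Suc n)) (u y)))\<^sup>2) \<longlonglongrightarrow> (LINT y|(cellM :: (real ^ 'd) measure). 0)"
  proof (rule integral_dominated_convergence[OF _ _ intu])
    show "(\<lambda>y. (cmod (u y - radial_clamp (real (Suc n)) (u y)))\<^sup>2) \<in> borel_measurable cellM" for n
      using meas_clamp[of "real (Suc n)"] by measurable
    show "AE y in cellM. (\<lambda>n. (cmod (u y - radial_clamp (real (Suc n)) (u y)))\<^sup>2) \<longlonglongrightarrow> 0"
    proof (rule AE_I2)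
      fix y
      obtain N where N: "cmod (u y) \<le> real N" using real_arch_simple by blast
      show "(\<lambda>n. (cmod (u y - radial_clamp (real (Suc n)) (u y)))\<^sup>2) \<longlonglongrightarrow> 0"
      proof (rule tendsto_eventually, rule eventually_sequentiallyI[of N])
        fix n assume "N \<le> n"
        then have "cmod (u y) \<le> real (Suc n)" using N by simp
        then show "(cmod (u y - radial_clamp (real (Suc n)) (u y)))\<^sup>2 = 0" by (simp add: radial_clamp_eq)
      qed
    qed
    show "AE y in cellM. norm ((cmod (u y - radial_clamp (real (Suc n)) (u y)))\<^sup>2) \<le> (cmod (u y))\<^sup>2" for n
      by (intro AE_I2) (simp add: norm_diff_radial_clamp power_mono)
  qed simp
  then have "(\<lambda>n. LINT y|cellM. (cmod (u y - radial_clamp (real (Suc n)) (u y)))\<^sup>2) \<longlonglongrightarrow> 0" by simp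
  then have "eventually (\<lambda>n. (LINT y|cellM. (cmod (u y - radial_clamp (real (Suc n)) (u y)))\<^sup>2) < e / 9) sequentially"
    using e by (intro order_tendstoD) auto
  then obtain n0 where n0: "(LINT y|cellM. (cmod (u y - radial_clamp (real (Suc n0)) (u y)))\<^sup>2) < e / 9"
    by (meson eventually_happens trivial_limit_sequentially)
  define M where "M = real (Suc n0)"
  have M: "M > 0" by (simp add: M_def)
  define c where "c y = radial_clamp M (u y)" for y
  have c: "c \<in> L2_cell" unfolding c_def using meas_clamp[OF M] norm_radial_clamp[OF M]
    by (intro L2_cell_bounded[where M=M]) auto
  have 1: "(LINT y|cellM. (cmod (u y - c y))\<^sup>2) < e / 9" using n0 by (simp add: c_def M_def)

  have "u measurable_on cell" by (simp add: measurable_on_iff_borel_measurable)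
  then obtain N g where N: "negligible N" and g: "\<And>k. continuous_on UNIV (g k)"
    and lim: "\<And>y. y \<notin> N \<Longrightarrow> (\<lambda>k. g k y) \<longlonglongrightarrow> (if y \<in> cell then u y else 0)"
    unfolding measurable_on_def by blast
  define G where "G k z = of_real (cutoff k z) * radial_clamp M (g k (\<chi> j. Arg2pi (z $ j)))" for k and z :: "complex ^ 'd"
  have Gcont: "continuous_on torus (G k)" for k
    unfolding G_def
    by (rule continuous_on_torus_cutoff[where g="\<lambda>y. radial_clamp M (g k y)" and M=M])
      (auto simp: norm_radial_clamp M intro: continuous_on_compose2[OF continuous_radial_clamp[OF M] g])
  have Gbd: "cmod (G k z) \<le> M" for k z
    unfolding G_def norm_mult norm_of_real abs_of_nonneg[OF cutoff_bounds(1)]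
    by (rule order_trans[OF mult_left_le_one_le]) (use norm_radial_clamp[OF M] cutoff_bounds in auto)
  have wrapc: "continuous_on UNIV wrap" unfolding wrap_def
    by (intro continuous_intros)
  have Gw: "(\<lambda>y. G k (wrap y)) \<in> L2_cell" for k
  proof (rule L2_cell_bounded[where M=M])
    have "continuous_on UNIV (\<lambda>y. G k (wrap y))"
      using continuous_on_compose2[OF Gcont wrapc] wrap_in_torus by blast
    then show "(\<lambda>y. G k (wrap y)) \<in> borel_measurable cellM"
      by (intro borel_measurable_integrable continuous_integrable_cell)
  qed (simp add: Gbd)
  have "(\<lambda>k. LINT y|cellM. (cmod (c y - G k (wrap y)))\<^sup>2) \<longlonglongrightarrow> (LINT y|(cellM :: (real ^ 'd) measure). 0)"
  proof (rule integral_dominated_convergence[where w="\<lambda>_. (2 * M)\<^sup>2"])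
    show "integrable cellM (\<lambda>_. (2 * M)\<^sup>2)" by (rule finite_measure.integrable_const[OF finite_measure_cellM])
    show "(\<lambda>y. (cmod (c y - G k (wrap y)))\<^sup>2) \<in> borel_measurable cellM" for k
      using L2_cell_measurable[OF c] L2_cell_measurable[OF Gw[of k]] by measurable
    show "AE y in cellM. norm ((cmod (c y - G k (wrap y)))\<^sup>2) \<le> (2 * M)\<^sup>2" for k
    proof (rule AE_I2)
      fix y
      have "cmod (c y - G k (wrap y)) \<le> M + M"
        using norm_radial_clamp[OF M] Gbd unfolding c_def by (intro order_trans[OF norm_triangle_ineq4] add_mono) auto
      then have "(cmod (c y - G k (wrap y)))\<^sup>2 \<le> (2 * M)\<^sup>2" by (intro power_mono) auto
      then show "norm ((cmod (c y - G k (wrap y)))\<^sup>2) \<le> (2 * M)\<^sup>2" by simp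
    qed
    have neg: "negligible (N \<union> (\<Union>j. {y::real^'d. y $ j = 0}))"
      using N by (auto intro!: negligible_Union negligible_standard_hyperplane_cart)
    show "AE y in cellM. (\<lambda>k. (cmod (c y - G k (wrap y)))\<^sup>2) \<longlonglongrightarrow> 0"
    proof (rule AE_cellM_I[OF neg])
      fix y :: "real ^ 'd" assume y: "y \<in> cell" "y \<notin> N \<union> (\<Union>j. {y. y $ j = 0})"
      have "(\<lambda>k. cutoff k (wrap y)) \<longlonglongrightarrow> 1"
        using y cell_wrap_neq_1 by (intro cutoff_tendsto) auto
      moreover have "(\<lambda>k. g k y) \<longlonglongrightarrow> u y" using lim[of y] y by simp
      then have "(\<lambda>k. radial_clamp M (g k y)) \<longlonglongrightarrow> radial_clamp M (u y)"
        using continuous_radial_clamp[OF M, of UNIV]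
        by (intro isCont_tendsto_compose[of "u y" "radial_clamp M"]) (auto simp: continuous_on_eq_continuous_at)
      ultimately have "(\<lambda>k. (cmod (c y - of_real (cutoff k (wrap y)) * radial_clamp M (g k y)))\<^sup>2)
          \<longlonglongrightarrow> (cmod (c y - of_real 1 * radial_clamp M (u y)))\<^sup>2"
        by (intro tendsto_intros)
      then show "(\<lambda>k. (cmod (c y - G k (wrap y)))\<^sup>2) \<longlonglongrightarrow> 0"
        using Arg2pi_wrap[OF y(1)] by (simp add: G_def c_def)
    qed
  qed simp
  then have "(\<lambda>k. LINT y|cellM. (cmod (c y - G k (wrap y)))\<^sup>2) \<longlonglongrightarrow> 0" by simp
  then have "eventually (\<lambda>k. (LINT y|cellM. (cmod (c y - G k (wrap y)))\<^sup>2) < e / 9) sequentially"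
    using e by (intro order_tendstoD) auto
  then obtain k where 2: "(LINT y|cellM. (cmod (c y - G k (wrap y)))\<^sup>2) < e / 9"
    by (meson eventually_happens trivial_limit_sequentially)

  define V where "V = vol TYPE('d)"
  have V: "V > 0" unfolding V_def by (rule vol_pos)
  \<comment> \<open>A uniform distance \<open>d\<close> contributes \<open>d\<^sup>2 V = e / 9\<close> to the
    squared norm.\<close>
  define d where "d = sqrt (e / (9 * V))"
  have d: "d > 0" "d\<^sup>2 * V = e / 9" using e V by (auto simp: d_def)
  obtain T where T: "T \<in> trig_poly" "\<And>y. cmod (G k (wrap y) - T y) < d"
    using trig_poly_approx[OF Gcont d(1)] by blast
  have TL: "T \<in> L2_cell" using T(1) by (rule trig_poly_measurable)
  have int3: "integrable cellM (\<lambda>y. (cmod (u y - c y))\<^sup>2)"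
    "integrable cellM (\<lambda>y. (cmod (c y - G k (wrap y)))\<^sup>2)"
    "integrable cellM (\<lambda>y. (cmod (G k (wrap y) - T y))\<^sup>2)"
    "integrable cellM (\<lambda>y. (cmod (u y - T y))\<^sup>2)"
    using L2_cell_diff[OF u c] L2_cell_diff[OF c Gw[of k]] L2_cell_diff[OF Gw[of k] TL] L2_cell_diff[OF u TL]
    by (auto simp: L2_cell_def)
  have 3: "(LINT y|cellM. (cmod (G k (wrap y) - T y))\<^sup>2) \<le> e / 9"
  proof -
    have "(LINT y|cellM. (cmod (G k (wrap y) - T y))\<^sup>2) \<le> (LINT y|(cellM :: (real^'d) measure). d\<^sup>2)"
      using T(2) int3 finite_measure.integrable_const[OF finite_measure_cellM]
      by (intro integral_mono) (auto intro!: power_mono simp: less_imp_le)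
    also have "\<dots> = V * d\<^sup>2" using measure_cellM[where 'd='d] by (simp add: V_def)
    finally show ?thesis using d by (simp add: mult.commute)
  qed
  have "(cmod (u y - T y))\<^sup>2 \<le> 3 * (cmod (u y - c y))\<^sup>2 + 3 * (cmod (c y - G k (wrap y)))\<^sup>2
      + 3 * (cmod (G k (wrap y) - T y))\<^sup>2" for y
  proof -
    define p q r where "p = cmod (u y - c y)" and "q = cmod (c y - G k (wrap y))"
      and "r = cmod (G k (wrap y) - T y)"
    have "u y - T y = (u y - c y) + (c y - G k (wrap y)) + (G k (wrap y) - T y)" by simp
    then have "cmod (u y - T y) \<le> p + q + r"
      unfolding p_def q_def r_def by (metis norm_triangle_le norm_triangle_ineq add_right_mono order_trans)
    then have "(cmod (u y - T y))\<^sup>2 \<le> (p + q + r)\<^sup>2" by (intro power_mono) auto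
    also have "\<dots> \<le> 3 * p\<^sup>2 + 3 * q\<^sup>2 + 3 * r\<^sup>2"
      using sum_squares_bound[of p q] sum_squares_bound[of q r] sum_squares_bound[of p r]
      by (simp add: power2_eq_square algebra_simps)
    finally show ?thesis by (simp add: p_def q_def r_def)
  qed
  then have "(LINT y|cellM. (cmod (u y - T y))\<^sup>2) \<le> (LINT y|cellM. 3 * (cmod (u y - c y))\<^sup>2
      + 3 * (cmod (c y - G k (wrap y)))\<^sup>2 + 3 * (cmod (G k (wrap y) - T y))\<^sup>2)"
    using int3 by (intro integral_mono) auto
  also have "\<dots> = 3 * (LINT y|cellM. (cmod (u y - c y))\<^sup>2) + 3 * (LINT y|cellM. (cmod (c y - G k (wrap y)))\<^sup>2)
      + 3 * (LINT y|cellM. (cmod (G k (wrap y) - T y))\<^sup>2)"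
    using int3 by simp
  also have "\<dots> < e" using 1 2 3 by linarith
  finally show ?thesis using T(1) unfolding L2_norm_sq by blast
qed

text \<open>By density and the best approximation property the partial sums exceed any number below the
  claimed value; Bessel's inequality bounds them from above.\<close>

theorem Parseval:
  fixes u :: "real ^ 'd \<Rightarrow> complex"
  assumes u: "u \<in> L2_cell"
  shows "((\<lambda>n. (cmod (fc u n))\<^sup>2) has_sum (vol TYPE('d) * (L2_norm u)\<^sup>2)) UNIV"
proof -
  define V where "V = vol TYPE('d)"
  have V: "V > 0" unfolding V_def by (rule vol_pos)
  have dist: "(L2_norm (\<lambda>y. u y - (\<Sum>n\<in>F. a n * trig n y)))\<^sup>2
     = (L2_norm u)\<^sup>2 - (\<Sum>n\<in>F. (cmod (fc u n))\<^sup>2) / V + V * (\<Sum>n\<in>F. (cmod (a n - fc u n / V))\<^sup>2)"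
    if "finite F" for F a
    using dist_trig_sum[OF u that] by (simp add: V_def)
  have upper: "(\<Sum>n\<in>F. (cmod (fc u n))\<^sup>2) \<le> V * (L2_norm u)\<^sup>2" if F: "finite F" for F
  proof -
    have "0 \<le> (L2_norm u)\<^sup>2 - (\<Sum>n\<in>F. (cmod (fc u n))\<^sup>2) / V + V * (\<Sum>n\<in>F. (cmod (fc u n / V - fc u n / V))\<^sup>2)"
      unfolding dist[OF F, of "\<lambda>n. fc u n / V", symmetric] by simp
    then have "0 \<le> (L2_norm u)\<^sup>2 - (\<Sum>n\<in>F. (cmod (fc u n))\<^sup>2) / V" by simp
    then show ?thesis using V by (simp add: field_simps)
  qed
  have "eventually (\<lambda>F. dist (\<Sum>n\<in>F. (cmod (fc u n))\<^sup>2) (V * (L2_norm u)\<^sup>2) < e) (finite_subsets_at_top UNIV)"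
    if e: "e > 0" for e
  proof -
    obtain T where T: "T \<in> trig_poly" "(L2_norm (\<lambda>y. u y - T y))\<^sup>2 < e / V"
      using trig_poly_dense[OF u, of "e / V"] e V by auto
    obtain F0 a where F0: "finite F0" "T = (\<lambda>y. \<Sum>n\<in>F0. a n * trig n y)"
      using trig_poly_sum[OF T(1)] by blast
    have "(L2_norm u)\<^sup>2 - (\<Sum>n\<in>F0. (cmod (fc u n))\<^sup>2) / V \<le> (L2_norm (\<lambda>y. u y - T y))\<^sup>2"
      unfolding F0(2) dist[OF F0(1)] using V by (simp add: sum_nonneg)
    then have "(L2_norm u)\<^sup>2 - (\<Sum>n\<in>F0. (cmod (fc u n))\<^sup>2) / V < e / V" using T(2) by linarith
    then have "V * ((L2_norm u)\<^sup>2 - (\<Sum>n\<in>F0. (cmod (fc u n))\<^sup>2) / V) < V * (e / V)"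
      using V by (rule mult_strict_left_mono)
    then have low: "V * (L2_norm u)\<^sup>2 - e < (\<Sum>n\<in>F0. (cmod (fc u n))\<^sup>2)"
      using V by (simp add: right_diff_distrib)
    show ?thesis
      unfolding eventually_finite_subsets_at_top
    proof (intro exI[of _ F0] conjI allI impI)
      fix F assume F: "finite F \<and> F0 \<subseteq> F \<and> F \<subseteq> UNIV"
      then have "(\<Sum>n\<in>F0. (cmod (fc u n))\<^sup>2) \<le> (\<Sum>n\<in>F. (cmod (fc u n))\<^sup>2)"
        by (intro sum_mono2) auto
      then show "dist (\<Sum>n\<in>F. (cmod (fc u n))\<^sup>2) (V * (L2_norm u)\<^sup>2) < e"
        using low upper[of F] F by (simp add: dist_real_def)
    qed (use F0 in auto)
  qed
  then show ?thesis unfolding has_sum_def V_def[symmetric] by (intro tendstoI)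
qed

lemma AE_eq_if_fc_eq:
  assumes u: "u \<in> L2_cell" and v: "v \<in> L2_cell" and eq: "\<And>n. fc u n = fc v n"
  shows "AE y in cellM. u y = v y"
proof -
  let ?w = "\<lambda>y. u y - v y"
  have w: "?w \<in> L2_cell" using u v by (rule L2_cell_diff)
  have "fc ?w n = 0" for n
    using L2_inner_add_left[OF u L2_cell_cmult[OF v, of "-1"], of "trig n"] eq[of n]
      L2_inner_cmult_left[of "-1" v "trig n"]
    by (simp add: fc_def)
  then have "((\<lambda>n. 0) has_sum (vol TYPE('a) * (L2_norm ?w)\<^sup>2)) (UNIV :: (int^'a) set)"
    using Parseval[OF w] by simp
  then have "vol TYPE('a) * (L2_norm ?w)\<^sup>2 = 0" using has_sum_0_simp has_sum_unique by blast
  then have "L2_norm ?w = 0" using vol_pos[where 'd='a] by simp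
  then show ?thesis using L2_norm_eq_0[OF w] by simp
qed

section \<open>Weak derivatives on the torus\<close>

abbreviation ae_eq :: "(real ^ 'd \<Rightarrow> complex) \<Rightarrow> (real ^ 'd \<Rightarrow> complex) \<Rightarrow> bool" where
  "ae_eq u v \<equiv> AE y in cellM. u y = v y"

lemma L2_per_iff: "u \<in> L2_per \<longleftrightarrow> u \<in> borel_measurable lebesgue \<and> periodic u \<and> u \<in> L2_cell"
  by (auto simp: L2_per_def L2_cell_def measurable_restrict_space1)

lemma periodic_compose2:
  fixes f :: "real ^ 'd \<Rightarrow> 'b" and g :: "real ^ 'd \<Rightarrow> 'c"
  assumes "periodic f" "periodic g"
  shows "periodic (\<lambda>y. h (f y) (g y))"
  unfolding periodic_def
proof (intro allI impI)
  fix p :: "real ^ 'd" assume p: "\<forall>i. p $ i \<in> \<int>"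
  have "AE y in lebesgue. f (y + (2 * pi) *\<^sub>R p) = f y" "AE y in lebesgue. g (y + (2 * pi) *\<^sub>R p) = g y"
    using assms p by (auto simp: periodic_def)
  then show "AE y in lebesgue. h (f (y + (2 * pi) *\<^sub>R p)) (g (y + (2 * pi) *\<^sub>R p)) = h (f y) (g y)"
    by eventually_elim simp
qed

lemma periodic_const [simp]: "periodic (\<lambda>_. c)"
  by (simp add: periodic_def)

lemma L2_per_add: "u \<in> L2_per \<Longrightarrow> v \<in> L2_per \<Longrightarrow> (\<lambda>y. u y + v y) \<in> L2_per"
  by (auto simp: L2_per_iff intro: L2_cell_add periodic_compose2)

lemma L2_per_cmult: "u \<in> L2_per \<Longrightarrow> (\<lambda>y. c * u y) \<in> L2_per"
  using periodic_compose2[of u u "\<lambda>a b. c * a"] by (auto simp: L2_per_iff intro: L2_cell_cmult)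

lemma L2_per_cnj: "u \<in> L2_per \<Longrightarrow> (\<lambda>y. cnj (u y)) \<in> L2_per"
  using periodic_compose2[of u u "\<lambda>a b. cnj a"] borel_measurable_continuous_on[of cnj u lebesgue]
  by (auto simp: L2_per_iff continuous_intros intro: L2_cell_cnj)

lemma L2_cell_continuous:
  assumes "continuous_on UNIV f"
  shows "f \<in> L2_cell"
proof -
  have "integrable cellM (\<lambda>y. f y * cnj (f y))"
    using assms by (intro continuous_integrable_cell continuous_intros)
  then have "integrable cellM (\<lambda>y. Re (f y * cnj (f y)))" by (rule integrable_Re)
  moreover have "(\<lambda>y. Re (f y * cnj (f y))) = (\<lambda>y. (cmod (f y))\<^sup>2)"
    by (rule ext) (simp add: cmod_power2, simp add: power2_eq_square)
  ultimately have "integrable cellM (\<lambda>y. (cmod (f y))\<^sup>2)" by simp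
  then show ?thesis
    using borel_measurable_integrable[OF continuous_integrable_cell[OF assms]] by (simp add: L2_cell_def)
qed

lemma L2_per_const [simp]: "(\<lambda>_. c) \<in> L2_per"
  by (auto simp: L2_per_iff intro!: L2_cell_continuous continuous_intros)

lemma smooth_L2_cell: "smooth \<psi> \<Longrightarrow> \<psi> \<in> L2_cell"
  by (intro L2_cell_continuous smooth_continuous)

lemma L2_cell_mult': "u \<in> L2_cell \<Longrightarrow> v \<in> L2_cell \<Longrightarrow> integrable cellM (\<lambda>y. u y * v y)"
  using L2_cell_mult[OF _ L2_cell_cnj] by fastforce

lemma is_weak_pd_add:
  assumes "is_weak_pd j u g" "is_weak_pd j v h" "u \<in> L2_cell" "v \<in> L2_cell" "g \<in> L2_cell" "h \<in> L2_cell"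
  shows "is_weak_pd j (\<lambda>y. u y + v y) (\<lambda>y. g y + h y)"
  unfolding is_weak_pd_def
proof (intro allI impI)
  fix \<psi> :: "real ^ 'a \<Rightarrow> complex" assume \<psi>: "smooth \<psi> \<and> periodic \<psi>"
  then have L: "\<psi> \<in> L2_cell" "pd j \<psi> \<in> L2_cell" by (auto intro: smooth_L2_cell smooth_pd)
  show "(LINT y|cellM. (u y + v y) * pd j \<psi> y) = - (LINT y|cellM. (g y + h y) * \<psi> y)"
    using assms \<psi> L by (simp add: distrib_right L2_cell_mult' is_weak_pd_def)
qed

lemma is_weak_pd_cmult:
  assumes "is_weak_pd j u g"
  shows "is_weak_pd j (\<lambda>y. c * u y) (\<lambda>y. c * g y)"
  using assms by (simp add: is_weak_pd_def mult.assoc)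

lemma is_weak_pd_cong:
  assumes "ae_eq u v" "u \<in> L2_cell" "v \<in> L2_cell"
  shows "is_weak_pd j u g \<longleftrightarrow> is_weak_pd j v g"
proof -
  have "(LINT y|cellM. u y * pd j \<psi> y) = (LINT y|cellM. v y * pd j \<psi> y)" if "smooth \<psi>" for \<psi>
  proof (rule integral_cong_AE)
    have L: "pd j \<psi> \<in> L2_cell" using that by (intro smooth_L2_cell smooth_pd)
    show "(\<lambda>y. u y * pd j \<psi> y) \<in> borel_measurable cellM" "(\<lambda>y. v y * pd j \<psi> y) \<in> borel_measurable cellM"
      using assms L by (auto intro: borel_measurable_integrable L2_cell_mult')
    show "AE y in cellM. u y * pd j \<psi> y = v y * pd j \<psi> y"
      using assms(1) by eventually_elim simp
  qed
  then show ?thesis unfolding is_weak_pd_def by auto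
qed

lemma weak_pd_cong:
  assumes "ae_eq u v" "u \<in> L2_cell" "v \<in> L2_cell"
  shows "weak_pd j u = weak_pd j v"
  unfolding weak_pd_def using is_weak_pd_cong[OF assms] by simp

text \<open>The test function \<open>trig (- n)\<close> in the definition of the weak derivative.\<close>

lemma fc_weak_pd:
  assumes "is_weak_pd j u g"
  shows "fc g n = \<i> * of_int (n $ j) * fc u n"
proof -
  have "(LINT y|cellM. u y * pd j (trig (- n)) y) = - (LINT y|cellM. g y * trig (- n) y)"
    using assms smooth_trig periodic_trig unfolding is_weak_pd_def by blast
  moreover have "(LINT y|cellM. u y * pd j (trig (- n)) y)
      = (LINT y|cellM. (- (\<i> * of_int (n $ j))) * (u y * trig (- n) y))"
    by (rule Bochner_Integration.integral_cong[OF refl]) (simp add: pd_trig)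
  ultimately show ?thesis by (simp add: fc_def L2_inner_def cnj_trig)
qed

lemma H1_perD:
  assumes "u \<in> H1_per"
  shows "u \<in> L2_per" "weak_pd j u \<in> L2_per" "is_weak_pd j u (weak_pd j u)"
proof -
  show "u \<in> L2_per" using assms by (simp add: H1_per_def)
  have "\<exists>g. g \<in> L2_per \<and> is_weak_pd j u g" using assms by (auto simp: H1_per_def)
  then have "weak_pd j u \<in> L2_per \<and> is_weak_pd j u (weak_pd j u)"
    unfolding weak_pd_def by (rule someI_ex)
  then show "weak_pd j u \<in> L2_per" "is_weak_pd j u (weak_pd j u)" by auto
qed

lemma H1_per_L2_cell: "u \<in> H1_per \<Longrightarrow> u \<in> L2_cell" "u \<in> H1_per \<Longrightarrow> weak_pd j u \<in> L2_cell"
  by (auto intro: H1_perD L2_per_imp_L2_cell)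

lemma H1_perI:
  assumes "u \<in> L2_per" "\<And>j. g j \<in> L2_per" "\<And>j. is_weak_pd j u (g j)"
  shows "u \<in> H1_per"
  using assms by (auto simp: H1_per_def)

text \<open>The weak derivative is a choice among functions with the same Fourier coefficients, hence
  determined almost everywhere on the cell. All identities between weak derivatives below have this
  form.\<close>

lemma weak_pd_eqI:
  assumes "u \<in> H1_per" "g \<in> L2_per" "is_weak_pd j u g"
  shows "ae_eq (weak_pd j u) g"
  using assms H1_perD(2,3)[OF assms(1), of j]
  by (intro AE_eq_if_fc_eq L2_per_imp_L2_cell) (auto simp: fc_weak_pd)

lemma H1_per_cong:
  assumes "u \<in> H1_per" "v \<in> L2_per" "ae_eq u v"
  shows "v \<in> H1_per"
proof (rule H1_perI[OF assms(2)])
  show "weak_pd j u \<in> L2_per" for j using H1_perD(2)[OF assms(1)] .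
  show "is_weak_pd j v (weak_pd j u)" for j
    using H1_perD(3)[OF assms(1)]
      is_weak_pd_cong[OF assms(3) L2_per_imp_L2_cell[OF H1_perD(1)[OF assms(1)]] L2_per_imp_L2_cell[OF assms(2)]]
    by simp
qed

lemma H1_per_add:
  assumes "u \<in> H1_per" "v \<in> H1_per"
  shows "(\<lambda>y. u y + v y) \<in> H1_per"
    and "ae_eq (weak_pd j (\<lambda>y. u y + v y)) (\<lambda>y. weak_pd j u y + weak_pd j v y)"
proof -
  have w: "is_weak_pd j (\<lambda>y. u y + v y) (\<lambda>y. weak_pd j u y + weak_pd j v y)" for j
    using assms by (intro is_weak_pd_add H1_perD H1_per_L2_cell)
  have L: "(\<lambda>y. weak_pd j u y + weak_pd j v y) \<in> L2_per" for j
    using assms by (intro L2_per_add H1_perD)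
  show H: "(\<lambda>y. u y + v y) \<in> H1_per"
    by (rule H1_perI[OF _ L w]) (use assms in \<open>intro L2_per_add H1_perD\<close>)
  show "ae_eq (weak_pd j (\<lambda>y. u y + v y)) (\<lambda>y. weak_pd j u y + weak_pd j v y)"
    by (rule weak_pd_eqI[OF H L w])
qed

lemma H1_per_cmult:
  assumes "u \<in> H1_per"
  shows "(\<lambda>y. c * u y) \<in> H1_per"
    and "ae_eq (weak_pd j (\<lambda>y. c * u y)) (\<lambda>y. c * weak_pd j u y)"
proof -
  have w: "is_weak_pd j (\<lambda>y. c * u y) (\<lambda>y. c * weak_pd j u y)" for j
    using assms by (intro is_weak_pd_cmult H1_perD)
  have L: "(\<lambda>y. c * weak_pd j u y) \<in> L2_per" for j
    using assms by (intro L2_per_cmult H1_perD)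
  show H: "(\<lambda>y. c * u y) \<in> H1_per"
    by (rule H1_perI[OF _ L w]) (use assms in \<open>intro L2_per_cmult H1_perD\<close>)
  show "ae_eq (weak_pd j (\<lambda>y. c * u y)) (\<lambda>y. c * weak_pd j u y)"
    by (rule weak_pd_eqI[OF H L w])
qed

text \<open>A constant is weakly differentiable because derivatives of periodic test functions have integral
  zero.\<close>

lemma H1_per_const:
  "(\<lambda>_ :: real ^ 'd. c) \<in> H1_per" "ae_eq (weak_pd j (\<lambda>_ :: real ^ 'd. c)) (\<lambda>_. 0)"
proof -
  have w: "is_weak_pd j (\<lambda>_. c) (\<lambda>_. 0)" for j :: 'd
    by (auto simp: is_weak_pd_def integral_pd_zero)
  show H: "(\<lambda>_. c) \<in> (H1_per :: (real ^ 'd \<Rightarrow> complex) set)"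
    by (rule H1_perI[OF L2_per_const L2_per_const w])
  show "ae_eq (weak_pd j (\<lambda>_ :: real ^ 'd. c)) (\<lambda>_. 0)"
    by (rule weak_pd_eqI[OF H L2_per_const w])
qed

lemma foldr_pd_cnj:
  assumes "smooth \<psi>"
  shows "foldr pd js (\<lambda>y. cnj (\<psi> y)) = (\<lambda>y. cnj (foldr pd js \<psi> y))"
proof (induction js)
  case (Cons j js)
  have "pd j (\<lambda>y. cnj (foldr pd js \<psi> y)) x = cnj (pd j (foldr pd js \<psi>) x)" for x
  proof -
    have "foldr pd js \<psi> differentiable (at (x + 0 *\<^sub>R axis j 1))" using assms by (simp add: smooth_def)
    then have "(\<lambda>t. foldr pd js \<psi> (x + t *\<^sub>R axis j 1)) differentiable (at 0)"
      using differentiable_pd[of "foldr pd js \<psi>" x 0 j]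
      by (auto simp: has_vector_derivative_def differentiable_def)
    then show ?thesis unfolding pd_def by (rule vector_derivative_cnj)
  qed
  then show ?case using Cons by auto
qed simp

lemma smooth_cnj:
  assumes "smooth \<psi>"
  shows "smooth (\<lambda>y. cnj (\<psi> y))"
  unfolding smooth_def foldr_pd_cnj[OF assms]
proof (intro allI)
  fix js x
  obtain D where "(foldr pd js \<psi> has_derivative D) (at x)"
    using assms unfolding smooth_def differentiable_def by blast
  then have "((\<lambda>y. cnj (foldr pd js \<psi> y)) has_derivative (\<lambda>h. cnj (D h))) (at x)"
    by (rule bounded_linear.has_derivative[OF bounded_linear_cnj])
  then show "(\<lambda>y. cnj (foldr pd js \<psi> y)) differentiable (at x)"
    unfolding differentiable_def by blast
qed

lemma H1_per_cnj:
  assumes "u \<in> H1_per"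
  shows "(\<lambda>y. cnj (u y)) \<in> H1_per"
    and "ae_eq (weak_pd j (\<lambda>y. cnj (u y))) (\<lambda>y. cnj (weak_pd j u y))"
proof -
  have w: "is_weak_pd j (\<lambda>y. cnj (u y)) (\<lambda>y. cnj (weak_pd j u y))" for j
    unfolding is_weak_pd_def
  proof (intro allI impI)
    fix \<psi> :: "real ^ 'a \<Rightarrow> complex" assume \<psi>: "smooth \<psi> \<and> periodic \<psi>"
    then have per: "periodic (\<lambda>y. cnj (\<psi> y))" using periodic_compose2[of \<psi> \<psi> "\<lambda>a b. cnj a"] by simp
    have pd: "pd j (\<lambda>y. cnj (\<psi> y)) = (\<lambda>y. cnj (pd j \<psi> y))"
      using foldr_pd_cnj[of \<psi> "[j]"] \<psi> by simp
    have "(LINT y|cellM. u y * pd j (\<lambda>y. cnj (\<psi> y)) y) = - (LINT y|cellM. weak_pd j u y * cnj (\<psi> y))"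
      using H1_perD(3)[OF assms, of j] smooth_cnj \<psi> per unfolding is_weak_pd_def by blast
    then have "cnj (LINT y|cellM. u y * cnj (pd j \<psi> y)) = cnj (- (LINT y|cellM. weak_pd j u y * cnj (\<psi> y)))"
      unfolding pd by (rule arg_cong)
    then have "(LINT y|cellM. cnj (u y * cnj (pd j \<psi> y))) = - (LINT y|cellM. cnj (weak_pd j u y * cnj (\<psi> y)))"
      unfolding Bochner_Integration.integral_cnj by simp
    then show "(LINT y|cellM. cnj (u y) * pd j \<psi> y) = - (LINT y|cellM. cnj (weak_pd j u y) * \<psi> y)"
      by simp
  qed
  have L: "(\<lambda>y. cnj (weak_pd j u y)) \<in> L2_per" for j
    using assms by (intro L2_per_cnj H1_perD)
  show H: "(\<lambda>y. cnj (u y)) \<in> H1_per"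
    by (rule H1_perI[OF _ L w]) (use assms in \<open>intro L2_per_cnj H1_perD\<close>)
  show "ae_eq (weak_pd j (\<lambda>y. cnj (u y))) (\<lambda>y. cnj (weak_pd j u y))"
    by (rule weak_pd_eqI[OF H L w])
qed

lemma H2_perD:
  assumes "u \<in> H2_per"
  shows "u \<in> H1_per" "weak_pd j u \<in> H1_per"
  using assms by (auto simp: H2_per_def)

lemma H2_per_L2_cell:
  assumes "u \<in> H2_per"
  shows "u \<in> L2_cell" "weak_pd j u \<in> L2_cell" "weak_pd i (weak_pd j u) \<in> L2_cell"
  using H2_perD[OF assms] H1_per_L2_cell by auto

text \<open>A function \<open>g j\<close> that agrees with a weak derivative almost everywhere has exactly the
  same chosen weak derivatives, since the choice depends on integrals only.\<close>

lemma H2_perI: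
  assumes u: "u \<in> H1_per" and g: "\<And>j. g j \<in> H1_per" "\<And>j. ae_eq (weak_pd j u) (g j)"
  shows "u \<in> H2_per" "weak_pd i (weak_pd j u) = weak_pd i (g j)"
proof -
  have L: "weak_pd j u \<in> L2_cell" "g j \<in> L2_cell" for j using u g H1_per_L2_cell by auto
  show "weak_pd i (weak_pd j u) = weak_pd i (g j)" by (rule weak_pd_cong[OF g(2) L])
  have "weak_pd j u \<in> H1_per" for j
    by (rule H1_per_cong[OF g(1)[of j] H1_perD(2)[OF u]]) (use g(2)[of j] in \<open>auto elim: eventually_mono\<close>)
  then show "u \<in> H2_per" using u by (simp add: H2_per_def)
qed

lemma H2_per_add:
  assumes "u \<in> H2_per" "v \<in> H2_per"
  shows "(\<lambda>y. u y + v y) \<in> H2_per"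
    and "ae_eq (weak_pd i (weak_pd j (\<lambda>y. u y + v y))) (\<lambda>y. weak_pd i (weak_pd j u) y + weak_pd i (weak_pd j v) y)"
proof -
  note D = H2_perD[OF assms(1)] H2_perD[OF assms(2)]
  note I = H2_perI[of "\<lambda>y. u y + v y" "\<lambda>j y. weak_pd j u y + weak_pd j v y",
      OF H1_per_add(1)[OF D(1,3)] H1_per_add(1)[OF D(2,4)] H1_per_add(2)[OF D(1,3)]]
  show "(\<lambda>y. u y + v y) \<in> H2_per" by (rule I(1))
  show "ae_eq (weak_pd i (weak_pd j (\<lambda>y. u y + v y))) (\<lambda>y. weak_pd i (weak_pd j u) y + weak_pd i (weak_pd j v) y)"
    unfolding I(2) by (rule H1_per_add(2)[OF D(2,4)])
qed

lemma H2_per_cmult: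
  assumes "u \<in> H2_per"
  shows "(\<lambda>y. c * u y) \<in> H2_per"
    and "ae_eq (weak_pd i (weak_pd j (\<lambda>y. c * u y))) (\<lambda>y. c * weak_pd i (weak_pd j u) y)"
proof -
  note D = H2_perD[OF assms]
  note I = H2_perI[of "\<lambda>y. c * u y" "\<lambda>j y. c * weak_pd j u y",
      OF H1_per_cmult(1)[OF D(1)] H1_per_cmult(1)[OF D(2)] H1_per_cmult(2)[OF D(1)]]
  show "(\<lambda>y. c * u y) \<in> H2_per" by (rule I(1))
  show "ae_eq (weak_pd i (weak_pd j (\<lambda>y. c * u y))) (\<lambda>y. c * weak_pd i (weak_pd j u) y)"
    unfolding I(2) by (rule H1_per_cmult(2)[OF D(2)])
qed

lemma H2_per_cnj:
  assumes "u \<in> H2_per"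
  shows "(\<lambda>y. cnj (u y)) \<in> H2_per"
    and "ae_eq (weak_pd i (weak_pd j (\<lambda>y. cnj (u y)))) (\<lambda>y. cnj (weak_pd i (weak_pd j u) y))"
proof -
  note D = H2_perD[OF assms]
  note I = H2_perI[of "\<lambda>y. cnj (u y)" "\<lambda>j y. cnj (weak_pd j u y)",
      OF H1_per_cnj(1)[OF D(1)] H1_per_cnj(1)[OF D(2)] H1_per_cnj(2)[OF D(1)]]
  show "(\<lambda>y. cnj (u y)) \<in> H2_per" by (rule I(1))
  show "ae_eq (weak_pd i (weak_pd j (\<lambda>y. cnj (u y)))) (\<lambda>y. cnj (weak_pd i (weak_pd j u) y))"
    unfolding I(2) by (rule H1_per_cnj(2)[OF D(2)])
qed

lemma H2_per_const:
  "(\<lambda>_ :: real ^ 'd. c) \<in> H2_per" "ae_eq (weak_pd i (weak_pd j (\<lambda>_ :: real ^ 'd. c))) (\<lambda>_. 0)"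
proof -
  note I = H2_perI[of "\<lambda>_ :: real ^ 'd. c" "\<lambda>_ _. 0", OF H1_per_const(1) H1_per_const(1) H1_per_const(2)]
  show "(\<lambda>_ :: real ^ 'd. c) \<in> H2_per" by (rule I(1))
  show "ae_eq (weak_pd i (weak_pd j (\<lambda>_ :: real ^ 'd. c))) (\<lambda>_. 0)" unfolding I(2) by (rule H1_per_const(2))
qed

definition laplace :: "(real ^ 'd \<Rightarrow> complex) \<Rightarrow> real ^ 'd \<Rightarrow> complex" where
  "laplace u y = (\<Sum>j\<in>UNIV. weak_pd j (weak_pd j u) y)"

lemma laplace_L2_cell: "u \<in> H2_per \<Longrightarrow> laplace u \<in> L2_cell"
  unfolding laplace_def[abs_def] by (intro L2_cell_sum H2_per_L2_cell)

lemma fc_weak_pd_weak_pd: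
  assumes "u \<in> H2_per"
  shows "fc (weak_pd j u) n = \<i> * of_int (n $ j) * fc u n"
    and "fc (weak_pd i (weak_pd j u)) n = - of_int (n $ i) * of_int (n $ j) * fc u n"
  using fc_weak_pd[OF H1_perD(3)[OF H2_perD(1)[OF assms]], of j n]
    fc_weak_pd[OF H1_perD(3)[OF H2_perD(2)[OF assms]], of i j n]
  by (simp_all, simp add: complex_eq_iff algebra_simps)

lemma fc_laplace:
  assumes "u \<in> H2_per"
  shows "fc (laplace u) n = - of_int (\<Sum>j\<in>UNIV. (n $ j)\<^sup>2) * fc u n"
proof -
  have "fc (laplace u) n = (\<Sum>j\<in>UNIV. fc (weak_pd j (weak_pd j u)) n)"
    unfolding fc_def laplace_def[abs_def] using assms
    by (intro L2_inner_sum_left) (auto intro: H2_per_L2_cell)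
  then show ?thesis by (simp add: fc_weak_pd_weak_pd[OF assms] sum_distrib_right power2_eq_square sum_negf)
qed

lemma fc_zero_mean: "mean u = 0 \<longleftrightarrow> fc u 0 = 0" for u :: "real ^ 'd \<Rightarrow> complex"
  using vol_pos[where 'd='d] by (simp add: mean_def fc_def L2_inner_def vol_def)

lemma H2_norm_sq: "(H2_norm u)\<^sup>2 = (L2_norm u)\<^sup>2 + (\<Sum>j\<in>UNIV. (L2_norm (weak_pd j u))\<^sup>2)
     + (\<Sum>j\<in>UNIV. \<Sum>k\<in>UNIV. (L2_norm (weak_pd j (weak_pd k u)))\<^sup>2)"
  unfolding H2_norm_def by (intro real_sqrt_pow2 add_nonneg_nonneg sum_nonneg) auto

lemma H1_norm_le_H2_norm: "H1_norm u \<le> H2_norm u"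
  unfolding H1_norm_def H2_norm_def by (intro real_sqrt_le_mono) (simp add: sum_nonneg)

lemma has_sum_finite_sum:
  fixes f :: "'i \<Rightarrow> 'b \<Rightarrow> 'a::topological_comm_monoid_add"
  assumes "\<And>i. i \<in> I \<Longrightarrow> (f i has_sum s i) A"
  shows "((\<lambda>x. \<Sum>i\<in>I. f i x) has_sum (\<Sum>i\<in>I. s i)) A"
  using assms by (induction I rule: infinite_finite_induct) (auto intro: has_sum_add)

text \<open>On the Fourier side the left-hand side has the weight \<open>1 + |n|^2 + |n|^4\<close> and the
  Laplacian has \<open>|n|^4\<close>. The term \<open>n = 0\<close> is absent because of the zero mean, and
  \<open>|n| \<ge> 1\<close> otherwise.\<close>

theorem H2_norm_le_laplace:
  fixes u :: "real ^ 'd \<Rightarrow> complex"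
  assumes u: "u \<in> H2_per" and mean: "mean u = 0"
  shows "(H2_norm u)\<^sup>2 \<le> 3 * (L2_norm (laplace u))\<^sup>2"
proof -
  define V where "V = vol TYPE('d)"
  have V: "V > 0" unfolding V_def by (rule vol_pos)
  define q where "q n = real_of_int (\<Sum>j\<in>UNIV. (n $ j)\<^sup>2)" for n :: "int ^ 'd"
  have fcj: "(cmod (fc (weak_pd j u) n))\<^sup>2 = (real_of_int (n $ j))\<^sup>2 * (cmod (fc u n))\<^sup>2" for j n
    by (simp add: fc_weak_pd_weak_pd[OF u] norm_mult power_mult_distrib)
  have fcij: "(cmod (fc (weak_pd i (weak_pd j u)) n))\<^sup>2
      = (real_of_int (n $ i))\<^sup>2 * (real_of_int (n $ j))\<^sup>2 * (cmod (fc u n))\<^sup>2" for i j n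
    by (simp add: fc_weak_pd_weak_pd[OF u] norm_mult power_mult_distrib)
  have fcl: "(cmod (fc (laplace u) n))\<^sup>2 = (q n)\<^sup>2 * (cmod (fc u n))\<^sup>2" for n
    unfolding fc_laplace[OF u] q_def norm_mult norm_minus_cancel power_mult_distrib norm_of_int by simp
  have "((\<lambda>n. (cmod (fc u n))\<^sup>2 + (\<Sum>j\<in>UNIV. (cmod (fc (weak_pd j u) n))\<^sup>2)
      + (\<Sum>i\<in>UNIV. \<Sum>j\<in>UNIV. (cmod (fc (weak_pd i (weak_pd j u)) n))\<^sup>2))
      has_sum (V * (L2_norm u)\<^sup>2 + (\<Sum>j\<in>UNIV. V * (L2_norm (weak_pd j u))\<^sup>2)
        + (\<Sum>i\<in>UNIV. \<Sum>j\<in>UNIV. V * (L2_norm (weak_pd i (weak_pd j u)))\<^sup>2))) UNIV"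
    unfolding V_def
    by (intro has_sum_add has_sum_finite_sum Parseval H2_per_L2_cell[OF u])
  then have "((\<lambda>n. (cmod (fc u n))\<^sup>2 + q n * (cmod (fc u n))\<^sup>2 + (q n)\<^sup>2 * (cmod (fc u n))\<^sup>2)
      has_sum (V * (H2_norm u)\<^sup>2)) UNIV"
    unfolding H2_norm_sq fcj fcij
    by (simp add: q_def sum_distrib_right sum_distrib_left power2_eq_square[of "sum _ _"]
        distrib_left sum_product mult_ac)
  moreover have "((\<lambda>n. 3 * (cmod (fc (laplace u) n))\<^sup>2) has_sum (3 * (V * (L2_norm (laplace u))\<^sup>2))) UNIV"
    unfolding V_def by (intro has_sum_cmult_right Parseval laplace_L2_cell u)
  moreover have "(cmod (fc u n))\<^sup>2 + q n * (cmod (fc u n))\<^sup>2 + (q n)\<^sup>2 * (cmod (fc u n))\<^sup>2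
      \<le> 3 * (cmod (fc (laplace u) n))\<^sup>2" for n
  proof (cases "n = 0")
    case True
    then show ?thesis using mean by (simp add: fc_zero_mean)
  next
    case False
    then obtain j where "n $ j \<noteq> 0" by (auto simp: vec_eq_iff)
    then have "1 \<le> (n $ j)\<^sup>2" by (simp add: int_one_le_iff_zero_less)
    also have "\<dots> \<le> (\<Sum>j\<in>UNIV. (n $ j)\<^sup>2)" by (rule member_le_sum) auto
    finally have q: "1 \<le> q n" unfolding q_def by linarith
    have "q n * 1 \<le> q n * q n" using q by (intro mult_left_mono) auto
    then have "1 + q n + (q n)\<^sup>2 \<le> 3 * (q n)\<^sup>2" using q unfolding power2_eq_square by linarith
    then have "(1 + q n + (q n)\<^sup>2) * (cmod (fc u n))\<^sup>2 \<le> 3 * (q n)\<^sup>2 * (cmod (fc u n))\<^sup>2"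
      by (rule mult_right_mono) simp
    then show ?thesis unfolding fcl by (simp add: algebra_simps)
  qed
  ultimately have "V * (H2_norm u)\<^sup>2 \<le> 3 * (V * (L2_norm (laplace u))\<^sup>2)"
    by (rule has_sum_mono) 
  then show ?thesis using V by simp
qed

section \<open>The Sobolev space as an inner product space\<close>

definition H2_ip :: "(real ^ 'd \<Rightarrow> complex) \<Rightarrow> (real ^ 'd \<Rightarrow> complex) \<Rightarrow> real" where
  "H2_ip u v = Re (L2_inner u v) + (\<Sum>j\<in>UNIV. Re (L2_inner (weak_pd j u) (weak_pd j v)))
     + (\<Sum>j\<in>UNIV. \<Sum>k\<in>UNIV. Re (L2_inner (weak_pd j (weak_pd k u)) (weak_pd j (weak_pd k v))))"

definition h2_rel :: "(real ^ 'd \<Rightarrow> complex) \<Rightarrow> (real ^ 'd \<Rightarrow> complex) \<Rightarrow> bool" where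
  "h2_rel u v \<longleftrightarrow> u \<in> H2_per \<and> v \<in> H2_per \<and> ae_eq u v"

lemma h2_rel_refl [simp]: "h2_rel u u \<longleftrightarrow> u \<in> H2_per"
  by (simp add: h2_rel_def)

text \<open>As a type, the space has the calculus of sums and limits in normed spaces at its disposal.
  Equality almost everywhere is only required on the cell, which is all that the norms and forms see.\<close>

quotient_type (overloaded) 'd h2 = "real ^ ('d::finite) \<Rightarrow> complex" / partial: h2_rel
proof (rule part_equivpI)
  show "\<exists>u::real ^ 'd \<Rightarrow> complex. h2_rel u u" using H2_per_const(1) by auto
  show "symp (h2_rel :: (real ^ 'd \<Rightarrow> complex) \<Rightarrow> _)"
    by (auto simp: symp_def h2_rel_def elim: eventually_mono)
  show "transp (h2_rel :: (real ^ 'd \<Rightarrow> complex) \<Rightarrow> _)"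
  proof (rule transpI)
    fix u v w :: "real ^ 'd \<Rightarrow> complex" assume "h2_rel u v" "h2_rel v w"
    then show "h2_rel u w" unfolding h2_rel_def by (auto elim: eventually_elim2)
  qed
qed

lemma abs_h2_eq_iff:
  "u \<in> H2_per \<Longrightarrow> v \<in> H2_per \<Longrightarrow> abs_h2 u = abs_h2 v \<longleftrightarrow> ae_eq u v"
  using Quotient_rel[OF Quotient_h2, of u v] by (auto simp: h2_rel_def)

lemma h2_exhaust:
  obtains u where "u \<in> H2_per" "x = abs_h2 u"
  using h2.abs_induct[of "\<lambda>x. \<exists>u\<in>H2_per. x = abs_h2 u" x] by auto

lemma rep_h2 [simp]: "rep_h2 x \<in> H2_per" "abs_h2 (rep_h2 x) = x"
  using Quotient_rep_reflp[OF Quotient_h2, of x] Quotient_abs_rep[OF Quotient_h2, of x] by auto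

lemma rep_abs_h2: "u \<in> H2_per \<Longrightarrow> ae_eq (rep_h2 (abs_h2 u)) u"
  using abs_h2_eq_iff[of "rep_h2 (abs_h2 u)" u] by simp

lemma h2_rel_weak_pd: "h2_rel u v \<Longrightarrow> weak_pd j u = weak_pd j v"
  unfolding h2_rel_def by (intro weak_pd_cong) (auto intro: H2_per_L2_cell)

lemma H2_ip_cong:
  assumes "h2_rel u u'" "h2_rel v v'"
  shows "H2_ip u v = H2_ip u' v'"
proof -
  have "L2_inner u v = L2_inner u' v'"
    using assms unfolding h2_rel_def by (intro L2_inner_cong_AE H2_per_L2_cell) auto
  then show ?thesis unfolding H2_ip_def using assms[THEN h2_rel_weak_pd] by simp
qed

lemma H2_ip_sym: "H2_ip u v = H2_ip v u"
  unfolding H2_ip_def by (subst (1 2 3) L2_inner_cnj) simp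

lemma H2_ip_self: "H2_ip u u = (H2_norm u)\<^sup>2"
  unfolding H2_ip_def H2_norm_sq L2_inner_self by simp

lemma H2_ip_add:
  assumes u: "u \<in> H2_per" and v: "v \<in> H2_per" and w: "w \<in> H2_per"
  shows "H2_ip (\<lambda>y. u y + v y) w = H2_ip u w + H2_ip v w"
proof -
  note L = H2_per_L2_cell[OF u] H2_per_L2_cell[OF v] H2_per_L2_cell[OF w] H2_per_L2_cell[OF H2_per_add(1)[OF u v]]
  have 1: "L2_inner (weak_pd j (\<lambda>y. u y + v y)) (weak_pd j w)
      = L2_inner (weak_pd j u) (weak_pd j w) + L2_inner (weak_pd j v) (weak_pd j w)" for j
    by (subst L2_inner_add_left[symmetric]; (intro L)?)
      (intro L2_inner_cong_AE L L2_cell_add H1_per_add H2_perD u v, auto)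
  have 2: "L2_inner (weak_pd j (weak_pd k (\<lambda>y. u y + v y))) (weak_pd j (weak_pd k w))
      = L2_inner (weak_pd j (weak_pd k u)) (weak_pd j (weak_pd k w))
        + L2_inner (weak_pd j (weak_pd k v)) (weak_pd j (weak_pd k w))" for j k
    by (subst L2_inner_add_left[symmetric]; (intro L)?)
      (intro L2_inner_cong_AE L L2_cell_add H2_per_add u v, auto)
  show ?thesis
    unfolding H2_ip_def 1 2 by (simp add: L2_inner_add_left L sum.distrib)
qed

lemma H2_ip_cmult:
  assumes u: "u \<in> H2_per" and w: "w \<in> H2_per"
  shows "H2_ip (\<lambda>y. complex_of_real r * u y) w = r * H2_ip u w"
proof -
  note L = H2_per_L2_cell[OF u] H2_per_L2_cell[OF w] H2_per_L2_cell[OF H2_per_cmult(1)[OF u]]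
  have 1: "L2_inner (weak_pd j (\<lambda>y. complex_of_real r * u y)) (weak_pd j w)
      = complex_of_real r * L2_inner (weak_pd j u) (weak_pd j w)" for j
    unfolding L2_inner_cmult_left[symmetric]
    by (intro L2_inner_cong_AE L L2_cell_cmult H1_per_cmult H2_perD u) auto
  have 2: "L2_inner (weak_pd j (weak_pd k (\<lambda>y. complex_of_real r * u y))) (weak_pd j (weak_pd k w))
      = complex_of_real r * L2_inner (weak_pd j (weak_pd k u)) (weak_pd j (weak_pd k w))" for j k
    unfolding L2_inner_cmult_left[symmetric]
    by (intro L2_inner_cong_AE L L2_cell_cmult H2_per_cmult u) auto
  show ?thesis
    unfolding H2_ip_def 1 2 by (simp add: L2_inner_cmult_left sum_distrib_left distrib_left)
qed

instantiation h2 :: (finite) real_vector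
begin

lift_definition zero_h2 :: "'a h2" is "\<lambda>_. 0" by (simp add: H2_per_const)

lift_definition plus_h2 :: "'a h2 \<Rightarrow> 'a h2 \<Rightarrow> 'a h2" is "\<lambda>u v y. u y + v y"
  by (auto simp: h2_rel_def H2_per_add elim: eventually_elim2)

lift_definition uminus_h2 :: "'a h2 \<Rightarrow> 'a h2" is "\<lambda>u y. complex_of_real (- 1) * u y"
  by (auto simp: h2_rel_def simp del: of_real_minus of_real_1 intro: H2_per_cmult elim: eventually_mono)

lift_definition scaleR_h2 :: "real \<Rightarrow> 'a h2 \<Rightarrow> 'a h2" is "\<lambda>r u y. complex_of_real r * u y"
  by (auto simp: h2_rel_def H2_per_cmult elim: eventually_mono)

definition minus_h2 :: "'a h2 \<Rightarrow> 'a h2 \<Rightarrow> 'a h2" where "minus_h2 x y = x + - y"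
instance
proof
  fix x y z :: "'a h2" and r s :: real
  obtain u where u: "u \<in> H2_per" "x = abs_h2 u" by (rule h2_exhaust)
  obtain v where v: "v \<in> H2_per" "y = abs_h2 v" by (rule h2_exhaust)
  obtain w where w: "w \<in> H2_per" "z = abs_h2 w" by (rule h2_exhaust)
  note ops = plus_h2.abs_eq uminus_h2.abs_eq scaleR_h2.abs_eq zero_h2_def
  note [simp] = u v w ops H2_per_add H2_per_cmult H2_per_const
  show "x + y + z = x + (y + z)" by (simp add: add.assoc)
  show "x + y = y + x" by (simp add: add.commute)
  show "0 + x = x" by simp
  show "- x + x = 0" by (simp del: of_real_minus) simp
  show "x - y = x + - y" by (rule minus_h2_def)
  show "r *\<^sub>R (x + y) = r *\<^sub>R x + r *\<^sub>R y" by (simp add: distrib_left)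
  show "(r + s) *\<^sub>R x = r *\<^sub>R x + s *\<^sub>R x" by (simp add: distrib_right)
  show "r *\<^sub>R s *\<^sub>R x = (r * s) *\<^sub>R x" by (simp add: mult.assoc)
  show "1 *\<^sub>R x = x" by simp
qed

end

instantiation h2 :: (finite) real_inner
begin

lift_definition inner_h2 :: "'a h2 \<Rightarrow> 'a h2 \<Rightarrow> real" is H2_ip
  by (rule H2_ip_cong)

definition norm_h2 :: "'a h2 \<Rightarrow> real" where "norm_h2 x = sqrt (inner x x)"
definition dist_h2 :: "'a h2 \<Rightarrow> 'a h2 \<Rightarrow> real" where "dist_h2 x y = norm (x - y)"
definition sgn_h2 :: "'a h2 \<Rightarrow> 'a h2" where "sgn_h2 x = x /\<^sub>R norm x"
definition uniformity_h2 :: "('a h2 \<times> 'a h2) filter" where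
  "uniformity_h2 = (INF e\<in>{0<..}. principal {(x, y). dist x y < e})"
definition open_h2 :: "'a h2 set \<Rightarrow> bool" where
  "open_h2 U \<longleftrightarrow> (\<forall>x\<in>U. eventually (\<lambda>(x', y). x' = x \<longrightarrow> y \<in> U) uniformity)"

instance
proof
  fix x y z :: "'a h2" and r s :: real
  obtain u where u: "u \<in> H2_per" "x = abs_h2 u" by (rule h2_exhaust)
  obtain v where v: "v \<in> H2_per" "y = abs_h2 v" by (rule h2_exhaust)
  obtain w where w: "w \<in> H2_per" "z = abs_h2 w" by (rule h2_exhaust)
  note ops = plus_h2.abs_eq uminus_h2.abs_eq scaleR_h2.abs_eq inner_h2.abs_eq zero_h2_def
  note [simp] = u v w ops H2_per_add H2_per_cmult H2_per_const
  show "dist x y = norm (x - y)" by (rule dist_h2_def)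
  show "sgn x = x /\<^sub>R norm x" by (rule sgn_h2_def)
  show "uniformity = (INF e\<in>{0<..}. principal {(x::'a h2, y). dist x y < e})"
    by (rule uniformity_h2_def)
  show "open U = (\<forall>x\<in>U. \<forall>\<^sub>F (x', y) in uniformity. x' = x \<longrightarrow> y \<in> U)" for U :: "'a h2 set"
    by (rule open_h2_def)
  show "inner x y = inner y x" by (simp add: H2_ip_sym)
  show "inner (x + y) z = inner x z + inner y z" by (simp add: H2_ip_add)
  show "inner (r *\<^sub>R x) y = r * inner x y" by (simp add: H2_ip_cmult)
  show "0 \<le> inner x x" by (simp add: H2_ip_self)
  show "(inner x x = 0) = (x = 0)"
  proof
    assume "inner x x = 0"
    then have "(H2_norm u)\<^sup>2 = 0" by (simp add: H2_ip_self)
    then have "(L2_norm u)\<^sup>2 = 0"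
      unfolding H2_norm_sq
      by (smt (verit) sum_nonneg zero_le_power2)
    then have "ae_eq u (\<lambda>_. 0)" using u L2_norm_eq_0[OF H2_per_L2_cell(1)[OF u(1)]] by simp
    then show "x = 0" by (simp add: abs_h2_eq_iff)
  next
    assume "x = 0"
    have "0 *\<^sub>R z = (0 :: 'a h2)" by simp
    moreover have "inner (0 *\<^sub>R z) x = 0"
      using H2_ip_cmult[OF w(1) u(1), of 0] H2_per_cmult(1)[OF w(1), of "of_real 0"]
      by (simp only: u w scaleR_h2.abs_eq inner_h2.abs_eq h2_rel_refl mult_zero_left)
    ultimately show "inner x x = 0" using \<open>x = 0\<close> by (simp del: ops)
  qed
  show "norm x = sqrt (inner x x)" by (rule norm_h2_def)
qed

end

lemma norm_abs_h2: "u \<in> H2_per \<Longrightarrow> norm (abs_h2 u) = H2_norm u"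
  unfolding norm_h2_def by (simp add: inner_h2.abs_eq H2_ip_self) (simp add: H2_norm_def sum_nonneg)

lemma H2_norm_rep: "H2_norm (rep_h2 x) = norm x"
  using norm_abs_h2[of "rep_h2 x"] by simp

lemma abs_h2_add: "u \<in> H2_per \<Longrightarrow> v \<in> H2_per \<Longrightarrow> abs_h2 u + abs_h2 v = abs_h2 (\<lambda>y. u y + v y)"
  by (simp add: plus_h2.abs_eq)

lemma abs_h2_scaleR: "u \<in> H2_per \<Longrightarrow> r *\<^sub>R abs_h2 u = abs_h2 (\<lambda>y. of_real r * u y)"
  by (simp add: scaleR_h2.abs_eq)

lemma H2_per_diff: "u \<in> H2_per \<Longrightarrow> v \<in> H2_per \<Longrightarrow> (\<lambda>y. u y - v y) \<in> H2_per"
  using H2_per_add(1)[OF _ H2_per_cmult(1)[of v "-1"], of u] by simp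

lemma abs_h2_diff: "u \<in> H2_per \<Longrightarrow> v \<in> H2_per \<Longrightarrow> abs_h2 u - abs_h2 v = abs_h2 (\<lambda>y. u y - v y)"
  using abs_h2_add[of u "\<lambda>y. of_real (-1) * v y"] abs_h2_scaleR[of v "-1"] H2_per_cmult(1)[of v "-1"]
  by (simp add: diff_conv_add_uminus scaleR_minus1_left del: add_uminus_conv_diff)

lemma abs_h2_sum:
  assumes "\<And>i. i \<in> F \<Longrightarrow> u i \<in> H2_per"
  shows "(\<lambda>y. \<Sum>i\<in>F. u i y) \<in> H2_per \<and> (\<Sum>i\<in>F. abs_h2 (u i)) = abs_h2 (\<lambda>y. \<Sum>i\<in>F. u i y)"
  using assms
proof (induction F rule: infinite_finite_induct)
  case (insert i F)
  then show ?case by (auto simp: H2_per_add abs_h2_add)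
qed (auto simp: H2_per_const zero_h2_def)

lemma H2_analytic_at_imp_power_series:
  fixes f :: "real ^ 'd \<Rightarrow> real ^ 'd \<Rightarrow> complex"
  assumes "H2_analytic_at f x0"
  shows "\<exists>c. has_power_series c (\<lambda>x. abs_h2 (f x)) x0"
proof -
  obtain c r where r: "r > 0" and c: "\<And>\<beta>. c \<beta> \<in> H2_per"
    and f: "\<And>x. x \<in> ball x0 r \<Longrightarrow> f x \<in> H2_per"
    and lim: "\<And>x. x \<in> ball x0 r \<Longrightarrow>
       ((\<lambda>F. H2_norm (\<lambda>y. f x y - (\<Sum>\<beta>\<in>F. complex_of_real (mi_power (x - x0) \<beta>) * c \<beta> y)))
              \<longlongrightarrow> 0) (finite_subsets_at_top UNIV)"
    using assms unfolding H2_analytic_at_def by blast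
  have "((\<lambda>\<beta>. mi_power (x - x0) \<beta> *\<^sub>R abs_h2 (c \<beta>)) has_sum abs_h2 (f x)) UNIV"
    if x: "x \<in> ball x0 r" for x
  proof -
    have eq: "H2_norm (\<lambda>y. f x y - (\<Sum>\<beta>\<in>F. complex_of_real (mi_power (x - x0) \<beta>) * c \<beta> y))
        = norm ((\<Sum>\<beta>\<in>F. mi_power (x - x0) \<beta> *\<^sub>R abs_h2 (c \<beta>)) - abs_h2 (f x))" for F
    proof -
      let ?u = "\<lambda>\<beta> y. complex_of_real (mi_power (x - x0) \<beta>) * c \<beta> y"
      have u: "?u \<beta> \<in> H2_per" for \<beta> using c by (intro H2_per_cmult)
      have "(\<Sum>\<beta>\<in>F. mi_power (x - x0) \<beta> *\<^sub>R abs_h2 (c \<beta>)) = (\<Sum>\<beta>\<in>F. abs_h2 (?u \<beta>))"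
        using c by (simp add: abs_h2_scaleR)
      also have "\<dots> = abs_h2 (\<lambda>y. \<Sum>\<beta>\<in>F. ?u \<beta> y)" using abs_h2_sum[of F ?u] u by blast
      finally have d: "abs_h2 (f x) - (\<Sum>\<beta>\<in>F. mi_power (x - x0) \<beta> *\<^sub>R abs_h2 (c \<beta>))
          = abs_h2 (\<lambda>y. f x y - (\<Sum>\<beta>\<in>F. ?u \<beta> y))"
        using abs_h2_diff[OF f[OF x], of "\<lambda>y. \<Sum>\<beta>\<in>F. ?u \<beta> y"] abs_h2_sum[of F ?u] u by simp
      have "(\<lambda>y. f x y - (\<Sum>\<beta>\<in>F. ?u \<beta> y)) \<in> H2_per"
        using abs_h2_sum[of F ?u] u by (intro H2_per_diff f x) auto
      then show ?thesis
        by (subst norm_minus_commute) (simp only: d norm_abs_h2)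
    qed
    show ?thesis
      using lim[OF x] unfolding eq has_sum_def by (simp add: tendsto_norm_zero_iff LIM_zero_iff)
  qed
  then show ?thesis unfolding has_power_series_def using r by (intro exI[of _ "\<lambda>\<beta>. abs_h2 (c \<beta>)"] exI[of _ r]) auto
qed

text \<open>The choice in \<open>H2_pd\<close> is of a limit in the \<open>H\<^sup>2\<close> norm; in
  \<open>h2\<close> such a limit is unique, and a representative of \<open>D\<close> shows that one
  exists.\<close>

lemma H2_pd_abs_h2:
  assumes U: "open U" "x \<in> U" and f: "\<And>y. y \<in> U \<Longrightarrow> f y \<in> H2_per"
    and D: "has_pd j (\<lambda>y. abs_h2 (f y)) x D"
  shows "H2_pd j f x \<in> H2_per \<and> abs_h2 (H2_pd j f x) = D"
proof -
  define N where "N g t = H2_norm (\<lambda>y. (f (x + t *\<^sub>R axis j 1) y - f x y) / complex_of_real t - g y)" for g t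
  have "((\<lambda>t. x + t *\<^sub>R axis j (1::real)) \<longlongrightarrow> x + 0 *\<^sub>R axis j 1) (at 0)"
    by (intro tendsto_intros)
  then have "eventually (\<lambda>t. x + t *\<^sub>R axis j 1 \<in> U) (at 0)"
    using U by (auto dest!: topological_tendstoD)
  then have ev: "eventually (\<lambda>t. N g t
      = norm ((1/t) *\<^sub>R (abs_h2 (f (x + t *\<^sub>R axis j 1)) - abs_h2 (f x)) - abs_h2 g)) (at 0)"
    if g: "g \<in> H2_per" for g
  proof eventually_elim
    case (elim t)
    let ?q = "\<lambda>y. complex_of_real (1/t) * (f (x + t *\<^sub>R axis j 1) y - f x y)"
    have q: "?q \<in> H2_per" using f[OF elim] f[OF U(2)] by (intro H2_per_cmult H2_per_diff)
    have "(1/t) *\<^sub>R (abs_h2 (f (x + t *\<^sub>R axis j 1)) - abs_h2 (f x)) - abs_h2 g = abs_h2 (\<lambda>y. ?q y - g y)"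
      using f[OF elim] f[OF U(2)] g q by (simp add: abs_h2_diff abs_h2_scaleR H2_per_diff)
    then show ?case using q g norm_abs_h2[of "\<lambda>y. ?q y - g y"]
      by (simp add: N_def H2_per_diff)
  qed
  have iff: "(N g \<longlongrightarrow> 0) (at 0) \<longleftrightarrow> has_pd j (\<lambda>y. abs_h2 (f y)) x (abs_h2 g)" if g: "g \<in> H2_per" for g
  proof -
    have "(N g \<longlongrightarrow> 0) (at 0) \<longleftrightarrow>
      ((\<lambda>t. norm ((1/t) *\<^sub>R (abs_h2 (f (x + t *\<^sub>R axis j 1)) - abs_h2 (f x)) - abs_h2 g)) \<longlongrightarrow> 0) (at 0)"
      by (rule tendsto_cong[OF ev[OF g]])
    also have "\<dots> \<longleftrightarrow> has_pd j (\<lambda>y. abs_h2 (f y)) x (abs_h2 g)"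
      unfolding has_pd_def by (simp only: tendsto_norm_zero_iff LIM_zero_iff)
    finally show ?thesis .
  qed
  have "\<exists>g. g \<in> H2_per \<and> (N g \<longlongrightarrow> 0) (at 0)"
    using D iff[of "rep_h2 D"] by (intro exI[of _ "rep_h2 D"]) simp
  then have "H2_pd j f x \<in> H2_per \<and> (N (H2_pd j f x) \<longlongrightarrow> 0) (at 0)"
    unfolding H2_pd_def N_def by (rule someI_ex)
  then have *: "H2_pd j f x \<in> H2_per" "has_pd j (\<lambda>y. abs_h2 (f y)) x (abs_h2 (H2_pd j f x))"
    using iff by auto
  have "abs_h2 (H2_pd j f x) = D" using pd_eqI[OF *(2)] pd_eqI[OF D] by simp
  then show ?thesis using * by simp
qed

lemma foldr_H2_pd:
  fixes f :: "real ^ 'd \<Rightarrow> real ^ 'd \<Rightarrow> complex"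
  assumes U: "open U" and f: "\<And>x. x \<in> U \<Longrightarrow> f x \<in> H2_per"
    and c: "\<And>x. x \<in> U \<Longrightarrow> has_power_series (c x) (\<lambda>x. abs_h2 (f x)) x"
  shows "x \<in> U \<Longrightarrow> foldr H2_pd js f x \<in> H2_per \<and>
           abs_h2 (foldr H2_pd js f x) = foldr pd js (\<lambda>x. abs_h2 (f x)) x"
proof (induction js arbitrary: x)
  case (Cons j js)
  let ?F = "foldr pd js (\<lambda>x. abs_h2 (f x))"
  have "has_power_series (foldr shift_coeffs js (c x)) ?F x"
    by (rule has_power_series_foldr_pd[OF U c Cons.prems])
  then have "has_pd j ?F x (pd j ?F x)" using has_power_series_has_pd pd_eqI by metis
  then have "has_pd j (\<lambda>x. abs_h2 (foldr H2_pd js f x)) x (pd j ?F x)"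
    using Cons by (subst has_pd_cong[OF U Cons.prems]) auto
  from H2_pd_abs_h2[OF U Cons.prems _ this] Cons.IH show ?case by simp
qed (use f in auto)

section \<open>Expansion of the Bloch form along a line\<close>

lemma L2_norm_add_le:
  assumes u: "u \<in> L2_cell" and v: "v \<in> L2_cell"
  shows "L2_norm (\<lambda>y. u y + v y) \<le> L2_norm u + L2_norm v"
proof (rule power2_le_imp_le)
  have "complex_of_real ((L2_norm (\<lambda>y. u y + v y))\<^sup>2)
      = L2_inner u u + L2_inner u v + (L2_inner v u + L2_inner v v)"
    unfolding L2_inner_self[symmetric] using u v
    by (simp add: L2_inner_add_left L2_inner_add_right L2_cell_add)
  also have "L2_inner v u = cnj (L2_inner u v)" by (rule L2_inner_cnj)
  finally have "(L2_norm (\<lambda>y. u y + v y))\<^sup>2 = (L2_norm u)\<^sup>2 + 2 * Re (L2_inner u v) + (L2_norm v)\<^sup>2"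
    unfolding L2_inner_self by (simp add: complex_eq_iff)
  also have "\<dots> \<le> (L2_norm u)\<^sup>2 + 2 * (L2_norm u * L2_norm v) + (L2_norm v)\<^sup>2"
    using complex_Re_le_cmod[of "L2_inner u v"] L2_Cauchy_Schwarz[OF u v] by linarith
  finally show "(L2_norm (\<lambda>y. u y + v y))\<^sup>2 \<le> (L2_norm u + L2_norm v)\<^sup>2"
    by (simp add: power2_sum)
qed simp

lemma L2_norm_cmult: "L2_norm (\<lambda>y. c * u y) = cmod c * L2_norm u"
  unfolding L2_norm_def by (simp add: norm_mult power_mult_distrib real_sqrt_mult)

lemma L2_norm_zero [simp]: "L2_norm (\<lambda>_. 0) = 0"
  by (simp add: L2_norm_def)

lemma L2_norm_sum_le:
  assumes "\<And>i. i \<in> F \<Longrightarrow> u i \<in> L2_cell"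
  shows "L2_norm (\<lambda>y. \<Sum>i\<in>F. u i y) \<le> (\<Sum>i\<in>F. L2_norm (u i))"
  using assms
proof (induction F rule: infinite_finite_induct)
  case (insert i F)
  have "L2_norm (\<lambda>y. u i y + (\<Sum>i\<in>F. u i y)) \<le> L2_norm (u i) + L2_norm (\<lambda>y. \<Sum>i\<in>F. u i y)"
    using insert.prems by (intro L2_norm_add_le L2_cell_sum) auto
  then show ?case using insert by simp
qed auto

lemma L2_norm_bmult:
  assumes u: "u \<in> L2_cell" and a: "a \<in> borel_measurable cellM"
    and M: "AE y in cellM. cmod (a y) \<le> M" "M \<ge> 0"
  shows "L2_norm (\<lambda>y. a y * u y) \<le> M * L2_norm u"
proof (rule power2_le_imp_le)
  have "(L2_norm (\<lambda>y. a y * u y))\<^sup>2 \<le> (LINT y|cellM. M\<^sup>2 * (cmod (u y))\<^sup>2)"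
    unfolding L2_norm_sq
  proof (rule integral_mono_AE)
    show "integrable cellM (\<lambda>y. (cmod (a y * u y))\<^sup>2)" "integrable cellM (\<lambda>y. M\<^sup>2 * (cmod (u y))\<^sup>2)"
      using L2_cell_bmult[OF u a M(1)] u by (auto simp: L2_cell_def)
    show "AE y in cellM. (cmod (a y * u y))\<^sup>2 \<le> M\<^sup>2 * (cmod (u y))\<^sup>2"
      using M(1)
    proof eventually_elim
      case (elim y)
      then have "(cmod (a y))\<^sup>2 \<le> M\<^sup>2" by (intro power_mono) auto
      then show ?case by (simp add: norm_mult power_mult_distrib mult_right_mono)
    qed
  qed
  also have "\<dots> = (M * L2_norm u)\<^sup>2" by (simp add: power_mult_distrib L2_norm_sq)
  finally show "(L2_norm (\<lambda>y. a y * u y))\<^sup>2 \<le> (M * L2_norm u)\<^sup>2" .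
qed (use M in simp)

lemma H2_norm_nonneg [simp]: "H2_norm u \<ge> 0"
  unfolding H2_norm_def by (intro real_sqrt_ge_zero add_nonneg_nonneg sum_nonneg) auto

lemma L2_norm_le_H2_norm:
  "L2_norm u \<le> H2_norm u" "L2_norm (weak_pd j u) \<le> H2_norm u"
  "L2_norm (weak_pd i (weak_pd j u)) \<le> H2_norm u"
proof -
  define a b c where "a = (L2_norm u)\<^sup>2" and "b = (\<Sum>j\<in>UNIV. (L2_norm (weak_pd j u))\<^sup>2)"
    and "c = (\<Sum>i\<in>UNIV. \<Sum>j\<in>UNIV. (L2_norm (weak_pd i (weak_pd j u)))\<^sup>2)"
  have sq: "(H2_norm u)\<^sup>2 = a + b + c" by (simp add: H2_norm_sq a_def b_def c_def)
  have nn: "a \<ge> 0" "b \<ge> 0" "c \<ge> 0" "H2_norm u \<ge> 0"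
    by (auto simp: a_def b_def c_def intro!: sum_nonneg)
  have "(L2_norm (weak_pd j u))\<^sup>2 \<le> b" unfolding b_def by (rule member_le_sum) auto
  moreover have "(L2_norm (weak_pd i (weak_pd j u)))\<^sup>2 \<le> c"
  proof -
    have "(L2_norm (weak_pd i (weak_pd j u)))\<^sup>2 \<le> (\<Sum>j\<in>UNIV. (L2_norm (weak_pd i (weak_pd j u)))\<^sup>2)"
      by (rule member_le_sum) auto
    also have "\<dots> \<le> c" unfolding c_def by (rule member_le_sum) (auto intro: sum_nonneg)
    finally show ?thesis .
  qed
  ultimately have "(L2_norm u)\<^sup>2 \<le> (H2_norm u)\<^sup>2" "(L2_norm (weak_pd j u))\<^sup>2 \<le> (H2_norm u)\<^sup>2"
    "(L2_norm (weak_pd i (weak_pd j u)))\<^sup>2 \<le> (H2_norm u)\<^sup>2"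
    using nn sq a_def by linarith+
  then show "L2_norm u \<le> H2_norm u" "L2_norm (weak_pd j u) \<le> H2_norm u"
    "L2_norm (weak_pd i (weak_pd j u)) \<le> H2_norm u"
    using nn(4) power2_le_imp_le by blast+
qed

text \<open>The coefficients of \<open>t^a\<close> in the shifted gradient and in the shifted Laplacian at
  \<open>\<eta> = t \<xi>\<close>. They are zero from some index on, so that the Cauchy products below make
  sense for every order.\<close>

definition grad_part :: "real ^ 'd \<Rightarrow> nat \<Rightarrow> (real ^ 'd \<Rightarrow> complex) \<Rightarrow> 'd \<Rightarrow> real ^ 'd \<Rightarrow> complex" where
  "grad_part \<xi> a u j = (if a = 0 then weak_pd j u
     else if a = 1 then (\<lambda>y. \<i> * of_real (\<xi> $ j) * u y) else (\<lambda>_. 0))"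

definition lap_part :: "real ^ 'd \<Rightarrow> nat \<Rightarrow> (real ^ 'd \<Rightarrow> complex) \<Rightarrow> real ^ 'd \<Rightarrow> complex" where
  "lap_part \<xi> a u = (if a = 0 then laplace u
     else if a = 1 then (\<lambda>y. \<Sum>j\<in>UNIV. 2 * \<i> * of_real (\<xi> $ j) * weak_pd j u y)
     else if a = 2 then (\<lambda>y. - of_real ((norm \<xi>)\<^sup>2) * u y) else (\<lambda>_. 0))"

lemma shifted_grad_expand:
  "shifted_grad (t *\<^sub>R \<xi>) u j = (\<lambda>y. \<Sum>a\<le>2. of_real (t ^ a) * grad_part \<xi> a u j y)"
  by (rule ext) (simp add: shifted_grad_def grad_part_def numeral_2_eq_2 algebra_simps)

lemma shifted_lap_expand:
  "shifted_lap (t *\<^sub>R \<xi>) u = (\<lambda>y. \<Sum>a\<le>2. of_real (t ^ a) * lap_part \<xi> a u y)"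
proof (rule ext)
  fix y
  have *: "(norm (t *\<^sub>R \<xi>))\<^sup>2 = t\<^sup>2 * (norm \<xi>)\<^sup>2" by (simp add: power_mult_distrib)
  have "{..2::nat} = {0, 1, 2}" by auto
  then show "shifted_lap (t *\<^sub>R \<xi>) u y = (\<Sum>a\<le>2. of_real (t ^ a) * lap_part \<xi> a u y)"
    unfolding shifted_lap_def * by (simp add: lap_part_def laplace_def sum_distrib_left mult_ac)
qed

lemma grad_part_L2 : "u \<in> H2_per \<Longrightarrow> grad_part \<xi> a u j \<in> L2_cell"
  unfolding grad_part_def by (auto intro!: H2_per_L2_cell L2_cell_cmult)

lemma lap_part_L2 : "u \<in> H2_per \<Longrightarrow> lap_part \<xi> a u \<in> L2_cell"
proof -
  assume u: "u \<in> H2_per"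
  have 1: "(\<lambda>y. \<Sum>j\<in>UNIV. 2 * \<i> * of_real (\<xi> $ j) * weak_pd j u y) \<in> L2_cell"
    by (intro L2_cell_sum L2_cell_cmult H2_per_L2_cell u)
  have 2: "(\<lambda>y. - of_real ((norm \<xi>)\<^sup>2) * u y) \<in> L2_cell"
    by (intro L2_cell_cmult H2_per_L2_cell u)
  show ?thesis using laplace_L2_cell[OF u] 1 2 by (auto simp: lap_part_def)
qed

definition part_bound :: "real ^ 'd \<Rightarrow> real" where
  "part_bound \<xi> = 1 + real CARD('d) + 2 * (\<Sum>j\<in>UNIV. \<bar>\<xi> $ j\<bar>) + (norm \<xi>)\<^sup>2"

lemma part_bound_ge: "part_bound \<xi> \<ge> 1"
  unfolding part_bound_def by (simp add: sum_nonneg)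

lemma grad_part_norm:
  "L2_norm (grad_part \<xi> a u j) \<le> part_bound \<xi> * H2_norm u"
proof -
  have *: "c * x \<le> part_bound \<xi> * H2_norm u" if "c \<le> part_bound \<xi>" "0 \<le> x" "x \<le> H2_norm u" for c x
    using that part_bound_ge[of \<xi>] by (intro mult_mono) auto
  have "\<bar>\<xi> $ j\<bar> \<le> (\<Sum>j\<in>UNIV. \<bar>\<xi> $ j\<bar>)" by (rule member_le_sum) auto
  moreover have "0 \<le> (\<Sum>j\<in>UNIV. \<bar>\<xi> $ j\<bar>)" "0 \<le> (norm \<xi>)\<^sup>2" "0 \<le> real CARD('a)"
    by (auto intro: sum_nonneg)
  ultimately have 1: "\<bar>\<xi> $ j\<bar> \<le> part_bound \<xi>" unfolding part_bound_def by linarith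
  show ?thesis
    using *[of 1 "L2_norm (weak_pd j u)"] *[of "\<bar>\<xi> $ j\<bar>" "L2_norm u"] part_bound_ge[of \<xi>] 1
    by (auto simp: grad_part_def L2_norm_cmult L2_norm_le_H2_norm norm_mult)
qed

lemma lap_part_norm:
  fixes u :: "real ^ 'd \<Rightarrow> complex"
  assumes u: "u \<in> H2_per"
  shows "L2_norm (lap_part \<xi> a u) \<le> part_bound \<xi> * H2_norm u"
proof -
  have *: "c * H2_norm u \<le> part_bound \<xi> * H2_norm u" if "c \<le> part_bound \<xi>" for c
    using that by (intro mult_right_mono) auto
  have "L2_norm (laplace u) \<le> (\<Sum>j\<in>UNIV. L2_norm (weak_pd j (weak_pd j u)))"
    unfolding laplace_def[abs_def] by (intro L2_norm_sum_le H2_per_L2_cell u)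
  also have "\<dots> \<le> (\<Sum>j\<in>(UNIV :: 'd set). H2_norm u)" by (intro sum_mono L2_norm_le_H2_norm)
  also have "\<dots> = real CARD('d) * H2_norm u" by simp
  also have "\<dots> \<le> part_bound \<xi> * H2_norm u" by (rule *) (simp add: part_bound_def sum_nonneg)
  finally have 0: "L2_norm (laplace u) \<le> part_bound \<xi> * H2_norm u" .
  have "L2_norm (\<lambda>y. \<Sum>j\<in>UNIV. 2 * \<i> * of_real (\<xi> $ j) * weak_pd j u y)
      \<le> (\<Sum>j\<in>UNIV. L2_norm (\<lambda>y. 2 * \<i> * of_real (\<xi> $ j) * weak_pd j u y))"
    by (intro L2_norm_sum_le L2_cell_cmult H2_per_L2_cell u)
  also have "\<dots> \<le> (\<Sum>j\<in>UNIV. 2 * \<bar>\<xi> $ j\<bar> * H2_norm u)"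
    by (intro sum_mono) (simp add: L2_norm_cmult norm_mult mult_left_mono L2_norm_le_H2_norm)
  also have "\<dots> = (2 * (\<Sum>j\<in>UNIV. \<bar>\<xi> $ j\<bar>)) * H2_norm u"
    by (simp add: sum_distrib_left sum_distrib_right)
  also have "\<dots> \<le> part_bound \<xi> * H2_norm u" by (rule *) (simp add: part_bound_def)
  finally have 1: "L2_norm (\<lambda>y. \<Sum>j\<in>UNIV. 2 * \<i> * of_real (\<xi> $ j) * weak_pd j u y) \<le> part_bound \<xi> * H2_norm u" .
  have "L2_norm (\<lambda>y. - of_real ((norm \<xi>)\<^sup>2) * u y) = (norm \<xi>)\<^sup>2 * L2_norm u"
    unfolding L2_norm_cmult norm_minus_cancel norm_of_real by simp
  also have "\<dots> \<le> (norm \<xi>)\<^sup>2 * H2_norm u" by (intro mult_left_mono L2_norm_le_H2_norm) simp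
  also have "\<dots> \<le> part_bound \<xi> * H2_norm u" by (rule *) (simp add: part_bound_def sum_nonneg)
  finally have 2: "L2_norm (\<lambda>y. - of_real ((norm \<xi>)\<^sup>2) * u y) \<le> part_bound \<xi> * H2_norm u" .
  show ?thesis using 0 1 2 part_bound_ge[of \<xi>] unfolding lap_part_def by auto
qed

lemma grad_part_add:
  assumes "u \<in> H2_per" "v \<in> H2_per"
  shows "ae_eq (grad_part \<xi> a (\<lambda>y. u y + v y) j) (\<lambda>y. grad_part \<xi> a u j y + grad_part \<xi> a v j y)"
  using H1_per_add(2)[OF H2_perD(1)[OF assms(1)] H2_perD(1)[OF assms(2)], where j=j]
  by (auto simp: grad_part_def distrib_left)

lemma grad_part_cmult:
  assumes "u \<in> H2_per"
  shows "ae_eq (grad_part \<xi> a (\<lambda>y. c * u y) j) (\<lambda>y. c * grad_part \<xi> a u j y)"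
  using H1_per_cmult(2)[OF H2_perD(1)[OF assms], where j=j and c=c]
  by (auto simp: grad_part_def mult_ac)

lemma lap_part_add:
  assumes "u \<in> H2_per" "v \<in> H2_per"
  shows "ae_eq (lap_part \<xi> a (\<lambda>y. u y + v y)) (\<lambda>y. lap_part \<xi> a u y + lap_part \<xi> a v y)"
proof -
  have 1: "AE y in cellM. \<forall>j. weak_pd j (\<lambda>y. u y + v y) y = weak_pd j u y + weak_pd j v y"
    using H1_per_add(2)[OF H2_perD(1)[OF assms(1)] H2_perD(1)[OF assms(2)]]
    by (intro eventually_all_finite)
  have 2: "AE y in cellM. \<forall>j. weak_pd j (weak_pd j (\<lambda>y. u y + v y)) y
      = weak_pd j (weak_pd j u) y + weak_pd j (weak_pd j v) y"
    using H2_per_add(2)[OF assms] by (intro eventually_all_finite)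
  show ?thesis
    using 1 2 by eventually_elim (simp add: lap_part_def laplace_def sum.distrib distrib_left algebra_simps)
qed

lemma lap_part_cmult:
  assumes "u \<in> H2_per"
  shows "ae_eq (lap_part \<xi> a (\<lambda>y. c * u y)) (\<lambda>y. c * lap_part \<xi> a u y)"
proof -
  have 1: "AE y in cellM. \<forall>j. weak_pd j (\<lambda>y. c * u y) y = c * weak_pd j u y"
    using H1_per_cmult(2)[OF H2_perD(1)[OF assms]] by (intro eventually_all_finite)
  have 2: "AE y in cellM. \<forall>j. weak_pd j (weak_pd j (\<lambda>y. c * u y)) y = c * weak_pd j (weak_pd j u) y"
    using H2_per_cmult(2)[OF assms] by (intro eventually_all_finite)
  show ?thesis
    using 1 2 by eventually_elim (simp add: lap_part_def laplace_def sum_distrib_left mult_ac)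
qed

lemma grad_part_cong: "h2_rel u v \<Longrightarrow> ae_eq (grad_part \<xi> a u j) (grad_part \<xi> a v j)"
  using h2_rel_weak_pd[of u v] by (auto simp: grad_part_def h2_rel_def elim: eventually_mono)

lemma lap_part_cong: "h2_rel u v \<Longrightarrow> ae_eq (lap_part \<xi> a u) (lap_part \<xi> a v)"
  using h2_rel_weak_pd[of u v] by (auto simp: lap_part_def laplace_def h2_rel_def elim: eventually_mono)

lemma grad_part_const: "a \<noteq> 1 \<Longrightarrow> ae_eq (grad_part \<xi> a (\<lambda>_. c) j) (\<lambda>_. 0)"
  using H1_per_const(2)[where j=j and c=c] by (auto simp: grad_part_def)

lemma lap_part_const:
  assumes "a \<noteq> 2"
  shows "ae_eq (lap_part \<xi> a (\<lambda>_. c)) (\<lambda>_. 0)"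
proof -
  have 1: "AE y in cellM. \<forall>j. weak_pd j (\<lambda>_. c) y = 0"
    using H1_per_const(2) by (intro eventually_all_finite)
  have 2: "AE y in cellM. \<forall>j. weak_pd j (weak_pd j (\<lambda>_. c)) y = 0"
    using H2_per_const(2) by (intro eventually_all_finite)
  show ?thesis
    using 1 2 by eventually_elim (use assms in \<open>simp add: lap_part_def laplace_def\<close>)
qed

text \<open>All three nonzero parts have zero mean: derivatives because of periodicity, \<open>u\<close> by
  assumption. This is where the factor \<open>\<rho>\<^sup>2\<close> disappears from pairings with
  constants.\<close>

lemma fc_lap_part_0:
  fixes u :: "real ^ 'd \<Rightarrow> complex"
  assumes u: "u \<in> H2_per" and m: "mean u = 0"
  shows "fc (lap_part \<xi> a u) 0 = 0"
proof -
  have "fc (\<lambda>y. \<Sum>j\<in>UNIV. 2 * \<i> * of_real (\<xi> $ j) * weak_pd j u y) 0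
      = (\<Sum>j\<in>UNIV. 2 * \<i> * of_real (\<xi> $ j) * fc (weak_pd j u) 0)"
    unfolding fc_def
    by (subst L2_inner_sum_left) (auto intro: L2_cell_cmult H2_per_L2_cell u simp: L2_inner_cmult_left)
  then have 1: "fc (\<lambda>y. \<Sum>j\<in>UNIV. 2 * \<i> * of_real (\<xi> $ j) * weak_pd j u y) 0 = 0"
    by (simp add: fc_weak_pd_weak_pd[OF u])
  have 2: "fc (\<lambda>y. - of_real ((norm \<xi>)\<^sup>2) * u y) 0 = 0"
    using m unfolding fc_zero_mean fc_def L2_inner_cmult_left by simp
  have 3: "fc (\<lambda>_ :: real ^ 'd. 0) 0 = 0" by (simp add: fc_def)
  show ?thesis using 1 2 3 fc_laplace[OF u, of 0] by (simp add: lap_part_def)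
qed

lemma L2_inner_const_right: "L2_inner w (\<lambda>_. c) = cnj c * fc w 0"
  using L2_inner_cmult_right[of w c "\<lambda>_. 1"] by (simp add: fc_def L2_inner_def)

lemma L2_inner_const_left: "L2_inner (\<lambda>_. c) w = c * cnj (fc w 0)"
  by (subst L2_inner_cnj) (simp add: L2_inner_const_right)

lemma AE_cellM: "AE y in lebesgue. P y \<Longrightarrow> AE y in cellM. P y"
  by (subst AE_restrict_space_iff) (auto elim: eventually_mono)

text \<open>The coefficient matrix as seen on the cell, with a named bound.\<close>

locale coefficients =
  fixes A :: "real ^ 'd \<Rightarrow> real ^ 'd ^ 'd" and M :: real
  assumes A_meas: "\<And>j k. (\<lambda>y. complex_of_real (A y $ j $ k)) \<in> borel_measurable cellM"
    and A_bound: "\<And>j k. AE y in cellM. cmod (complex_of_real (A y $ j $ k)) \<le> M"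
    and A_pos: "AE y in cellM. \<forall>x. 0 \<le> (A y *v x) \<bullet> x"
    and M_nonneg: "M \<ge> 0"

lemma coefficient_matrix_imp_coefficients:
  assumes "coefficient_matrix A"
  shows "\<exists>M. coefficients A M"
proof -
  obtain M where M: "AE y in lebesgue. \<forall>i j. \<bar>A y $ i $ j\<bar> \<le> M"
    using assms unfolding coefficient_matrix_def by blast
  obtain \<alpha> where \<alpha>: "\<alpha> > 0" "AE y in lebesgue. \<forall>\<xi>. (A y *v \<xi>) \<bullet> \<xi> \<ge> \<alpha> * (norm \<xi>)\<^sup>2"
    using assms unfolding coefficient_matrix_def by blast
  have meas: "(\<lambda>y. A y $ i $ j) \<in> borel_measurable lebesgue" for i j
    using assms unfolding coefficient_matrix_def by blast
  have "coefficients A \<bar>M\<bar>"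
  proof
    show "(\<lambda>y. complex_of_real (A y $ j $ k)) \<in> borel_measurable cellM" for j k
      by (intro measurable_restrict_space1 borel_measurable_continuous_on[OF _ meas] continuous_intros)
    show "AE y in cellM. cmod (complex_of_real (A y $ j $ k)) \<le> \<bar>M\<bar>" for j k
      using AE_cellM[OF M] by eventually_elim (auto intro: order_trans[of _ M])
    show "AE y in cellM. \<forall>x. 0 \<le> (A y *v x) \<bullet> x"
      using AE_cellM[OF \<alpha>(2)]
    proof eventually_elim
      case (elim y)
      show ?case
      proof
        fix x :: "real ^ 'a"
        have "0 \<le> \<alpha> * (norm x)\<^sup>2" using \<alpha> by simp
        then show "0 \<le> (A y *v x) \<bullet> x" using elim order_trans by blast
      qed
    qed
  qed simp
  then show ?thesis by blast
qed

context coefficients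
begin

definition matrix_form :: "('d \<Rightarrow> real ^ 'd \<Rightarrow> complex) \<Rightarrow> ('d \<Rightarrow> real ^ 'd \<Rightarrow> complex) \<Rightarrow> complex" where
  "matrix_form F G = (\<Sum>j\<in>UNIV. \<Sum>k\<in>UNIV. L2_inner (\<lambda>y. complex_of_real (A y $ j $ k) * F k y) (G j))"

lemma A_mult_L2: "u \<in> L2_cell \<Longrightarrow> (\<lambda>y. complex_of_real (A y $ j $ k) * u y) \<in> L2_cell"
  by (rule L2_cell_bmult[OF _ A_meas A_bound])

lemma matrix_form_integral:
  assumes "\<And>j. F j \<in> L2_cell" "\<And>j. G j \<in> L2_cell"
  shows "(LINT y|cellM. (\<Sum>j\<in>UNIV. \<Sum>k\<in>UNIV. complex_of_real (A y $ j $ k) * F k y * cnj (G j y)))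
     = matrix_form F G"
  unfolding matrix_form_def L2_inner_def
  using L2_cell_mult[OF A_mult_L2[OF assms(1)] assms(2)]
  by (subst Bochner_Integration.integral_sum, force)+ (rule refl)

lemma matrix_form_le:
  assumes F: "\<And>j. F j \<in> L2_cell" "\<And>j. L2_norm (F j) \<le> f"
    and G: "\<And>j. G j \<in> L2_cell" "\<And>j. L2_norm (G j) \<le> g"
  shows "cmod (matrix_form F G) \<le> M * (real CARD('d))\<^sup>2 * (f * g)"
proof -
  have fg: "f \<ge> 0" "g \<ge> 0" using F(2) G(2) L2_norm_nonneg order_trans by blast+
  have "cmod (matrix_form F G) \<le> (\<Sum>j\<in>(UNIV::'d set). \<Sum>k\<in>(UNIV::'d set). M * (f * g))"
    unfolding matrix_form_def
  proof (intro sum_norm_le)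
    fix j k
    have "cmod (L2_inner (\<lambda>y. complex_of_real (A y $ j $ k) * F k y) (G j))
        \<le> L2_norm (\<lambda>y. complex_of_real (A y $ j $ k) * F k y) * L2_norm (G j)"
      by (intro L2_Cauchy_Schwarz A_mult_L2 F G)
    also have "\<dots> \<le> (M * L2_norm (F k)) * L2_norm (G j)"
      by (intro mult_right_mono L2_norm_bmult F A_meas A_bound M_nonneg) simp
    also have "\<dots> \<le> (M * f) * g"
      using F G fg M_nonneg by (intro mult_mono) (auto intro: mult_left_mono)
    finally show "cmod (L2_inner (\<lambda>y. complex_of_real (A y $ j $ k) * F k y) (G j)) \<le> M * (f * g)"
      by (simp add: mult.assoc)
  qed
  also have "\<dots> = M * (real CARD('d))\<^sup>2 * (f * g)" by (simp add: power2_eq_square)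
  finally show ?thesis .
qed

lemma matrix_form_cong:
  assumes "\<And>j. F j \<in> L2_cell" "\<And>j. F' j \<in> L2_cell" "\<And>j. G j \<in> L2_cell" "\<And>j. G' j \<in> L2_cell"
    and "\<And>j. ae_eq (F j) (F' j)" "\<And>j. ae_eq (G j) (G' j)"
  shows "matrix_form F G = matrix_form F' G'"
  unfolding matrix_form_def
proof (intro sum.cong refl L2_inner_cong_AE A_mult_L2 assms)
  fix j k
  show "ae_eq (\<lambda>y. complex_of_real (A y $ j $ k) * F k y) (\<lambda>y. complex_of_real (A y $ j $ k) * F' k y)"
    using assms(5)[of k] by eventually_elim simp
qed

lemma matrix_form_sum:
  assumes "\<And>a j. a \<in> I \<Longrightarrow> F a j \<in> L2_cell" "\<And>b j. b \<in> J \<Longrightarrow> G b j \<in> L2_cell"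
  shows "matrix_form (\<lambda>j y. \<Sum>a\<in>I. of_real (s a) * F a j y) (\<lambda>j y. \<Sum>b\<in>J. of_real (t b) * G b j y)
     = (\<Sum>a\<in>I. \<Sum>b\<in>J. of_real (s a) * of_real (t b) * matrix_form (F a) (G b))"
proof -
  have "L2_inner (\<lambda>y. complex_of_real (A y $ j $ k) * (\<Sum>a\<in>I. of_real (s a) * F a k y))
         (\<lambda>y. \<Sum>b\<in>J. of_real (t b) * G b j y)
      = (\<Sum>a\<in>I. \<Sum>b\<in>J. of_real (s a) * of_real (t b)
           * L2_inner (\<lambda>y. complex_of_real (A y $ j $ k) * F a k y) (G b j))" for j k
  proof -
    have "(\<lambda>y. complex_of_real (A y $ j $ k) * (\<Sum>a\<in>I. of_real (s a) * F a k y))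
        = (\<lambda>y. \<Sum>a\<in>I. of_real (s a) * (complex_of_real (A y $ j $ k) * F a k y))"
      by (simp add: sum_distrib_left mult_ac)
    then show ?thesis
      using assms
      by (simp add: L2_inner_sum_left L2_inner_sum_right L2_cell_cmult L2_cell_sum A_mult_L2
          L2_inner_cmult_left L2_inner_cmult_right sum_distrib_left mult.assoc)
  qed
  then have "matrix_form (\<lambda>j y. \<Sum>a\<in>I. of_real (s a) * F a j y) (\<lambda>j y. \<Sum>b\<in>J. of_real (t b) * G b j y)
      = (\<Sum>j\<in>UNIV. \<Sum>k\<in>UNIV. \<Sum>a\<in>I. \<Sum>b\<in>J. of_real (s a) * of_real (t b)
           * L2_inner (\<lambda>y. complex_of_real (A y $ j $ k) * F a k y) (G b j))"
    by (simp add: matrix_form_def)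
  also have "\<dots> = (\<Sum>j\<in>UNIV. \<Sum>a\<in>I. \<Sum>b\<in>J. \<Sum>k\<in>UNIV. of_real (s a) * of_real (t b)
           * L2_inner (\<lambda>y. complex_of_real (A y $ j $ k) * F a k y) (G b j))"
    by (intro sum.cong refl) (subst sum.swap, intro sum.cong refl, rule sum.swap)
  also have "\<dots> = (\<Sum>a\<in>I. \<Sum>b\<in>J. \<Sum>j\<in>UNIV. \<Sum>k\<in>UNIV. of_real (s a) * of_real (t b)
           * L2_inner (\<lambda>y. complex_of_real (A y $ j $ k) * F a k y) (G b j))"
    by (subst sum.swap, intro sum.cong refl, rule sum.swap)
  finally show ?thesis by (simp add: matrix_form_def sum_distrib_left)
qed

lemma matrix_form_add_left:
  assumes "\<And>j. F j \<in> L2_cell" "\<And>j. F' j \<in> L2_cell" "\<And>j. G j \<in> L2_cell"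
  shows "matrix_form (\<lambda>j y. F j y + F' j y) G = matrix_form F G + matrix_form F' G"
  unfolding matrix_form_def using assms
  by (simp add: distrib_left L2_inner_add_left A_mult_L2 sum.distrib)

lemma matrix_form_cmult_left:
  "matrix_form (\<lambda>j y. c * F j y) G = c * matrix_form F G"
proof -
  have "(\<lambda>y. complex_of_real (A y $ j $ k) * (c * F k y)) = (\<lambda>y. c * (complex_of_real (A y $ j $ k) * F k y))"
    for j k by (simp add: mult_ac)
  then show ?thesis by (simp add: matrix_form_def L2_inner_cmult_left sum_distrib_left)
qed

lemma matrix_form_zero:
  assumes "\<And>j. F j \<in> L2_cell" "\<And>j. G j \<in> L2_cell"
    and "(\<forall>j. ae_eq (F j) (\<lambda>_. 0)) \<or> (\<forall>j. ae_eq (G j) (\<lambda>_. 0))"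
  shows "matrix_form F G = 0"
  using assms(3)
proof
  assume "\<forall>j. ae_eq (F j) (\<lambda>_. 0)"
  then have "matrix_form F G = matrix_form (\<lambda>_ _. 0) G"
    using assms by (intro matrix_form_cong) auto
  then show ?thesis by (simp add: matrix_form_def)
next
  assume "\<forall>j. ae_eq (G j) (\<lambda>_. 0)"
  then have "matrix_form F G = matrix_form F (\<lambda>_ _. 0)"
    using assms by (intro matrix_form_cong) auto
  then show ?thesis by (simp add: matrix_form_def)
qed

text \<open>For a real matrix the real part of \<open>A F \<cdot> cnj F\<close> is the sum of the real forms
  at the real and at the imaginary part of \<open>F\<close>.\<close>

lemma matrix_form_nonneg:
  assumes F: "\<And>j. F j \<in> L2_cell"
  shows "0 \<le> Re (matrix_form F F)"
proof -
  have int: "integrable cellM (\<lambda>y. \<Sum>j\<in>UNIV. \<Sum>k\<in>UNIV. complex_of_real (A y $ j $ k) * F k y * cnj (F j y))"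
    using L2_cell_mult[OF A_mult_L2[OF F] F] by (intro Bochner_Integration.integrable_sum)
  have "Re (matrix_form F F)
      = (LINT y|cellM. Re (\<Sum>j\<in>UNIV. \<Sum>k\<in>UNIV. complex_of_real (A y $ j $ k) * F k y * cnj (F j y)))"
    unfolding matrix_form_integral[OF F F, symmetric] using int by (rule integral_Re[symmetric])
  also have "\<dots> \<ge> 0"
  proof (rule integral_nonneg_AE)
    show "AE y in cellM. 0 \<le> Re (\<Sum>j\<in>UNIV. \<Sum>k\<in>UNIV. complex_of_real (A y $ j $ k) * F k y * cnj (F j y))"
      using A_pos
    proof eventually_elim
      case (elim y)
      have "Re (\<Sum>j\<in>UNIV. \<Sum>k\<in>UNIV. complex_of_real (A y $ j $ k) * F k y * cnj (F j y))
          = (A y *v (\<chi> k. Re (F k y))) \<bullet> (\<chi> k. Re (F k y)) + (A y *v (\<chi> k. Im (F k y))) \<bullet> (\<chi> k. Im (F k y))"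
        by (simp add: matrix_vector_mult_def inner_vec_def sum_distrib_left sum_distrib_right algebra_simps
            flip: sum.distrib)
      also have "\<dots> \<ge> 0" using elim by (intro add_nonneg_nonneg) auto
      finally show ?case .
    qed
  qed
  finally show ?thesis .
qed

end

text \<open>The constant must not grow with \<open>i\<close>, hence the count of the nonzero terms.\<close>

lemma abs_sum_le_few:
  fixes f :: "nat \<Rightarrow> 'a::real_normed_vector"
  assumes "\<And>a. a \<le> 2 \<Longrightarrow> norm (f a) \<le> B" "\<And>a. a > 2 \<Longrightarrow> f a = 0" "B \<ge> 0"
  shows "norm (\<Sum>a\<le>i. f a) \<le> 3 * B"
proof -
  have "(\<Sum>a\<le>i. f a) = (\<Sum>a\<in>{..i} \<inter> {..2}. f a)"
  proof (intro sum.mono_neutral_right ballI)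
    show "f a = 0" if "a \<in> {..i} - {..i} \<inter> {..2}" for a
      by (rule assms(2)) (use that in auto)
  qed auto
  also have "norm \<dots> \<le> (\<Sum>a\<in>{..i} \<inter> {..2}. B)"
    using assms(1) by (intro sum_norm_le) auto
  also have "\<dots> = real (card ({..i} \<inter> {..2::nat})) * B" by simp
  also have "\<dots> \<le> 3 * B"
  proof (rule mult_right_mono)
    have "card ({..i} \<inter> {..2::nat}) \<le> card {..2::nat}" by (intro card_mono) auto
    then show "real (card ({..i} \<inter> {..2::nat})) \<le> 3" by simp
  qed fact
  finally show ?thesis .
qed

lemma sum_square_antidiagonals:
  fixes t :: complex
  assumes "\<And>a b. a > 2 \<Longrightarrow> X a b = 0" "\<And>a b. b > 2 \<Longrightarrow> X a b = 0"
  shows "(\<Sum>a\<le>2. \<Sum>b\<le>2. t ^ a * t ^ b * X a b) = (\<Sum>i\<le>4. t ^ i * (\<Sum>a\<le>i. X a (i - a)))"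
proof -
  have s2: "{..2::nat} = {0, 1, 2}" by auto
  have s3: "{..3::nat} = {0, 1, 2, 3}" by auto
  have s4: "{..4::nat} = {0, 1, 2, 3, 4}" by auto
  have s1: "{..Suc 0} = {0, 1}" by auto
  have z: "X 0 3 = 0" "X 3 0 = 0" "X 0 4 = 0" "X 1 3 = 0" "X 3 1 = 0" "X 4 0 = 0"
     "X 3 (Suc 0) = 0" "X (Suc 0) 3 = 0"
    using assms by auto
  show ?thesis
    by (simp add: s1 s2 s3 s4 z) (simp add: algebra_simps eval_nat_numeral)
qed

context coefficients
begin

text \<open>The contribution of the parts of orders \<open>a\<close> and \<open>b\<close> of the two
  arguments; it belongs to \<open>t^(a + b)\<close>.\<close>

definition pair_form :: "real \<Rightarrow> real ^ 'd \<Rightarrow> nat \<Rightarrow> nat \<Rightarrow> (real ^ 'd \<Rightarrow> complex) \<Rightarrow> (real ^ 'd \<Rightarrow> complex) \<Rightarrow> complex" where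
  "pair_form \<rho> \<xi> a b u v = matrix_form (grad_part \<xi> a u) (grad_part \<xi> b v)
     + of_real (\<rho>\<^sup>2) * L2_inner (lap_part \<xi> a u) (lap_part \<xi> b v)"

definition form_coeff :: "real \<Rightarrow> real ^ 'd \<Rightarrow> nat \<Rightarrow> (real ^ 'd \<Rightarrow> complex) \<Rightarrow> (real ^ 'd \<Rightarrow> complex) \<Rightarrow> complex" where
  "form_coeff \<rho> \<xi> i u v = (\<Sum>a\<le>i. pair_form \<rho> \<xi> a (i - a) u v)"

lemma pair_form_zero:
  "a > 2 \<Longrightarrow> pair_form \<rho> \<xi> a b u v = 0" "b > 2 \<Longrightarrow> pair_form \<rho> \<xi> a b u v = 0"
  by (auto simp: pair_form_def grad_part_def[abs_def] lap_part_def[abs_def] matrix_form_def)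

lemma matrix_form_parts_zero: "a > 2 \<Longrightarrow> matrix_form (grad_part \<xi> a u) G = 0"
  by (simp add: grad_part_def[abs_def] matrix_form_def)

lemma bloch_form_expand:
  assumes u: "u \<in> H2_per" and v: "v \<in> H2_per"
  shows "bloch_form A \<rho> (t *\<^sub>R \<xi>) u v = (\<Sum>i\<le>4. of_real (t ^ i) * form_coeff \<rho> \<xi> i u v)"
proof -
  let ?G = "\<lambda>u j y. \<Sum>a\<le>2. of_real (t ^ a) * grad_part \<xi> a u j y"
  let ?L = "\<lambda>u y. \<Sum>a\<le>2. of_real (t ^ a) * lap_part \<xi> a u y"
  have "(LINT y|cellM. (\<Sum>j\<in>UNIV. \<Sum>k\<in>UNIV. complex_of_real (A y $ j $ k) * ?G u k y * cnj (?G v j y)))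
      = matrix_form (?G u) (?G v)"
    using u v by (intro matrix_form_integral L2_cell_sum L2_cell_cmult grad_part_L2)
  also have "\<dots> = (\<Sum>a\<le>2. \<Sum>b\<le>2. of_real (t ^ a) * of_real (t ^ b) * matrix_form (grad_part \<xi> a u) (grad_part \<xi> b v))"
    using u v by (intro matrix_form_sum grad_part_L2)
  finally have 1: "(LINT y|cellM. (\<Sum>j\<in>UNIV. \<Sum>k\<in>UNIV. complex_of_real (A y $ j $ k) * ?G u k y * cnj (?G v j y)))
      = (\<Sum>a\<le>2. \<Sum>b\<le>2. of_real (t ^ a) * of_real (t ^ b) * matrix_form (grad_part \<xi> a u) (grad_part \<xi> b v))" .
  have "L2_inner (?L u) (?L v) = (\<Sum>a\<le>2. L2_inner (\<lambda>y. of_real (t ^ a) * lap_part \<xi> a u y) (?L v))"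
    using u v by (intro L2_inner_sum_left L2_cell_sum L2_cell_cmult lap_part_L2)
  also have "\<dots> = (\<Sum>a\<le>2. of_real (t ^ a) * (\<Sum>b\<le>2. L2_inner (lap_part \<xi> a u) (\<lambda>y. of_real (t ^ b) * lap_part \<xi> b v y)))"
    unfolding L2_inner_cmult_left using u v
    by (intro sum.cong refl arg_cong2[of _ _ _ _ "(*)"] L2_inner_sum_right L2_cell_cmult lap_part_L2)
  also have "\<dots> = (\<Sum>a\<le>2. \<Sum>b\<le>2. of_real (t ^ a) * of_real (t ^ b) * L2_inner (lap_part \<xi> a u) (lap_part \<xi> b v))"
    unfolding L2_inner_cmult_right by (simp add: sum_distrib_left mult.assoc)
  finally have 2: "L2_inner (?L u) (?L v)
      = (\<Sum>a\<le>2. \<Sum>b\<le>2. of_real (t ^ a) * of_real (t ^ b) * L2_inner (lap_part \<xi> a u) (lap_part \<xi> b v))" .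
  have "bloch_form A \<rho> (t *\<^sub>R \<xi>) u v
      = (LINT y|cellM. (\<Sum>j\<in>UNIV. \<Sum>k\<in>UNIV. complex_of_real (A y $ j $ k) * ?G u k y * cnj (?G v j y)))
        + of_real (\<rho>\<^sup>2) * L2_inner (?L u) (?L v)"
    unfolding bloch_form_def shifted_grad_expand shifted_lap_expand L2_inner_def ..
  also have "\<dots> = (\<Sum>a\<le>2. \<Sum>b\<le>2. of_real t ^ a * of_real t ^ b * pair_form \<rho> \<xi> a b u v)"
    unfolding 1 2 pair_form_def
    by (simp add: sum_distrib_left distrib_left sum.distrib mult_ac)
  also have "\<dots> = (\<Sum>i\<le>4. of_real t ^ i * form_coeff \<rho> \<xi> i u v)"
    unfolding form_coeff_def by (rule sum_square_antidiagonals) (auto simp: pair_form_zero)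
  finally show ?thesis by simp
qed

lemma pair_form_cong:
  assumes "h2_rel u u'" "h2_rel v v'"
  shows "pair_form \<rho> \<xi> a b u v = pair_form \<rho> \<xi> a b u' v'"
proof -
  have H: "u \<in> H2_per" "u' \<in> H2_per" "v \<in> H2_per" "v' \<in> H2_per" using assms by (auto simp: h2_rel_def)
  show ?thesis
    unfolding pair_form_def
    by (intro arg_cong2[of _ _ _ _ "(+)"] arg_cong2[of _ _ _ _ "(*)"] refl matrix_form_cong
        L2_inner_cong_AE grad_part_L2 lap_part_L2 grad_part_cong lap_part_cong assms H)
qed

lemma pair_form_add_left:
  assumes u: "u \<in> H2_per" and u': "u' \<in> H2_per" and v: "v \<in> H2_per"
  shows "pair_form \<rho> \<xi> a b (\<lambda>y. u y + u' y) v = pair_form \<rho> \<xi> a b u v + pair_form \<rho> \<xi> a b u' v"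
proof -
  note S = H2_per_add(1)[OF u u']
  have 1: "matrix_form (grad_part \<xi> a (\<lambda>y. u y + u' y)) (grad_part \<xi> b v)
      = matrix_form (\<lambda>j y. grad_part \<xi> a u j y + grad_part \<xi> a u' j y) (grad_part \<xi> b v)"
    by (intro matrix_form_cong grad_part_add grad_part_L2 L2_cell_add S u u' v) simp
  have 2: "L2_inner (lap_part \<xi> a (\<lambda>y. u y + u' y)) (lap_part \<xi> b v)
      = L2_inner (\<lambda>y. lap_part \<xi> a u y + lap_part \<xi> a u' y) (lap_part \<xi> b v)"
    by (intro L2_inner_cong_AE lap_part_add lap_part_L2 L2_cell_add S u u' v) simp
  show ?thesis
    unfolding pair_form_def 1 2 using u u' v
    by (simp add: matrix_form_add_left L2_inner_add_left grad_part_L2 lap_part_L2 algebra_simps)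
qed

lemma pair_form_cmult_left:
  assumes u: "u \<in> H2_per" and v: "v \<in> H2_per"
  shows "pair_form \<rho> \<xi> a b (\<lambda>y. c * u y) v = c * pair_form \<rho> \<xi> a b u v"
proof -
  note S = H2_per_cmult(1)[OF u]
  have 1: "matrix_form (grad_part \<xi> a (\<lambda>y. c * u y)) (grad_part \<xi> b v)
      = matrix_form (\<lambda>j y. c * grad_part \<xi> a u j y) (grad_part \<xi> b v)"
    by (intro matrix_form_cong grad_part_cmult grad_part_L2 L2_cell_cmult S u v) simp
  have 2: "L2_inner (lap_part \<xi> a (\<lambda>y. c * u y)) (lap_part \<xi> b v)
      = L2_inner (\<lambda>y. c * lap_part \<xi> a u y) (lap_part \<xi> b v)"
    by (intro L2_inner_cong_AE lap_part_cmult lap_part_L2 L2_cell_cmult S u v) simp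
  show ?thesis
    unfolding pair_form_def 1 2
    by (simp add: matrix_form_cmult_left L2_inner_cmult_left algebra_simps)
qed

definition mat_const :: "real ^ 'd \<Rightarrow> real" where
  "mat_const \<xi> = M * (real CARD('d))\<^sup>2 * (part_bound \<xi>)\<^sup>2"

lemma mat_const_nonneg: "mat_const \<xi> \<ge> 0"
  unfolding mat_const_def using M_nonneg by simp

lemma matrix_form_parts_le:
  assumes u: "u \<in> H2_per" and v: "v \<in> H2_per"
  shows "cmod (matrix_form (grad_part \<xi> a u) (grad_part \<xi> b v)) \<le> mat_const \<xi> * (H2_norm u * H2_norm v)"
  using matrix_form_le[OF grad_part_L2[OF u] grad_part_norm grad_part_L2[OF v] grad_part_norm]
  by (simp add: mat_const_def power2_eq_square mult_ac)

lemma pair_form_le: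
  assumes u: "u \<in> H2_per" and v: "v \<in> H2_per" and \<rho>: "\<rho> \<ge> 1"
  shows "cmod (pair_form \<rho> \<xi> a b u v) \<le> (mat_const \<xi> + (part_bound \<xi>)\<^sup>2) * \<rho>\<^sup>2 * (H2_norm u * H2_norm v)"
proof -
  have \<rho>2: "\<rho>\<^sup>2 \<ge> 1" using \<rho> by (simp add: one_le_power)
  define N where "N = H2_norm u * H2_norm v"
  have N: "N \<ge> 0" by (simp add: N_def)
  have "cmod (L2_inner (lap_part \<xi> a u) (lap_part \<xi> b v))
      \<le> L2_norm (lap_part \<xi> a u) * L2_norm (lap_part \<xi> b v)"
    by (intro L2_Cauchy_Schwarz lap_part_L2 u v)
  also have "\<dots> \<le> (part_bound \<xi> * H2_norm u) * (part_bound \<xi> * H2_norm v)"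
    using part_bound_ge[of \<xi>] by (intro mult_mono lap_part_norm u v) auto
  also have "\<dots> = (part_bound \<xi>)\<^sup>2 * N" by (simp add: N_def power2_eq_square mult_ac)
  finally have 1: "cmod (L2_inner (lap_part \<xi> a u) (lap_part \<xi> b v)) \<le> (part_bound \<xi>)\<^sup>2 * N" .
  have "cmod (pair_form \<rho> \<xi> a b u v) \<le> mat_const \<xi> * N + \<rho>\<^sup>2 * ((part_bound \<xi>)\<^sup>2 * N)"
    unfolding pair_form_def
    using matrix_form_parts_le[OF u v, of \<xi> a b] mult_left_mono[OF 1, of "\<rho>\<^sup>2"]
    by (intro order_trans[OF norm_triangle_ineq] add_mono) (auto simp: norm_mult N_def norm_power)
  also have "\<dots> \<le> mat_const \<xi> * N * \<rho>\<^sup>2 + \<rho>\<^sup>2 * ((part_bound \<xi>)\<^sup>2 * N)"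
    using mult_left_mono[OF \<rho>2, of "mat_const \<xi> * N"] mat_const_nonneg N by simp
  finally show ?thesis by (simp add: N_def algebra_simps)
qed

lemma form_coeff_le:
  assumes "u \<in> H2_per" "v \<in> H2_per" "\<rho> \<ge> 1"
  shows "cmod (form_coeff \<rho> \<xi> i u v) \<le> 3 * (mat_const \<xi> + (part_bound \<xi>)\<^sup>2) * \<rho>\<^sup>2 * (H2_norm u * H2_norm v)"
proof -
  have "cmod (form_coeff \<rho> \<xi> i u v) \<le> 3 * ((mat_const \<xi> + (part_bound \<xi>)\<^sup>2) * \<rho>\<^sup>2 * (H2_norm u * H2_norm v))"
    unfolding form_coeff_def
    by (rule abs_sum_le_few) (auto simp: pair_form_zero pair_form_le assms mat_const_nonneg)
  then show ?thesis by (simp only: mult.assoc)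
qed

lemma lap_part_const_2: "lap_part \<xi> 2 (\<lambda>_. c) = (\<lambda>_. - of_real ((norm \<xi>)\<^sup>2) * c)"
  by (simp add: lap_part_def)

text \<open>For a constant only the part of order 2 is nonzero, and it is again a constant; it is orthogonal
  to all parts of a function of zero mean.\<close>

lemma lap_inner_const:
  assumes v: "v \<in> H2_per" and z: "mean v = 0 \<or> (\<exists>c'. v = (\<lambda>_. c') \<and> (a \<noteq> 2 \<or> b \<noteq> 2))"
  shows "L2_inner (lap_part \<xi> a (\<lambda>_. c)) (lap_part \<xi> b v) = 0"
    and "L2_inner (lap_part \<xi> b v) (lap_part \<xi> a (\<lambda>_. c)) = 0"
proof -
  have *: "L2_inner (lap_part \<xi> a (\<lambda>_. c)) (lap_part \<xi> b v) = 0"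
  proof (cases "a = 2")
    case False
    then have "L2_inner (lap_part \<xi> a (\<lambda>_. c)) (lap_part \<xi> b v) = L2_inner (\<lambda>_. 0) (lap_part \<xi> b v)"
      by (intro L2_inner_cong_AE lap_part_const lap_part_L2 H2_per_const v L2_cell_0) simp_all
    then show ?thesis by simp
  next
    case True
    show ?thesis
    proof (cases "mean v = 0")
      case m: True
      show ?thesis
        unfolding True lap_part_const_2 L2_inner_const_left using fc_lap_part_0[OF v m] by simp
    next
      case False
      then obtain c' where c': "v = (\<lambda>_. c')" "b \<noteq> 2" using z True by auto
      have "L2_inner (lap_part \<xi> a (\<lambda>_. c)) (lap_part \<xi> b v) = L2_inner (lap_part \<xi> a (\<lambda>_. c)) (\<lambda>_. 0)"
        unfolding c'(1) by (intro L2_inner_cong_AE lap_part_const lap_part_L2 H2_per_const L2_cell_0 c'(2)) simp_all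
      then show ?thesis by simp
    qed
  qed
  show "L2_inner (lap_part \<xi> a (\<lambda>_. c)) (lap_part \<xi> b v) = 0" by (rule *)
  then show "L2_inner (lap_part \<xi> b v) (lap_part \<xi> a (\<lambda>_. c)) = 0"
    by (subst L2_inner_cnj) simp
qed

text \<open>By \<open>lap_inner_const\<close> the part with the factor \<open>\<rho>\<^sup>2\<close> drops
  out, so the bound does not contain \<open>\<rho>\<close>.\<close>

lemma form_coeff_const_left:
  assumes v: "v \<in> H2_per" and z: "mean v = 0 \<or> (\<exists>c'. v = (\<lambda>_. c') \<and> i \<noteq> 4)"
  shows "cmod (form_coeff \<rho> \<xi> i (\<lambda>_. c) v) \<le> 3 * mat_const \<xi> * (H2_norm (\<lambda>_ :: real ^ 'd. c) * H2_norm v)"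
proof -
  have "cmod (form_coeff \<rho> \<xi> i (\<lambda>_. c) v) \<le> 3 * (mat_const \<xi> * (H2_norm (\<lambda>_ :: real ^ 'd. c) * H2_norm v))"
  proof -
    have "form_coeff \<rho> \<xi> i (\<lambda>_. c) v = (\<Sum>a\<le>i. matrix_form (grad_part \<xi> a (\<lambda>_. c)) (grad_part \<xi> (i - a) v))"
      unfolding form_coeff_def pair_form_def
      by (intro sum.cong refl) (subst lap_inner_const(1), use v z in auto)
    also have "cmod \<dots> \<le> 3 * (mat_const \<xi> * (H2_norm (\<lambda>_ :: real ^ 'd. c) * H2_norm v))"
      by (rule abs_sum_le_few)
        (auto simp: matrix_form_parts_le H2_per_const v mat_const_nonneg matrix_form_parts_zero)
    finally show ?thesis .
  qed
  then show ?thesis by simp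
qed

lemma form_coeff_const_right:
  assumes v: "v \<in> H2_per" and z: "mean v = 0"
  shows "cmod (form_coeff \<rho> \<xi> i v (\<lambda>_. c)) \<le> 3 * mat_const \<xi> * (H2_norm v * H2_norm (\<lambda>_ :: real ^ 'd. c))"
proof -
  have "form_coeff \<rho> \<xi> i v (\<lambda>_. c) = (\<Sum>a\<le>i. matrix_form (grad_part \<xi> a v) (grad_part \<xi> (i - a) (\<lambda>_. c)))"
    unfolding form_coeff_def pair_form_def
    by (intro sum.cong refl) (subst lap_inner_const(2), use v z in auto)
  also have "cmod \<dots> \<le> 3 * (mat_const \<xi> * (H2_norm v * H2_norm (\<lambda>_ :: real ^ 'd. c)))"
    by (rule abs_sum_le_few)
      (auto simp: matrix_form_parts_le H2_per_const v mat_const_nonneg matrix_form_parts_zero)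
  finally show ?thesis by simp
qed

lemma form_coeff_0_const:
  assumes v: "v \<in> H2_per"
  shows "form_coeff \<rho> \<xi> 0 v (\<lambda>_. c) = 0" "form_coeff \<rho> \<xi> 0 (\<lambda>_. c) v = 0"
proof -
  have g: "\<forall>j. ae_eq (grad_part \<xi> 0 (\<lambda>_. c) j) (\<lambda>_. 0)" by (simp add: grad_part_const)
  note L = grad_part_L2[OF v] grad_part_L2[OF H2_per_const(1)[of c]] lap_part_L2[OF v]
    lap_part_L2[OF H2_per_const(1)[of c]]
  have "matrix_form (grad_part \<xi> 0 v) (grad_part \<xi> 0 (\<lambda>_. c)) = 0"
    "matrix_form (grad_part \<xi> 0 (\<lambda>_. c)) (grad_part \<xi> 0 v) = 0"
    using g by (auto intro!: matrix_form_zero L)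
  moreover have "L2_inner (lap_part \<xi> 0 v) (lap_part \<xi> 0 (\<lambda>_. c)) = L2_inner (lap_part \<xi> 0 v) (\<lambda>_. 0)"
    "L2_inner (lap_part \<xi> 0 (\<lambda>_. c)) (lap_part \<xi> 0 v) = L2_inner (\<lambda>_. 0) (lap_part \<xi> 0 v)"
    by (intro L2_inner_cong_AE L lap_part_const L2_cell_0; simp)+
  ultimately show "form_coeff \<rho> \<xi> 0 v (\<lambda>_. c) = 0" "form_coeff \<rho> \<xi> 0 (\<lambda>_. c) v = 0"
    by (simp_all add: form_coeff_def pair_form_def)
qed

lemma form_coeff_2_const:
  "form_coeff \<rho> \<xi> 2 (\<lambda>_. c) (\<lambda>_. c)
     = of_real ((cmod c)\<^sup>2) * (\<Sum>j\<in>UNIV. \<Sum>k\<in>UNIV. of_real (\<xi> $ j * \<xi> $ k) * (LINT y|cellM. complex_of_real (A y $ j $ k)))"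
proof -
  have "form_coeff \<rho> \<xi> 2 (\<lambda>_. c) (\<lambda>_. c) = (\<Sum>a\<le>2. matrix_form (grad_part \<xi> a (\<lambda>_. c)) (grad_part \<xi> (2 - a) (\<lambda>_. c)))"
    unfolding form_coeff_def pair_form_def
    by (intro sum.cong refl) (subst lap_inner_const(1), use H2_per_const in auto)
  also have "\<dots> = matrix_form (grad_part \<xi> 1 (\<lambda>_. c)) (grad_part \<xi> 1 (\<lambda>_. c))"
    by (simp add: numeral_2_eq_2 grad_part_def[abs_def] matrix_form_def)
  also have "\<dots> = (\<Sum>j\<in>UNIV. \<Sum>k\<in>UNIV. (of_real ((cmod c)\<^sup>2) * of_real (\<xi> $ j * \<xi> $ k)) * (LINT y|cellM. complex_of_real (A y $ j $ k)))"
    unfolding matrix_form_def L2_inner_def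
  proof (intro sum.cong refl)
    fix j k
    have "(LINT y|cellM. complex_of_real (A y $ j $ k) * grad_part \<xi> 1 (\<lambda>_. c) k y * cnj (grad_part \<xi> 1 (\<lambda>_. c) j y))
       = (LINT y|cellM. (of_real ((cmod c)\<^sup>2) * of_real (\<xi> $ j * \<xi> $ k)) * complex_of_real (A y $ j $ k))"
      unfolding complex_norm_square
      by (rule Bochner_Integration.integral_cong[OF refl]) (simp add: grad_part_def mult_ac)
    then show "(LINT y|cellM. complex_of_real (A y $ j $ k) * grad_part \<xi> 1 (\<lambda>_. c) k y * cnj (grad_part \<xi> 1 (\<lambda>_. c) j y))
       = (of_real ((cmod c)\<^sup>2) * of_real (\<xi> $ j * \<xi> $ k)) * (LINT y|cellM. complex_of_real (A y $ j $ k))"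
      by simp
  qed
  finally show ?thesis by (simp add: sum_distrib_left mult.assoc)
qed

lemma form_coeff_coercive:
  assumes v: "v \<in> H2_per" and m: "mean v = 0"
  shows "\<rho>\<^sup>2 * (H2_norm v)\<^sup>2 \<le> 3 * Re (form_coeff \<rho> \<xi> 0 v v)"
proof -
  have g: "0 \<le> Re (matrix_form (grad_part \<xi> 0 v) (grad_part \<xi> 0 v))"
    by (intro matrix_form_nonneg grad_part_L2 v)
  have "\<rho>\<^sup>2 * (H2_norm v)\<^sup>2 \<le> \<rho>\<^sup>2 * (3 * (L2_norm (laplace v))\<^sup>2)"
    by (intro mult_left_mono H2_norm_le_laplace v m) simp
  moreover have "Re (form_coeff \<rho> \<xi> 0 v v)
      = Re (matrix_form (grad_part \<xi> 0 v) (grad_part \<xi> 0 v)) + \<rho>\<^sup>2 * (L2_norm (laplace v))\<^sup>2"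
    by (simp add: form_coeff_def pair_form_def lap_part_def L2_inner_self flip: of_real_power of_real_mult)
  ultimately show ?thesis using g by simp
qed

end

section \<open>The branch along a line\<close>

lemma has_power_series_line_eventually:
  fixes f :: "real ^ 'd \<Rightarrow> real"
  assumes "has_power_series c f 0"
  shows "eventually (\<lambda>t. summable (\<lambda>m. norm (homog_part c \<xi> m * t ^ m)) \<and>
            (\<lambda>m. homog_part c \<xi> m * t ^ m) sums f (t *\<^sub>R \<xi>)) (nhds 0)"
  using has_power_series_line[OF assms, of \<xi>] unfolding eventually_nhds_metric
  by (auto simp: dist_real_def)

lemma real_powser_unique_eventually:
  fixes a b :: "nat \<Rightarrow> real"
  assumes "eventually (\<lambda>t. (\<lambda>n. a n * t ^ n) sums f t) (nhds 0)"
    and "eventually (\<lambda>t. (\<lambda>n. b n * t ^ n) sums f t) (nhds 0)"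
  shows "a n = b n"
proof -
  have "eventually (\<lambda>t. (\<lambda>n. a n * t ^ n) sums f t \<and> (\<lambda>n. b n * t ^ n) sums f t) (nhds 0)"
    using assms by (rule eventually_conj)
  then obtain r where "r > 0"
    "\<And>t. \<bar>t\<bar> < r \<Longrightarrow> (\<lambda>n. a n * t ^ n) sums f t \<and> (\<lambda>n. b n * t ^ n) sums f t"
    unfolding eventually_nhds_metric by (auto simp: dist_real_def)
  then show ?thesis by (intro real_powser_unique[of r a f b]) auto
qed

lemma sums_shift_power:
  fixes g :: "nat \<Rightarrow> real"
  assumes "(\<lambda>m. g m * t ^ m) sums S"
  shows "(\<lambda>m. (if i \<le> m then g (m - i) else 0) * t ^ m) sums (t ^ i * S)"
proof -
  have "(\<lambda>m. t ^ i * (g m * t ^ m)) sums (t ^ i * S)" using assms by (rule sums_mult)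
  then have "(\<lambda>m. (if i \<le> m + i then g (m + i - i) else 0) * t ^ (m + i)) sums (t ^ i * S)"
    by (simp add: power_add mult_ac)
  then show ?thesis by (subst (asm) sums_zero_iff_shift) auto
qed

lemma line_eventually_in:
  fixes \<xi> :: "'a::real_normed_vector"
  assumes "open U" "0 \<in> U"
  shows "eventually (\<lambda>t. t *\<^sub>R \<xi> \<in> U) (nhds 0)"
proof -
  have "((\<lambda>t. t *\<^sub>R \<xi>) \<longlongrightarrow> 0 *\<^sub>R \<xi>) (nhds 0)"
    by (rule tendsto_scaleR[OF filterlim_ident tendsto_const])
  then show ?thesis using assms by (auto dest: topological_tendstoD)
qed

lemma mean_fc: "mean u = (1 / vol TYPE('d)) *\<^sub>R fc u 0" for u :: "real ^ 'd \<Rightarrow> complex"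
  by (simp add: mean_def fc_def L2_inner_def vol_def)

lemma L2_inner_rep_abs:
  assumes "u \<in> H2_per" "v \<in> L2_cell"
  shows "L2_inner (rep_h2 (abs_h2 u)) v = L2_inner u v" "L2_inner v (rep_h2 (abs_h2 u)) = L2_inner v u"
  using assms rep_abs_h2[OF assms(1)] by (auto intro!: L2_inner_cong_AE H2_per_L2_cell)

definition h2_pairing :: "'d h2 \<Rightarrow> 'd::finite h2 \<Rightarrow> complex" where
  "h2_pairing x y = L2_inner (rep_h2 x) (rep_h2 y)"

lemma rep_L2 [simp]: "rep_h2 x \<in> L2_cell"
  by (rule H2_per_L2_cell) simp

lemma h2_add_eq: "x + y = abs_h2 (\<lambda>w. rep_h2 x w + rep_h2 y w)"
  using abs_h2_add[of "rep_h2 x" "rep_h2 y"] by simp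

lemma h2_scaleR_eq: "r *\<^sub>R x = abs_h2 (\<lambda>w. of_real r * rep_h2 x w)"
  using abs_h2_scaleR[of "rep_h2 x" r] by simp

lemma bounded_linear_L2_inner:
  assumes v: "v \<in> L2_cell"
  shows "bounded_linear (\<lambda>x. L2_inner (rep_h2 x) v)"
proof (rule bounded_linear_intro)
  fix x y and r
  show "L2_inner (rep_h2 (x + y)) v = L2_inner (rep_h2 x) v + L2_inner (rep_h2 y) v"
    unfolding h2_add_eq by (simp add: L2_inner_rep_abs H2_per_add v L2_inner_add_left)
  show "L2_inner (rep_h2 (r *\<^sub>R x)) v = r *\<^sub>R L2_inner (rep_h2 x) v"
    unfolding h2_scaleR_eq
    by (simp add: L2_inner_rep_abs H2_per_cmult v L2_inner_cmult_left scaleR_conv_of_real)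
  have "cmod (L2_inner (rep_h2 x) v) \<le> L2_norm (rep_h2 x) * L2_norm v"
    using v by (intro L2_Cauchy_Schwarz) auto
  also have "\<dots> \<le> norm x * L2_norm v"
    using L2_norm_le_H2_norm(1)[of "rep_h2 x"] by (intro mult_right_mono) (auto simp: H2_norm_rep)
  finally show "cmod (L2_inner (rep_h2 x) v) \<le> norm x * L2_norm v" .
qed

lemma bounded_linear_fc: "bounded_linear (\<lambda>x. fc (rep_h2 x) n)"
  unfolding fc_def by (rule bounded_linear_L2_inner) simp

lemma fc_rep_abs: "u \<in> H2_per \<Longrightarrow> fc (rep_h2 (abs_h2 u)) n = fc u n"
  by (simp add: fc_def L2_inner_rep_abs)

lemma mean_const: "mean (\<lambda>_ :: real ^ 'd. c :: complex) = c"
  using vol_pos[where 'd='d] measure_cellM[where 'd='d] by (simp add: mean_def vol_def)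

definition zero_mean :: "'d::finite h2 set" where
  "zero_mean = {x. mean (rep_h2 x) = 0}"

definition h2_const :: "real \<Rightarrow> 'd::finite h2" where
  "h2_const k = abs_h2 (\<lambda>_. of_real k)"

lemma rep_h2_const: "h2_rel (rep_h2 (h2_const k)) (\<lambda>_. of_real k)"
  unfolding h2_const_def h2_rel_def using rep_abs_h2[OF H2_per_const(1)] by (auto simp: H2_per_const)

lemma norm_h2_const: "norm (h2_const k :: 'd::finite h2) = H2_norm (\<lambda>_ :: real ^ 'd. of_real k)"
  unfolding h2_const_def by (rule norm_abs_h2[OF H2_per_const(1)])

context coefficients
begin

text \<open>The real part suffices, since \<open>t\<close> and the eigenvalue are real; the recursion then
  lives in a real vector space.\<close>

definition h2_form :: "real \<Rightarrow> real ^ 'd \<Rightarrow> nat \<Rightarrow> 'd h2 \<Rightarrow> 'd h2 \<Rightarrow> real" where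
  "h2_form \<rho> \<xi> i x y = Re (form_coeff \<rho> \<xi> i (rep_h2 x) (rep_h2 y))"

lemma form_coeff_cong: "h2_rel u u' \<Longrightarrow> h2_rel v v' \<Longrightarrow> form_coeff \<rho> \<xi> i u v = form_coeff \<rho> \<xi> i u' v'"
  unfolding form_coeff_def by (intro sum.cong refl pair_form_cong)

lemma rep_abs_rel: "u \<in> H2_per \<Longrightarrow> h2_rel (rep_h2 (abs_h2 u)) u"
  by (simp add: h2_rel_def rep_abs_h2)

lemma bounded_linear_h2_form:
  assumes \<rho>: "\<rho> \<ge> 1"
  shows "bounded_linear (\<lambda>x. h2_form \<rho> \<xi> i x y)"
proof (rule bounded_linear_intro)
  fix x x' and r
  have "form_coeff \<rho> \<xi> i (rep_h2 (x + x')) (rep_h2 y)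
      = form_coeff \<rho> \<xi> i (\<lambda>w. rep_h2 x w + rep_h2 x' w) (rep_h2 y)"
    unfolding h2_add_eq by (intro form_coeff_cong rep_abs_rel H2_per_add) auto
  then show "h2_form \<rho> \<xi> i (x + x') y = h2_form \<rho> \<xi> i x y + h2_form \<rho> \<xi> i x' y"
    by (simp add: h2_form_def form_coeff_def pair_form_add_left sum.distrib)
  have "form_coeff \<rho> \<xi> i (rep_h2 (r *\<^sub>R x)) (rep_h2 y)
      = form_coeff \<rho> \<xi> i (\<lambda>w. of_real r * rep_h2 x w) (rep_h2 y)"
    unfolding h2_scaleR_eq by (intro form_coeff_cong rep_abs_rel H2_per_cmult) auto
  then show "h2_form \<rho> \<xi> i (r *\<^sub>R x) y = r *\<^sub>R h2_form \<rho> \<xi> i x y"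
    by (simp add: h2_form_def form_coeff_def pair_form_cmult_left flip: sum_distrib_left)
  have "\<bar>h2_form \<rho> \<xi> i x y\<bar> \<le> 3 * (mat_const \<xi> + (part_bound \<xi>)\<^sup>2) * \<rho>\<^sup>2 * (norm x * norm y)"
    unfolding h2_form_def using form_coeff_le[OF rep_h2(1) rep_h2(1) \<rho>, of \<xi> i x y]
    by (intro order_trans[OF abs_Re_le_cmod]) (simp add: H2_norm_rep)
  then show "norm (h2_form \<rho> \<xi> i x y) \<le> norm x * (3 * (mat_const \<xi> + (part_bound \<xi>)\<^sup>2) * \<rho>\<^sup>2 * norm y)"
    by (simp add: mult_ac)
qed

lemma form_coeff_large: "i > 4 \<Longrightarrow> form_coeff \<rho> \<xi> i u v = 0"
proof -
  assume i: "i > 4"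
  have "pair_form \<rho> \<xi> a (i - a) u v = 0" for a
    using i by (cases "a > 2") (auto simp: pair_form_zero)
  then show ?thesis by (simp add: form_coeff_def)
qed

lemma bloch_form_h2:
  assumes u: "u \<in> H2_per"
  shows "Re (bloch_form A \<rho> (t *\<^sub>R \<xi>) u (rep_h2 y)) = (\<Sum>i\<le>4. t ^ i * h2_form \<rho> \<xi> i (abs_h2 u) y)"
proof -
  have "form_coeff \<rho> \<xi> i u (rep_h2 y) = form_coeff \<rho> \<xi> i (rep_h2 (abs_h2 u)) (rep_h2 y)" for i
    using rep_abs_rel[OF u] by (intro form_coeff_cong) (auto simp: h2_rel_def elim: eventually_mono)
  then show ?thesis
    by (simp add: bloch_form_expand[OF u] h2_form_def flip: of_real_power)
qed

text \<open>A sum of nonnegative terms, so that it dominates each of them; these are the lower bounds that the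
  assumptions of \<open>perturbation_data\<close> require of \<open>K\<close>. It does not contain
  \<open>\<rho>\<close>.\<close>

definition data_const :: "real \<Rightarrow> real ^ 'd \<Rightarrow> real" where
  "data_const k \<xi> = 3 * (mat_const \<xi> + (part_bound \<xi>)\<^sup>2)
     + 3 * mat_const \<xi> * norm (h2_const k :: 'd h2)
     + 3 * mat_const \<xi> * (norm (h2_const k :: 'd h2))\<^sup>2 + norm (h2_const k :: 'd h2) + 3
     + 1 / (k\<^sup>2 * vol TYPE('d))"

lemma data_const_ge:
  "0 \<le> data_const k \<xi>" "3 \<le> data_const k \<xi>"
  "3 * (mat_const \<xi> + (part_bound \<xi>)\<^sup>2) \<le> data_const k \<xi>"
  "3 * mat_const \<xi> * norm (h2_const k :: 'd h2) \<le> data_const k \<xi>"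
  "3 * mat_const \<xi> * (norm (h2_const k :: 'd h2))\<^sup>2 \<le> data_const k \<xi>"
  "norm (h2_const k :: 'd h2) \<le> data_const k \<xi>"
  "1 / (k\<^sup>2 * vol TYPE('d)) \<le> data_const k \<xi>"
proof -
  have "0 \<le> 3 * (mat_const \<xi> + (part_bound \<xi>)\<^sup>2)" "0 \<le> 3 * mat_const \<xi> * norm (h2_const k :: 'd h2)"
    "0 \<le> 3 * mat_const \<xi> * (norm (h2_const k :: 'd h2))\<^sup>2" "0 \<le> norm (h2_const k :: 'd h2)"
    "0 \<le> 1 / (k\<^sup>2 * vol TYPE('d))"
    using mat_const_nonneg vol_pos[where 'd='d] by (auto simp: less_imp_le)
  then show "0 \<le> data_const k \<xi>" "3 \<le> data_const k \<xi>"
  "3 * (mat_const \<xi> + (part_bound \<xi>)\<^sup>2) \<le> data_const k \<xi>"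
  "3 * mat_const \<xi> * norm (h2_const k :: 'd h2) \<le> data_const k \<xi>"
  "3 * mat_const \<xi> * (norm (h2_const k :: 'd h2))\<^sup>2 \<le> data_const k \<xi>"
  "norm (h2_const k :: 'd h2) \<le> data_const k \<xi>"
  "1 / (k\<^sup>2 * vol TYPE('d)) \<le> data_const k \<xi>"
    unfolding data_const_def by linarith+
qed

lemma h2_form_const_left:
  "h2_form \<rho> \<xi> i (h2_const k) y = Re (form_coeff \<rho> \<xi> i (\<lambda>_. of_real k) (rep_h2 y))"
  unfolding h2_form_def by (subst form_coeff_cong[OF rep_h2_const[of k], of "rep_h2 y" "rep_h2 y"]) auto

lemma h2_form_const_right:
  "h2_form \<rho> \<xi> i y (h2_const k) = Re (form_coeff \<rho> \<xi> i (rep_h2 y) (\<lambda>_. of_real k))"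
  unfolding h2_form_def by (subst form_coeff_cong[OF _ rep_h2_const[of k], of "rep_h2 y" "rep_h2 y"]) auto

lemma h2_form_const_const:
  "h2_form \<rho> \<xi> i (h2_const k) (h2_const k) = Re (form_coeff \<rho> \<xi> i (\<lambda>_. of_real k) (\<lambda>_. of_real k))"
  unfolding h2_form_def using form_coeff_cong[OF rep_h2_const[of k] rep_h2_const[of k]] by simp

lemma pairing_const:
  "Re (h2_pairing x (h2_const k)) = k * Re (fc (rep_h2 x) 0)"
  "Re (h2_pairing (h2_const k) x) = k * Re (fc (rep_h2 x) 0)"
proof -
  have 1: "h2_pairing x (h2_const k) = L2_inner (rep_h2 x) (\<lambda>_. of_real k)"
    unfolding h2_pairing_def h2_const_def by (simp add: L2_inner_rep_abs H2_per_const)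
  have 2: "h2_pairing (h2_const k) x = L2_inner (\<lambda>_. of_real k) (rep_h2 x)"
    unfolding h2_pairing_def h2_const_def by (simp add: L2_inner_rep_abs H2_per_const)
  show "Re (h2_pairing x (h2_const k)) = k * Re (fc (rep_h2 x) 0)"
    "Re (h2_pairing (h2_const k) x) = k * Re (fc (rep_h2 x) 0)"
    unfolding 1 2 by (simp_all add: L2_inner_const_right L2_inner_const_left)
qed

lemma fc_h2_const: "fc (rep_h2 (h2_const k :: 'd h2)) 0 = of_real (k * vol TYPE('d))"
  using mean_const[of "of_real k", where 'd='d] vol_pos[where 'd='d]
  unfolding h2_const_def fc_rep_abs[OF H2_per_const(1)] mean_fc
  by (simp add: scaleR_conv_of_real field_simps)

text \<open>Both sides of the weak eigenvalue equation are power series in \<open>t\<close> on the line;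
  equality of their coefficients is the recursion. The mean of the branch is a constant power series, which
  puts \<open>p m\<close> into \<open>zero_mean\<close> for \<open>m \<ge> 1\<close>.\<close>

lemma perturbation_data_branch:
  fixes \<phi> :: "real ^ 'd \<Rightarrow> real ^ 'd \<Rightarrow> complex"
  assumes \<rho>: "\<rho> \<ge> 1" and U: "open U" "0 \<in> U" and k: "k > 0"
    and eig: "\<And>\<eta>. \<eta> \<in> U \<Longrightarrow> eigenfunction A \<rho> \<eta> (lam \<eta>) (\<phi> \<eta>)"
    and mean: "\<And>\<eta>. \<eta> \<in> U \<Longrightarrow> mean (\<phi> \<eta>) = complex_of_real k"
    and psl: "has_power_series lc lam 0"
    and psc: "has_power_series c (\<lambda>\<eta>. abs_h2 (\<phi> \<eta>)) 0"
  shows "perturbation_data (data_const k \<xi>) \<rho> zero_mean (h2_const k) (h2_form \<rho> \<xi>)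
           (\<lambda>x y. Re (h2_pairing x y)) (homog_part c \<xi>) (homog_part lc \<xi>)"
proof -
  define p where "p = homog_part c \<xi>"
  define l where "l = homog_part lc \<xi>"
  define e where "e = (h2_const k :: 'd h2)"
  define V where "V = vol TYPE('d)"
  have V: "V > 0" unfolding V_def by (rule vol_pos)
  have inU: "eventually (\<lambda>t. t *\<^sub>R \<xi> \<in> U) (nhds 0)" by (rule line_eventually_in[OF U])
  have \<phi>: "\<phi> \<eta> \<in> H2_per" if "\<eta> \<in> U" for \<eta> using eig[OF that] by (simp add: eigenfunction_def)
  have series: "eventually (\<lambda>t. summable (\<lambda>m. norm (h (p m) * t ^ m)) \<and>
      (\<lambda>m. h (p m) * t ^ m) sums h (abs_h2 (\<phi> (t *\<^sub>R \<xi>)))) (nhds 0)" if h: "bounded_linear h" for h :: "'d h2 \<Rightarrow> real"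
    using has_power_series_line_eventually[OF has_power_series_bounded_linear[OF psc h], of \<xi>]
    unfolding homog_part_linear[OF h] p_def .
  have bl_L: "bounded_linear (\<lambda>x. Re (h2_pairing x v))" for v :: "'d h2"
    unfolding h2_pairing_def by (intro bounded_linear_compose[OF bounded_linear_Re] bounded_linear_L2_inner) simp
  have recursion: "(\<Sum>i\<le>m. h2_form \<rho> \<xi> i (p (m - i)) v) = (\<Sum>i\<le>m. l i * Re (h2_pairing (p (m - i)) v))" for m v
  proof (rule real_powser_unique_eventually)
    let ?f = "\<lambda>t. lam (t *\<^sub>R \<xi>) * Re (h2_pairing (abs_h2 (\<phi> (t *\<^sub>R \<xi>))) v)"
    have "eventually (\<lambda>t. \<forall>i\<in>{..4}. (\<lambda>m. h2_form \<rho> \<xi> i (p m) v * t ^ m) sums h2_form \<rho> \<xi> i (abs_h2 (\<phi> (t *\<^sub>R \<xi>))) v) (nhds 0)"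
    proof (rule eventually_ball_finite)
      show "\<forall>i\<in>{..4}. eventually (\<lambda>t. (\<lambda>m. h2_form \<rho> \<xi> i (p m) v * t ^ m) sums h2_form \<rho> \<xi> i (abs_h2 (\<phi> (t *\<^sub>R \<xi>))) v) (nhds 0)"
      proof
        fix i
        show "eventually (\<lambda>t. (\<lambda>m. h2_form \<rho> \<xi> i (p m) v * t ^ m) sums h2_form \<rho> \<xi> i (abs_h2 (\<phi> (t *\<^sub>R \<xi>))) v) (nhds 0)"
          using series[OF bounded_linear_h2_form[OF \<rho>, of \<xi> i v]] by (rule eventually_mono) simp
      qed
    qed simp
    then show "eventually (\<lambda>t. (\<lambda>m. (\<Sum>i\<le>m. h2_form \<rho> \<xi> i (p (m - i)) v) * t ^ m) sums ?f t) (nhds 0)"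
      using inU
    proof eventually_elim
      case (elim t)
      let ?u = "\<phi> (t *\<^sub>R \<xi>)"
      have "(\<lambda>m. \<Sum>i\<le>4. (if i \<le> m then h2_form \<rho> \<xi> i (p (m - i)) v else 0) * t ^ m) sums
          (\<Sum>i\<le>4. t ^ i * h2_form \<rho> \<xi> i (abs_h2 ?u) v)"
        using elim(1) by (intro sums_sum sums_shift_power) auto
      also have "(\<lambda>m. \<Sum>i\<le>4. (if i \<le> m then h2_form \<rho> \<xi> i (p (m - i)) v else 0) * t ^ m)
          = (\<lambda>m. (\<Sum>i\<le>m. h2_form \<rho> \<xi> i (p (m - i)) v) * t ^ m)"
      proof
        fix m
        have "(\<Sum>i\<le>4. if i \<le> m then h2_form \<rho> \<xi> i (p (m - i)) v else 0)
            = (\<Sum>i\<in>{..4} \<inter> {..m}. h2_form \<rho> \<xi> i (p (m - i)) v)"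
          by (rule sum.mono_neutral_cong_right) auto
        also have "\<dots> = (\<Sum>i\<le>m. h2_form \<rho> \<xi> i (p (m - i)) v)"
        proof (intro sum.mono_neutral_left ballI)
          fix i assume "i \<in> {..m} - {..4} \<inter> {..m}"
          then have "i > 4" by auto
          then show "h2_form \<rho> \<xi> i (p (m - i)) v = 0" by (simp add: h2_form_def form_coeff_large)
        qed auto
        finally show "(\<Sum>i\<le>4. (if i \<le> m then h2_form \<rho> \<xi> i (p (m - i)) v else 0) * t ^ m)
            = (\<Sum>i\<le>m. h2_form \<rho> \<xi> i (p (m - i)) v) * t ^ m"
          by (simp only: sum_distrib_right[symmetric])
      qed
      also have "(\<Sum>i\<le>4. t ^ i * h2_form \<rho> \<xi> i (abs_h2 ?u) v) = Re (bloch_form A \<rho> (t *\<^sub>R \<xi>) ?u (rep_h2 v))"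
        using \<phi>[OF elim(2)] by (rule bloch_form_h2[symmetric])
      also have "bloch_form A \<rho> (t *\<^sub>R \<xi>) ?u (rep_h2 v) = of_real (lam (t *\<^sub>R \<xi>)) * L2_inner ?u (rep_h2 v)"
        using eig[OF elim(2)] by (simp add: eigenfunction_def)
      also have "L2_inner ?u (rep_h2 v) = h2_pairing (abs_h2 ?u) v"
        unfolding h2_pairing_def using \<phi>[OF elim(2)] by (simp add: L2_inner_rep_abs)
      finally show ?case by simp
    qed
    have "eventually (\<lambda>t. summable (\<lambda>m. norm (l m * t ^ m)) \<and> (\<lambda>m. l m * t ^ m) sums lam (t *\<^sub>R \<xi>)) (nhds 0)"
      using has_power_series_line_eventually[OF psl, of \<xi>] unfolding l_def .
    then show "eventually (\<lambda>t. (\<lambda>m. (\<Sum>i\<le>m. l i * Re (h2_pairing (p (m - i)) v)) * t ^ m) sums ?f t) (nhds 0)"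
      using series[OF bl_L[of v]]
    proof eventually_elim
      case (elim t)
      have "(\<lambda>m. \<Sum>i\<le>m. (l i * t ^ i) * (Re (h2_pairing (p (m - i)) v) * t ^ (m - i))) sums
          ((\<Sum>m. l m * t ^ m) * (\<Sum>m. Re (h2_pairing (p m) v) * t ^ m))"
        using elim by (intro Cauchy_product_sums) auto
      also have "(\<Sum>m. l m * t ^ m) * (\<Sum>m. Re (h2_pairing (p m) v) * t ^ m) = ?f t"
        using elim by (simp add: sums_iff)
      also have "(\<lambda>m. \<Sum>i\<le>m. (l i * t ^ i) * (Re (h2_pairing (p (m - i)) v) * t ^ (m - i)))
          = (\<lambda>m. (\<Sum>i\<le>m. l i * Re (h2_pairing (p (m - i)) v)) * t ^ m)"
      proof
        fix m
        show "(\<Sum>i\<le>m. (l i * t ^ i) * (Re (h2_pairing (p (m - i)) v) * t ^ (m - i)))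
          = (\<Sum>i\<le>m. l i * Re (h2_pairing (p (m - i)) v)) * t ^ m"
          unfolding sum_distrib_right
        proof (rule sum.cong[OF refl])
          fix i assume "i \<in> {..m}"
          then have "t ^ m = t ^ i * t ^ (m - i)" by (simp flip: power_add)
          then show "(l i * t ^ i) * (Re (h2_pairing (p (m - i)) v) * t ^ (m - i))
              = l i * Re (h2_pairing (p (m - i)) v) * t ^ m" by simp
        qed
      qed
      finally show ?case .
    qed
  qed
  have fc\<phi>: "fc (rep_h2 (abs_h2 (\<phi> \<eta>))) 0 = of_real (V * k)" if "\<eta> \<in> U" for \<eta>
    using mean[OF that] V unfolding fc_rep_abs[OF \<phi>[OF that]] mean_fc V_def[symmetric]
    by (simp add: scaleR_conv_of_real field_simps)
  have const: "h (p m) = (if m = 0 then C else 0)"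
    if h: "bounded_linear h" and C: "\<And>\<eta>. \<eta> \<in> U \<Longrightarrow> h (abs_h2 (\<phi> \<eta>)) = C" for h :: "'d h2 \<Rightarrow> real" and C m
  proof (rule real_powser_unique_eventually[where a="\<lambda>m. h (p m)" and b="\<lambda>m. if m = 0 then C else 0"])
    show "eventually (\<lambda>t. (\<lambda>m. h (p m) * t ^ m) sums h (abs_h2 (\<phi> (t *\<^sub>R \<xi>)))) (nhds 0)"
      using series[OF h] by (rule eventually_mono) simp
    show "eventually (\<lambda>t. (\<lambda>m. (if m = 0 then C else 0) * t ^ m) sums h (abs_h2 (\<phi> (t *\<^sub>R \<xi>)))) (nhds 0)"
      using inU
    proof eventually_elim
      case (elim t)
      have "(\<lambda>m. (if m = 0 then C else 0) * t ^ m) = (\<lambda>m. if m = 0 then C else 0)" by auto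
      then show ?case using sums_single[of 0 "\<lambda>_. C"] C[OF elim] by simp
    qed
  qed
  have Re_fc: "Re (fc (rep_h2 (p m)) 0) = (if m = 0 then V * k else 0)" for m
    by (rule const[OF bounded_linear_compose[OF bounded_linear_Re bounded_linear_fc]]) (simp add: fc\<phi>)
  have Im_fc: "Im (fc (rep_h2 (p m)) 0) = (if m = 0 then 0 else 0)" for m
    by (rule const[OF bounded_linear_compose[OF bounded_linear_Im bounded_linear_fc]]) (simp add: fc\<phi>)
  have zero_mean_iff: "x \<in> zero_mean \<longleftrightarrow> fc (rep_h2 x) 0 = 0" for x :: "'d h2"
    by (simp add: zero_mean_def fc_zero_mean)
  have p_Z: "p m \<in> zero_mean" if "m \<ge> 1" for m
    using Re_fc[of m] Im_fc[of m] that by (simp add: zero_mean_iff complex_eq_iff)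
  have b0_e: "h2_form \<rho> \<xi> 0 v e = 0" "h2_form \<rho> \<xi> 0 e v = 0" for v
    unfolding e_def h2_form_const_right h2_form_const_left by (simp_all add: form_coeff_0_const)
  have coercive: "\<rho>\<^sup>2 * (norm v)\<^sup>2 \<le> 3 * h2_form \<rho> \<xi> 0 v v" if "v \<in> zero_mean" for v
    using form_coeff_coercive[of "rep_h2 v" \<rho> \<xi>] that
    by (simp add: zero_mean_def h2_form_def H2_norm_rep)
  have l0: "l 0 = 0"
  proof -
    have "0 = l 0 * Re (h2_pairing (p 0) e)" using recursion[of 0 e] b0_e(1) by simp
    then show ?thesis using V k by (simp add: e_def pairing_const Re_fc)
  qed
  \<comment> \<open>\<open>p 0 - e\<close> has zero mean and zero energy, so coercivity applies.\<close>
  have p0: "p 0 = e"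
  proof -
    interpret b: bounded_linear "\<lambda>x. h2_form \<rho> \<xi> 0 x (p 0 - e)" by (rule bounded_linear_h2_form[OF \<rho>])
    interpret f: bounded_linear "\<lambda>x :: 'd h2. fc (rep_h2 x) 0" by (rule bounded_linear_fc)
    have "fc (rep_h2 (p 0 - e)) 0 = 0"
      unfolding f.diff using Re_fc[of 0] Im_fc[of 0]
      by (simp add: e_def fc_h2_const complex_eq_iff V_def mult.commute)
    then have Z: "p 0 - e \<in> zero_mean" by (simp add: zero_mean_iff)
    have "h2_form \<rho> \<xi> 0 (p 0) (p 0 - e) = 0" using recursion[of 0 "p 0 - e"] l0 by simp
    then have "h2_form \<rho> \<xi> 0 (p 0 - e) (p 0 - e) = 0" by (simp add: b.diff b0_e)
    then have "\<rho>\<^sup>2 * (norm (p 0 - e))\<^sup>2 \<le> 0" using coercive[OF Z] by simp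
    then have "(norm (p 0 - e))\<^sup>2 \<le> 0" using \<rho> by (simp add: mult_le_0_iff)
    then show ?thesis by simp
  qed
  show ?thesis
    unfolding p_def[symmetric] l_def[symmetric] e_def[symmetric]
  proof
    let ?K = "data_const k \<xi>"
    note K = data_const_ge[where k=k and \<xi>=\<xi>]
    show "0 \<le> ?K" by (rule K)
    show "1 \<le> \<rho>" by fact
    show "(\<Sum>i\<le>m. h2_form \<rho> \<xi> i (p (m - i)) v) = (\<Sum>i\<le>m. l i * Re (h2_pairing (p (m - i)) v))" for m v
      by (rule recursion)
    show "\<bar>h2_form \<rho> \<xi> i u v\<bar> \<le> ?K * \<rho>\<^sup>2 * norm u * norm v" for i u v
    proof -
      have "\<bar>h2_form \<rho> \<xi> i u v\<bar> \<le> 3 * (mat_const \<xi> + (part_bound \<xi>)\<^sup>2) * (\<rho>\<^sup>2 * (norm u * norm v))"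
        unfolding h2_form_def using form_coeff_le[OF rep_h2(1) rep_h2(1) \<rho>, of \<xi> i u v]
        by (intro order_trans[OF abs_Re_le_cmod]) (simp add: H2_norm_rep mult.assoc)
      also have "\<dots> \<le> ?K * (\<rho>\<^sup>2 * (norm u * norm v))" by (intro mult_right_mono K) simp
      finally show ?thesis by (simp add: mult_ac)
    qed
    show "\<bar>h2_form \<rho> \<xi> i e v\<bar> \<le> ?K * norm v" if "v \<in> zero_mean" for i v
    proof -
      have "\<bar>h2_form \<rho> \<xi> i e v\<bar> \<le> 3 * mat_const \<xi> * (norm e * norm v)"
        unfolding e_def h2_form_const_left
        using form_coeff_const_left[of "rep_h2 v" i \<rho> \<xi> "of_real k"] that
        by (intro order_trans[OF abs_Re_le_cmod]) (simp add: zero_mean_def H2_norm_rep norm_h2_const)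
      also have "\<dots> = (3 * mat_const \<xi> * norm e) * norm v" by simp
      also have "\<dots> \<le> ?K * norm v" unfolding e_def by (intro mult_right_mono K) simp
      finally show ?thesis .
    qed
    show "\<bar>h2_form \<rho> \<xi> i v e\<bar> \<le> ?K * norm v" if "v \<in> zero_mean" for i v
    proof -
      have "\<bar>h2_form \<rho> \<xi> i v e\<bar> \<le> 3 * mat_const \<xi> * (norm v * norm e)"
        unfolding e_def h2_form_const_right
        using form_coeff_const_right[of "rep_h2 v" \<rho> \<xi> i "of_real k"] that
        by (intro order_trans[OF abs_Re_le_cmod]) (simp add: zero_mean_def H2_norm_rep norm_h2_const)
      also have "\<dots> = (3 * mat_const \<xi> * norm e) * norm v" by simp
      also have "\<dots> \<le> ?K * norm v" unfolding e_def by (intro mult_right_mono K) simp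
      finally show ?thesis .
    qed
    show "h2_form \<rho> \<xi> 0 v e = 0" for v by (rule b0_e)
    show "\<bar>h2_form \<rho> \<xi> i e e\<bar> \<le> ?K" if "i \<noteq> 4" for i
    proof -
      have "\<bar>h2_form \<rho> \<xi> i e e\<bar> \<le> 3 * mat_const \<xi> * (norm e * norm e)"
        unfolding e_def h2_form_const_const norm_h2_const
        using that by (intro order_trans[OF abs_Re_le_cmod] form_coeff_const_left H2_per_const) auto
      also have "\<dots> \<le> ?K" using K(5) by (simp add: e_def power2_eq_square)
      finally show ?thesis .
    qed
    show "\<rho>\<^sup>2 * (norm v)\<^sup>2 \<le> ?K * h2_form \<rho> \<xi> 0 v v" if "v \<in> zero_mean" for v
    proof -
      have c: "\<rho>\<^sup>2 * (norm v)\<^sup>2 \<le> 3 * h2_form \<rho> \<xi> 0 v v" by (rule coercive[OF that])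
      moreover have "0 \<le> \<rho>\<^sup>2 * (norm v)\<^sup>2" by simp
      ultimately have "0 \<le> h2_form \<rho> \<xi> 0 v v" by linarith
      then have "3 * h2_form \<rho> \<xi> 0 v v \<le> ?K * h2_form \<rho> \<xi> 0 v v" by (intro mult_right_mono K)
      then show ?thesis using c by linarith
    qed
    show "Re (h2_pairing e v) = 0" "Re (h2_pairing v e) = 0" if "v \<in> zero_mean" for v
      using that by (simp_all add: e_def pairing_const zero_mean_iff)
    show "1 \<le> ?K * Re (h2_pairing e e)"
    proof -
      have eq: "Re (h2_pairing e e) = k\<^sup>2 * V"
        by (simp add: e_def pairing_const fc_h2_const V_def power2_eq_square)
      have "1 / (k\<^sup>2 * V) * (k\<^sup>2 * V) \<le> ?K * (k\<^sup>2 * V)"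
        using K(7) V by (intro mult_right_mono) (auto simp: V_def)
      then show ?thesis unfolding eq using k V by simp
    qed
    show "\<bar>Re (h2_pairing u v)\<bar> \<le> norm u * norm v" for u v
    proof -
      have "\<bar>Re (h2_pairing u v)\<bar> \<le> L2_norm (rep_h2 u) * L2_norm (rep_h2 v)"
        unfolding h2_pairing_def
        by (intro order_trans[OF abs_Re_le_cmod] L2_Cauchy_Schwarz) auto
      also have "\<dots> \<le> norm u * norm v"
        using L2_norm_le_H2_norm(1) by (intro mult_mono) (auto simp flip: H2_norm_rep)
      finally show ?thesis .
    qed
    show "norm e \<le> ?K" unfolding e_def by (rule K)
    show "p 0 = e" by (rule p0)
    show "p m \<in> zero_mean" if "1 \<le> m" for m using that by (rule p_Z)
    show "l 0 = 0" by (rule l0)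
  qed
qed

lemma matrix_form_cnj:
  "matrix_form (\<lambda>j y. cnj (F j y)) (\<lambda>j y. cnj (G j y)) = cnj (matrix_form F G)"
proof -
  have "L2_inner (\<lambda>y. complex_of_real (A y $ j $ k) * cnj (F k y)) (\<lambda>y. cnj (G j y))
      = cnj (L2_inner (\<lambda>y. complex_of_real (A y $ j $ k) * F k y) (G j))" for j k
    unfolding L2_inner_def Bochner_Integration.integral_cnj[symmetric] by simp
  then show ?thesis by (simp add: matrix_form_def)
qed

lemma bloch_form_matrix_form:
  assumes u: "u \<in> H2_per" and v: "v \<in> H2_per"
  shows "bloch_form A \<rho> \<eta> u v = matrix_form (shifted_grad \<eta> u) (shifted_grad \<eta> v)
     + of_real (\<rho>\<^sup>2) * L2_inner (shifted_lap \<eta> u) (shifted_lap \<eta> v)"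
proof -
  have g: "shifted_grad \<eta> u j \<in> L2_cell" if "u \<in> H2_per" for u j
    using shifted_grad_expand[of 1 \<eta> u j] that by (auto intro!: L2_cell_sum L2_cell_cmult grad_part_L2)
  show ?thesis
    unfolding bloch_form_def L2_inner_def using matrix_form_integral[OF g[OF u] g[OF v]] by simp
qed

text \<open>The matrix is real, and conjugation turns \<open>\<nabla> + i \<eta>\<close> into
  \<open>\<nabla> - i \<eta>\<close>.\<close>

lemma bloch_form_cnj:
  assumes u: "u \<in> H2_per" and v: "v \<in> H2_per"
  shows "bloch_form A \<rho> (- \<eta>) (\<lambda>y. cnj (u y)) (\<lambda>y. cnj (v y)) = cnj (bloch_form A \<rho> \<eta> u v)"
proof -
  have g: "shifted_grad \<eta> u j \<in> L2_cell" if "u \<in> H2_per" for u j \<eta>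
    using shifted_grad_expand[of 1 \<eta> u j] that by (auto intro!: L2_cell_sum L2_cell_cmult grad_part_L2)
  have s: "shifted_lap \<eta> u \<in> L2_cell" if "u \<in> H2_per" for u \<eta>
    using shifted_lap_expand[of 1 \<eta> u] that by (auto intro!: L2_cell_sum L2_cell_cmult lap_part_L2)
  have gc: "ae_eq (shifted_grad (- \<eta>) (\<lambda>y. cnj (u y)) j) (\<lambda>y. cnj (shifted_grad \<eta> u j y))"
    if "u \<in> H2_per" for u j
    using H1_per_cnj(2)[OF H2_perD(1)[OF that], of j] by eventually_elim (simp add: shifted_grad_def)
  have sc: "ae_eq (shifted_lap (- \<eta>) (\<lambda>y. cnj (u y))) (\<lambda>y. cnj (shifted_lap \<eta> u y))"
    if u: "u \<in> H2_per" for u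
  proof -
    have 1: "AE y in cellM. \<forall>j. weak_pd j (\<lambda>y. cnj (u y)) y = cnj (weak_pd j u y)"
      using H1_per_cnj(2)[OF H2_perD(1)[OF u]] by (intro eventually_all_finite)
    have 2: "AE y in cellM. \<forall>j. weak_pd j (weak_pd j (\<lambda>y. cnj (u y))) y = cnj (weak_pd j (weak_pd j u) y)"
      using H2_per_cnj(2)[OF u] by (intro eventually_all_finite)
    show ?thesis
      using 1 2 by eventually_elim (simp add: shifted_lap_def sum_negf)
  qed
  note C = H2_per_cnj(1)[OF u] H2_per_cnj(1)[OF v]
  have "matrix_form (shifted_grad (- \<eta>) (\<lambda>y. cnj (u y))) (shifted_grad (- \<eta>) (\<lambda>y. cnj (v y)))
      = matrix_form (\<lambda>j y. cnj (shifted_grad \<eta> u j y)) (\<lambda>j y. cnj (shifted_grad \<eta> v j y))"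
    by (intro matrix_form_cong gc g C u v L2_cell_cnj)
  moreover have "L2_inner (shifted_lap (- \<eta>) (\<lambda>y. cnj (u y))) (shifted_lap (- \<eta>) (\<lambda>y. cnj (v y)))
      = L2_inner (\<lambda>y. cnj (shifted_lap \<eta> u y)) (\<lambda>y. cnj (shifted_lap \<eta> v y))"
    by (intro L2_inner_cong_AE sc s C u v L2_cell_cnj)
  moreover have "L2_inner (\<lambda>y. cnj (shifted_lap \<eta> u y)) (\<lambda>y. cnj (shifted_lap \<eta> v y))
      = cnj (L2_inner (shifted_lap \<eta> u) (shifted_lap \<eta> v))"
    unfolding L2_inner_def Bochner_Integration.integral_cnj[symmetric] by simp
  ultimately show ?thesis
    unfolding bloch_form_matrix_form[OF u v] bloch_form_matrix_form[OF C] matrix_form_cnj by simp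
qed

lemma eigenfunction_cnj:
  assumes "eigenfunction A \<rho> \<eta> \<mu> u"
  shows "eigenfunction A \<rho> (- \<eta>) \<mu> (\<lambda>y. cnj (u y))"
  unfolding eigenfunction_def
proof (intro conjI ballI)
  have u: "u \<in> H2_per" using assms by (simp add: eigenfunction_def)
  show "(\<lambda>y. cnj (u y)) \<in> H2_per" by (rule H2_per_cnj(1)[OF u])
  show "\<not> (AE y in lebesgue. cnj (u y) = 0)" using assms by (simp add: eigenfunction_def)
  fix v :: "real ^ 'd \<Rightarrow> complex" assume v: "v \<in> H2_per"
  have "bloch_form A \<rho> (- \<eta>) (\<lambda>y. cnj (u y)) v = cnj (bloch_form A \<rho> \<eta> u (\<lambda>y. cnj (v y)))"
    using bloch_form_cnj[OF u H2_per_cnj(1)[OF v]] by simp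
  also have "\<dots> = cnj (of_real \<mu> * L2_inner u (\<lambda>y. cnj (v y)))"
    using assms H2_per_cnj(1)[OF v] by (simp add: eigenfunction_def)
  also have "\<dots> = of_real \<mu> * L2_inner (\<lambda>y. cnj (u y)) v"
    unfolding L2_inner_def complex_cnj_mult Bochner_Integration.integral_cnj[symmetric] by simp
  finally show "bloch_form A \<rho> (- \<eta>) (\<lambda>y. cnj (u y)) v = of_real \<mu> * L2_inner (\<lambda>y. cnj (u y)) v" .
qed

text \<open>The sets of eigenvalues at \<open>\<eta>\<close> and \<open>- \<eta>\<close> coincide.\<close>

lemma lambda1_even: "lambda1 A \<rho> (- \<eta>) = lambda1 A \<rho> \<eta>"
proof -
  have "(\<exists>u. eigenfunction A \<rho> (- \<eta>) \<mu> u) \<longleftrightarrow> (\<exists>u. eigenfunction A \<rho> \<eta> \<mu> u)" for \<mu>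
    using eigenfunction_cnj[of \<rho> \<eta> \<mu>] eigenfunction_cnj[of \<rho> "- \<eta>" \<mu>] by auto
  then show ?thesis by (simp add: lambda1_def)
qed

end

lemma even_homog_part_odd:
  fixes f :: "real ^ 'd \<Rightarrow> real"
  assumes ps: "has_power_series c f 0" and even: "\<And>x. f (- x) = f x" and m: "odd m"
  shows "homog_part c \<xi> m = 0"
proof -
  have "homog_part c \<xi> m = (- 1) ^ m * homog_part c \<xi> m"
  proof (rule real_powser_unique_eventually)
    have ev: "eventually (\<lambda>t. (\<lambda>m. homog_part c \<xi> m * t ^ m) sums f (t *\<^sub>R \<xi>)) (nhds 0)"
      using has_power_series_line_eventually[OF ps, of \<xi>] by (rule eventually_mono) simp
    then show "eventually (\<lambda>t. (\<lambda>m. homog_part c \<xi> m * t ^ m) sums f (t *\<^sub>R \<xi>)) (nhds 0)" .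
    have "filterlim uminus (nhds 0) (nhds (0::real))"
      using tendsto_minus[of "\<lambda>t. t" 0 "nhds (0::real)"] by (simp add: filterlim_ident)
    from eventually_compose_filterlim[OF ev this]
    show "eventually (\<lambda>t. (\<lambda>m. (- 1) ^ m * homog_part c \<xi> m * t ^ m) sums f (t *\<^sub>R \<xi>)) (nhds 0)"
    proof (rule eventually_mono)
      fix t assume "(\<lambda>m. homog_part c \<xi> m * (- t) ^ m) sums f ((- t) *\<^sub>R \<xi>)"
      moreover have "homog_part c \<xi> m * (- t) ^ m = (- 1) ^ m * homog_part c \<xi> m * t ^ m" for m
        by (simp add: power_minus[of t])
      ultimately show "(\<lambda>m. (- 1) ^ m * homog_part c \<xi> m * t ^ m) sums f (t *\<^sub>R \<xi>)"
        using even[of "t *\<^sub>R \<xi>"] by simp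
    qed
  qed
  then show ?thesis using m by simp
qed

section \<open>Bounds for the mixed derivatives\<close>

lemma mi_size_add: "mi_size (\<beta> + \<gamma>) = mi_size \<beta> + mi_size \<gamma>"
  by (simp add: mi_size_def sum.distrib)

lemma mi_size_axis: "mi_size (axis j 1) = 1"
proof -
  have "mi_size (axis j 1) = (\<Sum>i\<in>UNIV. if i = j then 1 else 0)"
    unfolding mi_size_def by (rule sum.cong) (auto simp: axis_def)
  then show ?thesis by simp
qed

lemma mi_power_add: "mi_power x (\<beta> + \<gamma>) = mi_power x \<beta> * mi_power x \<gamma>"
  by (simp add: mi_power_def power_add prod.distrib)

lemma mi_power_axis: "mi_power x (axis j 1) = x $ j"
proof -
  have "mi_power x (axis j 1) = (\<Prod>i\<in>UNIV. if i = j then x $ j else 1)"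
    unfolding mi_power_def by (rule prod.cong) (auto simp: axis_def)
  then show ?thesis by simp
qed

lemma mi_fact_axis: "mi_fact (axis j 1) = 1"
  using mi_fact_Suc[of 0 j] by (simp add: mi_fact_def)

lemma mi_fact_axis_axis: "mi_fact (axis j 1 + axis k 1) = (if j = k then 2 else 1)"
  unfolding mi_fact_Suc mi_fact_axis by (simp add: axis_def)

lemma axis_add_axis_eq_iff:
  "axis a (1::nat) + axis b 1 = axis j 1 + axis k 1 \<longleftrightarrow> (a = j \<and> b = k) \<or> (a = k \<and> b = j)"
proof
  assume eq: "axis a (1::nat) + axis b 1 = axis j 1 + axis k 1"
  have "(axis a (1::nat) + axis b 1) $ i = (axis j 1 + axis k 1) $ i" for i by (simp only: eq)
  from this[of a] this[of b] this[of j] this[of k]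
  show "(a = j \<and> b = k) \<or> (a = k \<and> b = j)"
    by (auto simp: axis_def split: if_splits)
qed (auto simp: add.commute)

lemma homog_part_diff: "homog_part (\<lambda>\<beta>. c \<beta> - d \<beta>) \<xi> m = homog_part c \<xi> m - homog_part d \<xi> m"
  by (simp add: homog_part_def scaleR_diff_right sum_subtractf)

text \<open>The coefficient of \<open>\<xi>^\<gamma>\<close> in the quadratic form of the matrix
  \<open>m\<close>, which collects \<open>m a b\<close> and \<open>m b a\<close>.\<close>

definition quad_coeff :: "('d \<Rightarrow> 'd \<Rightarrow> real) \<Rightarrow> nat ^ 'd \<Rightarrow> real" where
  "quad_coeff m \<gamma> = (\<Sum>a\<in>UNIV. \<Sum>b\<in>UNIV. if axis a 1 + axis b 1 = \<gamma> then m a b else 0)"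

lemma homog_part_quad_coeff:
  "homog_part (quad_coeff m) \<xi> 2 = (\<Sum>a\<in>UNIV. \<Sum>b\<in>UNIV. \<xi> $ a * \<xi> $ b * m a b)"
  for m :: "'d \<Rightarrow> 'd::finite \<Rightarrow> real"
proof -
  let ?S = "{\<gamma>::nat ^ 'd. mi_size \<gamma> = 2}"
  have "homog_part (quad_coeff m) \<xi> 2
      = (\<Sum>\<gamma>\<in>?S. \<Sum>a\<in>UNIV. \<Sum>b\<in>UNIV. if axis a 1 + axis b 1 = \<gamma> then mi_power \<xi> \<gamma> * m a b else 0)"
    by (simp add: homog_part_def quad_coeff_def sum_distrib_left if_distrib cong: if_cong)
  also have "\<dots> = (\<Sum>a\<in>UNIV. \<Sum>\<gamma>\<in>?S. \<Sum>b\<in>UNIV. if axis a 1 + axis b 1 = \<gamma> then mi_power \<xi> \<gamma> * m a b else 0)"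
    by (rule sum.swap)
  also have "\<dots> = (\<Sum>a\<in>UNIV. \<Sum>b\<in>UNIV. \<Sum>\<gamma>\<in>?S. if axis a 1 + axis b 1 = \<gamma> then mi_power \<xi> \<gamma> * m a b else 0)"
    by (intro sum.cong refl sum.swap)
  also have "\<dots> = (\<Sum>a\<in>UNIV. \<Sum>b\<in>UNIV. mi_power \<xi> (axis a 1 + axis b 1) * m a b)"
  proof (intro sum.cong refl)
    fix a b :: 'd
    have "axis a 1 + axis b 1 \<in> ?S"
      unfolding mem_Collect_eq mi_size_add mi_size_axis by simp
    then show "(\<Sum>\<gamma>\<in>?S. if axis a 1 + axis b 1 = \<gamma> then mi_power \<xi> \<gamma> * m a b else 0)
        = mi_power \<xi> (axis a 1 + axis b 1) * m a b"
      by (subst sum.delta'[OF finite_mi_size]) simp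
  qed
  also have "\<dots> = (\<Sum>a\<in>UNIV. \<Sum>b\<in>UNIV. \<xi> $ a * \<xi> $ b * m a b)"
    unfolding mi_power_add mi_power_axis ..
  finally show ?thesis .
qed

lemma quad_coeff_axis:
  assumes sym: "\<And>a b. m a b = m b a"
  shows "mi_fact (axis j 1 + axis k 1) * quad_coeff m (axis j 1 + axis k 1) = 2 * m j k"
proof -
  have "quad_coeff m (axis j 1 + axis k 1)
      = (\<Sum>a\<in>UNIV. \<Sum>b\<in>UNIV. if (a = j \<and> b = k) \<or> (a = k \<and> b = j) then m a b else 0)"
    unfolding quad_coeff_def axis_add_axis_eq_iff ..
  also have "\<dots> = (if j = k then m j k else 2 * m j k)"
  proof (cases "j = k")
    case True
    have "(\<Sum>b\<in>UNIV. if (a = j \<and> b = k) \<or> (a = k \<and> b = j) then m a b else 0)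
        = (if a = j then m j k else 0)" for a
      using True by (cases "a = j") (auto simp: if_distrib cong: if_cong)
    then show ?thesis using True by simp
  next
    case False
    have "(\<Sum>b\<in>UNIV. if (a = j \<and> b = k) \<or> (a = k \<and> b = j) then m a b else 0)
        = (if a = j then m j k else 0) + (if a = k then m j k else 0)" for a
      using False sym[of k j] by (cases "a = j"; cases "a = k") (auto cong: if_cong)
    then show ?thesis using False by (simp add: sum.distrib)
  qed
  finally show ?thesis unfolding mi_fact_axis_axis by auto
qed

text \<open>Bounds on finitely many lines give a bound for the coefficient. The predicate \<open>P\<close>
  relates the coefficients to the parameter \<open>\<rho>\<close>, over which the constant is uniform.\<close>

lemma coeff_bound_from_lines:
  fixes \<beta> :: "nat ^ 'd" and P :: "real \<Rightarrow> (nat ^ 'd \<Rightarrow> 'a::real_normed_vector) \<Rightarrow> bool"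
  assumes "\<And>\<xi>. \<exists>C\<ge>0. \<forall>\<rho> c. P \<rho> c \<longrightarrow> norm (homog_part c \<xi> (mi_size \<beta>)) \<le> C * s \<rho>"
  shows "\<exists>C\<ge>0. \<forall>\<rho> c. P \<rho> c \<longrightarrow> norm (c \<beta>) \<le> C * s \<rho>"
proof -
  have "\<forall>\<xi>. \<exists>C. C \<ge> 0 \<and> (\<forall>\<rho> c. P \<rho> c \<longrightarrow> norm (homog_part c \<xi> (mi_size \<beta>)) \<le> C * s \<rho>)"
    using assms by blast
  from choice[OF this] obtain C where
    C: "\<forall>\<xi>. C \<xi> \<ge> 0 \<and> (\<forall>\<rho> c. P \<rho> c \<longrightarrow> norm (homog_part c \<xi> (mi_size \<beta>)) \<le> C \<xi> * s \<rho>)" by auto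
  obtain w X where w: "\<forall>c :: nat ^ 'd \<Rightarrow> 'a. c \<beta> = (\<Sum>\<xi>\<in>X. w \<xi> *\<^sub>R homog_part c \<xi> (mi_size \<beta>))"
    using coeff_from_homog_part[where 'a='a, of \<beta>] by auto
  have "norm (c \<beta>) \<le> (\<Sum>\<xi>\<in>X. \<bar>w \<xi>\<bar> * C \<xi>) * s \<rho>" if "P \<rho> c" for \<rho> c
  proof -
    have "norm (c \<beta>) = norm (\<Sum>\<xi>\<in>X. w \<xi> *\<^sub>R homog_part c \<xi> (mi_size \<beta>))" using w by metis
    also have "\<dots> \<le> (\<Sum>\<xi>\<in>X. \<bar>w \<xi>\<bar> * (C \<xi> * s \<rho>))"
    proof (rule sum_norm_le)
      fix \<xi>
      have "norm (homog_part c \<xi> (mi_size \<beta>)) \<le> C \<xi> * s \<rho>" using C that by blast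
      then show "norm (w \<xi> *\<^sub>R homog_part c \<xi> (mi_size \<beta>)) \<le> \<bar>w \<xi>\<bar> * (C \<xi> * s \<rho>)"
        by (simp add: mult_left_mono)
    qed
    finally show ?thesis by (simp add: sum_distrib_right mult.assoc)
  qed
  moreover have "(\<Sum>\<xi>\<in>X. \<bar>w \<xi>\<bar> * C \<xi>) \<ge> 0" using C by (intro sum_nonneg mult_nonneg_nonneg) auto
  ultimately show ?thesis by blast
qed

definition branch_mean :: "nat \<Rightarrow> real" where
  "branch_mean d = (2 * pi) powr (- real d / 2)"

text \<open>All that the bounds use of a branch, stated for its power series at 0 on all lines at once. The
  bound of the matrix is chosen here, before \<open>\<rho>\<close> and the branch, to keep the constants
  uniform.\<close>

definition branch_coeffs ::
  "(real ^ 'd \<Rightarrow> real ^ 'd ^ 'd) \<Rightarrow> real \<Rightarrow> (nat ^ 'd \<Rightarrow> real) \<Rightarrow> (nat ^ 'd \<Rightarrow> 'd::finite h2) \<Rightarrow> bool" where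
  "branch_coeffs A \<rho> lc c \<longleftrightarrow> \<rho> \<ge> 1 \<and>
     (\<forall>\<xi>. perturbation_data (coefficients.data_const (SOME M. coefficients A M) (branch_mean CARD('d)) \<xi>) \<rho> zero_mean
        (h2_const (branch_mean CARD('d))) (coefficients.h2_form A \<rho> \<xi>) (\<lambda>x y. Re (h2_pairing x y))
        (homog_part c \<xi>) (homog_part lc \<xi>)) \<and>
     (\<forall>\<xi> m. odd m \<longrightarrow> homog_part lc \<xi> m = 0)"

lemma ground_branch_coeffs:
  fixes A :: "real ^ 'd::{finite,linorder} \<Rightarrow> real ^ 'd::{finite,linorder} ^ 'd::{finite,linorder}"
  assumes A: "coefficient_matrix A" and \<rho>: "\<rho> \<ge> 1" and br: "ground_branch A \<rho> \<phi>"
  shows "\<exists>lc c. branch_coeffs A \<rho> lc c \<and>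
     (\<forall>\<beta>. mi_pd \<beta> (lambda1 A \<rho>) 0 = mi_fact \<beta> * lc \<beta> \<and>
          H1_norm (mi_H2_pd \<beta> \<phi> 0) \<le> mi_fact \<beta> * norm (c \<beta>))"
proof -
  define M where "M = (SOME M. coefficients A M)"
  have "coefficients A M"
    unfolding M_def using coefficient_matrix_imp_coefficients[OF A] by (rule someI_ex)
  then interpret coefficients A M .
  obtain U where U: "open U" "0 \<in> U"
    and an: "\<And>\<eta>. \<eta> \<in> U \<Longrightarrow> real_analytic_at (lambda1 A \<rho>) \<eta>"
    and H2: "\<And>\<eta>. \<eta> \<in> U \<Longrightarrow> H2_analytic_at \<phi> \<eta>"
    and eig: "\<And>\<eta>. \<eta> \<in> U \<Longrightarrow> eigenfunction A \<rho> \<eta> (lambda1 A \<rho> \<eta>) (\<phi> \<eta>)"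
    and mean: "\<And>\<eta>. \<eta> \<in> U \<Longrightarrow> mean (\<phi> \<eta>) = complex_of_real (branch_mean CARD('d))"
    using br unfolding ground_branch_def branch_mean_def by blast
  have "\<exists>c. has_power_series c (lambda1 A \<rho>) \<eta>" if "\<eta> \<in> U" for \<eta>
    using an[OF that] unfolding real_analytic_at_def has_power_series_def by (auto simp: mult.commute)
  then obtain lc where lc: "\<And>\<eta>. \<eta> \<in> U \<Longrightarrow> has_power_series (lc \<eta>) (lambda1 A \<rho>) \<eta>" by metis
  obtain c where c: "\<And>\<eta>. \<eta> \<in> U \<Longrightarrow> has_power_series (c \<eta>) (\<lambda>\<eta>. abs_h2 (\<phi> \<eta>)) \<eta>"
    using H2_analytic_at_imp_power_series[OF H2] by metis
  have "branch_coeffs A \<rho> (lc 0) (c 0)"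
    unfolding branch_coeffs_def M_def[symmetric]
  proof (intro conjI allI impI \<rho>)
    fix \<xi>
    show "perturbation_data (data_const (branch_mean CARD('d)) \<xi>) \<rho> zero_mean (h2_const (branch_mean CARD('d)))
        (h2_form \<rho> \<xi>) (\<lambda>x y. Re (h2_pairing x y)) (homog_part (c 0) \<xi>) (homog_part (lc 0) \<xi>)"
      by (rule perturbation_data_branch[OF \<rho> U _ eig mean lc[OF U(2)] c[OF U(2)]])
        (auto simp: branch_mean_def)
    show "homog_part (lc 0) \<xi> m = 0" if "odd m" for m
      by (rule even_homog_part_odd[OF lc[OF U(2)] lambda1_even that])
  qed
  moreover have "mi_pd \<beta> (lambda1 A \<rho>) 0 = mi_fact \<beta> * lc 0 \<beta> \<and>
          H1_norm (mi_H2_pd \<beta> \<phi> 0) \<le> mi_fact \<beta> * norm (c 0 \<beta>)" for \<beta>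
  proof
    show "mi_pd \<beta> (lambda1 A \<rho>) 0 = mi_fact \<beta> * lc 0 \<beta>"
      using foldr_pd_at_center[OF U(1) lc U(2), of "mi_list \<beta>"] by (simp add: mi_pd_def mi_count_mi_list)
    have phi: "\<phi> x \<in> H2_per" if "x \<in> U" for x using eig[OF that] by (simp add: eigenfunction_def)
    have "mi_H2_pd \<beta> \<phi> 0 \<in> H2_per \<and> abs_h2 (mi_H2_pd \<beta> \<phi> 0) = mi_fact \<beta> *\<^sub>R c 0 \<beta>"
      using foldr_H2_pd[OF U(1) phi c U(2), of "mi_list \<beta>"] foldr_pd_at_center[OF U(1) c U(2), of "mi_list \<beta>"]
      by (simp add: mi_H2_pd_def mi_count_mi_list)
    then have "H2_norm (mi_H2_pd \<beta> \<phi> 0) = mi_fact \<beta> * norm (c 0 \<beta>)"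
      using norm_abs_h2[of "mi_H2_pd \<beta> \<phi> 0"] mi_fact_pos[of \<beta>] by simp
    then show "H1_norm (mi_H2_pd \<beta> \<phi> 0) \<le> mi_fact \<beta> * norm (c 0 \<beta>)"
      using H1_norm_le_H2_norm[of "mi_H2_pd \<beta> \<phi> 0"] by simp
  qed
  ultimately show ?thesis by blast
qed

lemma branch_coeffs_bounds:
  fixes \<beta> :: "nat ^ 'd::finite"
  shows "\<exists>C\<ge>0. \<forall>\<rho> lc c. branch_coeffs A \<rho> lc c \<longrightarrow>
      norm (c \<beta>) \<le> C * (if mi_size \<beta> \<in> {1..3} then 1 / \<rho>\<^sup>2 else 1)"
    and "\<exists>C\<ge>0. \<forall>\<rho> lc c. branch_coeffs A \<rho> lc c \<longrightarrow>
      \<bar>lc \<beta>\<bar> \<le> C * (if mi_size \<beta> = 4 then \<rho>\<^sup>2 else 1)"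
    and "branch_coeffs A \<rho> lc c \<Longrightarrow> odd (mi_size \<beta>) \<Longrightarrow> lc \<beta> = 0"
proof -
  let ?m = "mi_size \<beta>"
  have line: "\<exists>C\<ge>0. \<forall>\<rho> lc c. branch_coeffs A \<rho> lc c \<longrightarrow>
      norm (homog_part c \<xi> ?m) \<le> C * (if ?m \<in> {1..3} then 1 / \<rho>\<^sup>2 else 1) \<and>
      \<bar>homog_part lc \<xi> ?m\<bar> \<le> C * (if ?m = 4 then \<rho>\<^sup>2 else 1)" for \<xi>
    using coeff_bounds[where 'h="'d h2" and m="?m"
        and K="coefficients.data_const (SOME M. coefficients A M) (branch_mean CARD('d)) \<xi>"]
    unfolding branch_coeffs_def by meson
  have "\<exists>C\<ge>0. \<forall>\<rho> c. (\<exists>lc. branch_coeffs A \<rho> lc c) \<longrightarrow>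
      norm (c \<beta>) \<le> C * (if ?m \<in> {1..3} then 1 / \<rho>\<^sup>2 else 1)"
    by (rule coeff_bound_from_lines) (use line in meson)
  then show "\<exists>C\<ge>0. \<forall>\<rho> lc c. branch_coeffs A \<rho> lc c \<longrightarrow>
      norm (c \<beta>) \<le> C * (if ?m \<in> {1..3} then 1 / \<rho>\<^sup>2 else 1)" by meson
  have "\<exists>C\<ge>0. \<forall>\<rho> lc. (\<exists>c. branch_coeffs A \<rho> lc c) \<longrightarrow>
      norm (lc \<beta>) \<le> C * (if ?m = 4 then \<rho>\<^sup>2 else 1)"
    by (rule coeff_bound_from_lines) (use line in \<open>simp only: real_norm_def, meson\<close>)
  then show "\<exists>C\<ge>0. \<forall>\<rho> lc c. branch_coeffs A \<rho> lc c \<longrightarrow>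
      \<bar>lc \<beta>\<bar> \<le> C * (if ?m = 4 then \<rho>\<^sup>2 else 1)" unfolding real_norm_def by meson
  assume br: "branch_coeffs A \<rho> lc c" and odd: "odd ?m"
  obtain w X where w: "\<forall>c :: nat ^ 'd \<Rightarrow> real. c \<beta> = (\<Sum>\<xi>\<in>X. w \<xi> *\<^sub>R homog_part c \<xi> ?m)"
    using coeff_from_homog_part[where 'a=real, of \<beta>] by auto
  have "lc \<beta> = (\<Sum>\<xi>\<in>X. w \<xi> *\<^sub>R homog_part lc \<xi> ?m)" using w by blast
  also have "\<dots> = 0" using br odd by (simp add: branch_coeffs_def)
  finally show "lc \<beta> = 0" .
qed

context coefficients
begin

definition mean_entry :: "'d \<Rightarrow> 'd \<Rightarrow> real" where
  "mean_entry j k = mean (\<lambda>y. A y $ j $ k)"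

lemma integral_entry:
  "(LINT y|cellM. complex_of_real (A y $ j $ k)) = of_real (vol TYPE('d) * mean_entry j k)"
  using vol_pos[where 'd='d] by (simp add: mean_entry_def mean_def vol_def)

lemma h2_form_2_const:
  "h2_form \<rho> \<xi> 2 (h2_const k) (h2_const k)
     = k\<^sup>2 * vol TYPE('d) * homog_part (quad_coeff mean_entry) \<xi> 2"
proof -
  have "form_coeff \<rho> \<xi> 2 (\<lambda>_. complex_of_real k) (\<lambda>_. complex_of_real k)
      = of_real (k\<^sup>2 * (\<Sum>a\<in>UNIV. \<Sum>b\<in>UNIV. \<xi> $ a * \<xi> $ b * (vol TYPE('d) * mean_entry a b)))"
    unfolding form_coeff_2_const integral_entry by simp
  then show ?thesis
    unfolding h2_form_const_const homog_part_quad_coeff by (simp add: sum_distrib_left mult_ac)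
qed

end

text \<open>On a line the left-hand side becomes \<open>l 2\<close> minus the mean of
  \<open>A \<xi> \<cdot> \<xi>\<close>, which by \<open>second_eigenvalue_coeff\<close> is bounded by
  \<open>p 1\<close>, hence of size \<open>1 / \<rho>\<^sup>2\<close>.\<close>

lemma second_order_bound:
  fixes A :: "real ^ 'd::finite \<Rightarrow> real ^ 'd ^ 'd" and \<beta> :: "nat ^ 'd"
  assumes A: "coefficient_matrix A" and \<beta>: "mi_size \<beta> = 2"
  shows "\<exists>C\<ge>0. \<forall>\<rho> lc c. branch_coeffs A \<rho> lc c \<longrightarrow>
      \<bar>lc \<beta> - quad_coeff (\<lambda>j k. mean (\<lambda>y. A y $ j $ k)) \<beta>\<bar> \<le> C * (1 / \<rho>\<^sup>2)"
proof -
  define M where "M = (SOME M. coefficients A M)"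
  have "coefficients A M"
    unfolding M_def using coefficient_matrix_imp_coefficients[OF A] by (rule someI_ex)
  then interpret coefficients A M .
  define k where "k = branch_mean CARD('d)"
  have k: "k > 0" by (simp add: k_def branch_mean_def)
  define V where "V = vol TYPE('d)"
  have V: "V > 0" unfolding V_def by (rule vol_pos)
  let ?q = "quad_coeff mean_entry"
  have q: "quad_coeff (\<lambda>j k. mean (\<lambda>y. A y $ j $ k)) = ?q"
    unfolding mean_entry_def[abs_def] ..
  have "\<exists>C\<ge>0. \<forall>\<rho> d. (\<exists>lc c. branch_coeffs A \<rho> lc c \<and> d = (\<lambda>\<beta>. lc \<beta> - ?q \<beta>)) \<longrightarrow>
      norm (d \<beta>) \<le> C * (1 / \<rho>\<^sup>2)"
  proof (rule coeff_bound_from_lines)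
    fix \<xi> :: "real ^ 'd"
    let ?K = "data_const k \<xi>"
    obtain C where C: "C \<ge> 0" "\<And>\<rho> (Z :: 'd h2 set) e b L p l. perturbation_data ?K \<rho> Z e b L p l \<Longrightarrow>
         norm (p 1) \<le> C * (1 / \<rho>\<^sup>2)"
      using coeff_bounds[where 'h="'d h2" and m=1 and K="?K"] by auto
    have "norm (homog_part d \<xi> (mi_size \<beta>)) \<le> (?K * C / (k\<^sup>2 * V)) * (1 / \<rho>\<^sup>2)"
      if d: "\<exists>lc c. branch_coeffs A \<rho> lc c \<and> d = (\<lambda>\<beta>. lc \<beta> - ?q \<beta>)" for \<rho> d
    proof -
      obtain lc c where br: "branch_coeffs A \<rho> lc c" and d: "d = (\<lambda>\<beta>. lc \<beta> - ?q \<beta>)" using d by blast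
      have data: "perturbation_data ?K \<rho> zero_mean (h2_const k) (h2_form \<rho> \<xi>) (\<lambda>x y. Re (h2_pairing x y))
        (homog_part c \<xi>) (homog_part lc \<xi>)"
        using br unfolding branch_coeffs_def M_def[symmetric] k_def by blast
      interpret perturbation_data ?K \<rho> zero_mean "h2_const k" "h2_form \<rho> \<xi>" "\<lambda>x y. Re (h2_pairing x y)"
        "homog_part c \<xi>" "homog_part lc \<xi>" by (rule data)
      have e: "Re (h2_pairing (h2_const k) (h2_const k :: 'd h2)) = k\<^sup>2 * V"
        by (simp add: pairing_const fc_h2_const V_def power2_eq_square)
      have "\<bar>homog_part lc \<xi> 2 * (k\<^sup>2 * V) - k\<^sup>2 * V * homog_part ?q \<xi> 2\<bar> \<le> ?K * norm (homog_part c \<xi> 1)"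
        using second_eigenvalue_coeff unfolding e h2_form_2_const V_def .
      also have "\<dots> \<le> ?K * (C * (1 / \<rho>\<^sup>2))" by (intro mult_left_mono C(2)[OF data] K)
      finally have "\<bar>(k\<^sup>2 * V) * homog_part d \<xi> 2\<bar> \<le> ?K * (C * (1 / \<rho>\<^sup>2))"
        unfolding d homog_part_diff by (simp add: algebra_simps)
      then have "(k\<^sup>2 * V) * \<bar>homog_part d \<xi> 2\<bar> \<le> ?K * (C * (1 / \<rho>\<^sup>2))"
        using k V by (simp add: abs_mult)
      then have "\<bar>homog_part d \<xi> 2\<bar> \<le> ?K * (C * (1 / \<rho>\<^sup>2)) / (k\<^sup>2 * V)"
        using k V by (subst pos_le_divide_eq) (simp_all add: mult.commute)
      then show ?thesis by (simp add: \<beta> mult_ac)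
    qed
    moreover have "?K * C / (k\<^sup>2 * V) \<ge> 0" using data_const_ge(1) C k V by simp
    ultimately show "\<exists>C\<ge>0. \<forall>\<rho> d. (\<exists>lc c. branch_coeffs A \<rho> lc c \<and> d = (\<lambda>\<beta>. lc \<beta> - ?q \<beta>)) \<longrightarrow>
      norm (homog_part d \<xi> (mi_size \<beta>)) \<le> C * (1 / \<rho>\<^sup>2)" by blast
  qed
  then obtain C where C: "C \<ge> 0" "\<And>\<rho> d. (\<exists>lc c. branch_coeffs A \<rho> lc c \<and> d = (\<lambda>\<beta>. lc \<beta> - ?q \<beta>)) \<Longrightarrow>
      norm (d \<beta>) \<le> C * (1 / \<rho>\<^sup>2)" by blast
  show ?thesis unfolding q
  proof (intro exI[of _ C] conjI allI impI C(1))
    fix \<rho> lc c assume "branch_coeffs A \<rho> lc c"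
    then show "\<bar>lc \<beta> - ?q \<beta>\<bar> \<le> C * (1 / \<rho>\<^sup>2)" using C(2)[of \<rho> "\<lambda>\<beta>. lc \<beta> - ?q \<beta>"] by auto
  qed
qed

lemma axis_entry: "axis j 1 \<bullet> (B *v axis k 1) = B $ j $ k" for B :: "real ^ 'd ^ 'd"
  by (simp add: inner_axis' matrix_vector_mult_basis column_def)

lemma mean_entry_sym:
  fixes A :: "real ^ 'd::finite \<Rightarrow> real ^ 'd ^ 'd"
  assumes "coefficient_matrix A"
  shows "mean (\<lambda>y. A y $ j $ k) = mean (\<lambda>y. A y $ k $ j)"
proof -
  have "AE y in lebesgue. transpose (A y) = A y" using assms by (simp add: coefficient_matrix_def)
  then have "AE y in cellM. transpose (A y) = A y" by (rule AE_cellM)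
  then have "AE y in cellM. A y $ j $ k = A y $ k $ j"
  proof eventually_elim
    case (elim y)
    have "A y $ j $ k = transpose (A y) $ k $ j" by (simp add: transpose_def)
    then show ?case unfolding elim .
  qed
  moreover have "(\<lambda>y. A y $ i $ j) \<in> borel_measurable cellM" for i j
    using assms by (intro measurable_restrict_space1) (simp add: coefficient_matrix_def)
  ultimately have "(LINT y|cellM. A y $ j $ k) = (LINT y|cellM. A y $ k $ j)"
    by (intro integral_cong_AE) auto
  then show ?thesis by (simp add: mean_def)
qed

theorem theorem6p5:
  fixes A :: "real ^ 'd::{finite,linorder}
                 \<Rightarrow> real ^ 'd::{finite,linorder} ^ 'd::{finite,linorder}"
  assumes "coefficient_matrix A"
  shows "(\<forall>j. \<exists>C. \<forall>\<rho>\<ge>1. \<forall>\<phi>. ground_branch A \<rho> \<phi> \<longrightarrow>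
            H1_norm (mi_H2_pd (axis j 1) \<phi> 0) \<le> C / \<rho>\<^sup>2 \<and>
            mi_pd (axis j 1) (lambda1 A \<rho>) 0 = 0)
       \<and> (\<forall>j k. \<exists>C. \<forall>\<rho>\<ge>1. \<forall>\<phi>. ground_branch A \<rho> \<phi> \<longrightarrow>
            H1_norm (mi_H2_pd (axis j 1 + axis k 1) \<phi> 0) \<le> C / \<rho>\<^sup>2 \<and>
            \<bar>mi_pd (axis j 1 + axis k 1) (lambda1 A \<rho>) 0
               - 2 * mean (\<lambda>y. axis j 1 \<bullet> (A y *v axis k 1))\<bar> \<le> C / \<rho>\<^sup>2)
       \<and> (\<forall>j k l. \<exists>C. \<forall>\<rho>\<ge>1. \<forall>\<phi>. ground_branch A \<rho> \<phi> \<longrightarrow>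
            H1_norm (mi_H2_pd (axis j 1 + axis k 1 + axis l 1) \<phi> 0) \<le> C / \<rho>\<^sup>2 \<and>
            mi_pd (axis j 1 + axis k 1 + axis l 1) (lambda1 A \<rho>) 0 = 0)
       \<and> (\<forall>\<beta>. mi_size \<beta> \<ge> 4 \<longrightarrow> (\<exists>C. \<forall>\<rho>\<ge>1. \<forall>\<phi>. ground_branch A \<rho> \<phi> \<longrightarrow>
            H1_norm (mi_H2_pd \<beta> \<phi> 0) \<le> C))
       \<and> (\<forall>\<beta>. mi_size \<beta> = 4 \<longrightarrow> (\<exists>C. \<forall>\<rho>\<ge>1. \<forall>\<phi>. ground_branch A \<rho> \<phi> \<longrightarrow>
            \<bar>mi_pd \<beta> (lambda1 A \<rho>) 0\<bar> \<le> C * \<rho>\<^sup>2))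
       \<and> (\<forall>\<beta>. mi_size \<beta> > 4 \<longrightarrow> (\<exists>C. \<forall>\<rho>\<ge>1. \<forall>\<phi>. ground_branch A \<rho> \<phi> \<longrightarrow>
            \<bar>mi_pd \<beta> (lambda1 A \<rho>) 0\<bar> \<le> C))"
proof -
  note fact = mi_fact_pos[THEN less_imp_le]
  have H1: "\<exists>C. \<forall>\<rho>\<ge>1. \<forall>\<phi>. ground_branch A \<rho> \<phi> \<longrightarrow>
      H1_norm (mi_H2_pd \<beta> \<phi> 0) \<le> C * (if mi_size \<beta> \<in> {1..3} then 1 / \<rho>\<^sup>2 else 1)" for \<beta> :: "nat ^ 'd::{finite,linorder}"
  proof -
    obtain C where C: "\<And>\<rho> lc c. branch_coeffs A \<rho> lc c \<Longrightarrow>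
        norm (c \<beta>) \<le> C * (if mi_size \<beta> \<in> {1..3} then 1 / \<rho>\<^sup>2 else 1)"
      using branch_coeffs_bounds(1)[of A \<beta>] by auto
    have "H1_norm (mi_H2_pd \<beta> \<phi> 0) \<le> (mi_fact \<beta> * C) * (if mi_size \<beta> \<in> {1..3} then 1 / \<rho>\<^sup>2 else 1)"
      if h: "\<rho> \<ge> 1" "ground_branch A \<rho> \<phi>" for \<rho> \<phi>
    proof -
      obtain lc c where br: "branch_coeffs A \<rho> lc c"
        and le: "H1_norm (mi_H2_pd \<beta> \<phi> 0) \<le> mi_fact \<beta> * norm (c \<beta>)"
        using ground_branch_coeffs[OF assms h] by blast
      show ?thesis
        unfolding mult.assoc using le mult_left_mono[OF C[OF br] fact[of \<beta>]] by (rule order_trans)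
    qed
    then show ?thesis by blast
  qed
  have l: "\<exists>C. \<forall>\<rho>\<ge>1. \<forall>\<phi>. ground_branch A \<rho> \<phi> \<longrightarrow>
      \<bar>mi_pd \<beta> (lambda1 A \<rho>) 0\<bar> \<le> C * (if mi_size \<beta> = 4 then \<rho>\<^sup>2 else 1)" for \<beta> :: "nat ^ 'd::{finite,linorder}"
  proof -
    obtain C where C: "\<And>\<rho> lc (c :: nat ^ 'd::{finite,linorder} \<Rightarrow> 'd h2). branch_coeffs A \<rho> lc c \<Longrightarrow>
        \<bar>lc \<beta>\<bar> \<le> C * (if mi_size \<beta> = 4 then \<rho>\<^sup>2 else 1)"
      using branch_coeffs_bounds(2)[of A \<beta>] by auto
    have "\<bar>mi_pd \<beta> (lambda1 A \<rho>) 0\<bar> \<le> (mi_fact \<beta> * C) * (if mi_size \<beta> = 4 then \<rho>\<^sup>2 else 1)"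
      if h: "\<rho> \<ge> 1" "ground_branch A \<rho> \<phi>" for \<rho> \<phi>
    proof -
      obtain lc c where br: "branch_coeffs A \<rho> lc c"
        and eq: "mi_pd \<beta> (lambda1 A \<rho>) 0 = mi_fact \<beta> * lc \<beta>"
        using ground_branch_coeffs[OF assms h] by blast
      show ?thesis
        using mult_left_mono[OF C[OF br] fact[of \<beta>]] fact[of \<beta>]
        unfolding eq abs_mult by (simp only: mult.assoc abs_of_nonneg)
    qed
    then show ?thesis by blast
  qed
  have odd: "mi_pd \<beta> (lambda1 A \<rho>) 0 = 0"
    if h: "\<rho> \<ge> 1" "ground_branch A \<rho> \<phi>" "odd (mi_size \<beta>)" for \<rho> \<phi> and \<beta> :: "nat ^ 'd::{finite,linorder}"
  proof -
    obtain lc c where br: "branch_coeffs A \<rho> lc c"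
      and eq: "mi_pd \<beta> (lambda1 A \<rho>) 0 = mi_fact \<beta> * lc \<beta>"
      using ground_branch_coeffs[OF assms h(1,2)] by blast
    show ?thesis unfolding eq using branch_coeffs_bounds(3)[OF br h(3)] by simp
  qed
  have second: "\<exists>C. \<forall>\<rho>\<ge>1. \<forall>\<phi>. ground_branch A \<rho> \<phi> \<longrightarrow>
      \<bar>mi_pd (axis j 1 + axis k 1) (lambda1 A \<rho>) 0
               - 2 * mean (\<lambda>y. axis j 1 \<bullet> (A y *v axis k 1))\<bar> \<le> C / \<rho>\<^sup>2" for j k
  proof -
    let ?\<beta> = "axis j 1 + axis k 1 :: nat ^ 'd::{finite,linorder}"
    let ?m = "\<lambda>j k. mean (\<lambda>y. A y $ j $ k)"
    have size: "mi_size ?\<beta> = 2" unfolding mi_size_add mi_size_axis by simp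
    have q: "mi_fact ?\<beta> * quad_coeff ?m ?\<beta> = 2 * ?m j k"
      by (rule quad_coeff_axis) (rule mean_entry_sym[OF assms])
    obtain C where C: "\<And>\<rho> lc (c :: nat ^ 'd::{finite,linorder} \<Rightarrow> 'd h2). branch_coeffs A \<rho> lc c \<Longrightarrow>
        \<bar>lc ?\<beta> - quad_coeff ?m ?\<beta>\<bar> \<le> C * (1 / \<rho>\<^sup>2)"
      using second_order_bound[OF assms size] by blast
    have "\<bar>mi_pd ?\<beta> (lambda1 A \<rho>) 0 - 2 * ?m j k\<bar> \<le> (mi_fact ?\<beta> * C) / \<rho>\<^sup>2"
      if h: "\<rho> \<ge> 1" "ground_branch A \<rho> \<phi>" for \<rho> \<phi>
    proof -
      obtain lc c where br: "branch_coeffs A \<rho> lc c"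
        and eq: "mi_pd ?\<beta> (lambda1 A \<rho>) 0 = mi_fact ?\<beta> * lc ?\<beta>"
        using ground_branch_coeffs[OF assms h] by blast
      have "\<bar>mi_pd ?\<beta> (lambda1 A \<rho>) 0 - 2 * ?m j k\<bar> = mi_fact ?\<beta> * \<bar>lc ?\<beta> - quad_coeff ?m ?\<beta>\<bar>"
        unfolding eq q[symmetric] right_diff_distrib[symmetric] abs_mult abs_of_nonneg[OF fact] ..
      also have "\<dots> \<le> mi_fact ?\<beta> * (C * (1 / \<rho>\<^sup>2))" by (intro mult_left_mono C[OF br] fact)
      finally show ?thesis by (simp only: mult.assoc times_divide_eq_right mult_1_right)
    qed
    then show ?thesis unfolding axis_entry by blast
  qed
  show ?thesis
  proof (intro conjI allI impI)
    fix j
    let ?\<beta> = "axis j 1 :: nat ^ 'd::{finite,linorder}"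
    have size: "mi_size ?\<beta> = 1" by (rule mi_size_axis)
    obtain C where C: "\<forall>\<rho>\<ge>1. \<forall>\<phi>. ground_branch A \<rho> \<phi> \<longrightarrow>
      H1_norm (mi_H2_pd ?\<beta> \<phi> 0) \<le> C * (if mi_size ?\<beta> \<in> {1..3} then 1 / \<rho>\<^sup>2 else 1)" using H1 by blast
    show "\<exists>C. \<forall>\<rho>\<ge>1. \<forall>\<phi>. ground_branch A \<rho> \<phi> \<longrightarrow>
            H1_norm (mi_H2_pd ?\<beta> \<phi> 0) \<le> C / \<rho>\<^sup>2 \<and> mi_pd ?\<beta> (lambda1 A \<rho>) 0 = 0"
      using C odd[of _ _ ?\<beta>] unfolding size by (intro exI[of _ C]) auto
  next
    fix j k
    let ?\<beta> = "axis j 1 + axis k 1 :: nat ^ 'd::{finite,linorder}"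
    have size: "mi_size ?\<beta> = 2" unfolding mi_size_add mi_size_axis by simp
    obtain C where C: "\<forall>\<rho>\<ge>1. \<forall>\<phi>. ground_branch A \<rho> \<phi> \<longrightarrow>
      H1_norm (mi_H2_pd ?\<beta> \<phi> 0) \<le> C * (if mi_size ?\<beta> \<in> {1..3} then 1 / \<rho>\<^sup>2 else 1)" using H1 by blast
    obtain C' where C': "\<forall>\<rho>\<ge>1. \<forall>\<phi>. ground_branch A \<rho> \<phi> \<longrightarrow>
      \<bar>mi_pd ?\<beta> (lambda1 A \<rho>) 0 - 2 * mean (\<lambda>y. axis j 1 \<bullet> (A y *v axis k 1))\<bar> \<le> C' / \<rho>\<^sup>2"
      using second by blast
    have le: "C / \<rho>\<^sup>2 \<le> max C C' / \<rho>\<^sup>2" "C' / \<rho>\<^sup>2 \<le> max C C' / \<rho>\<^sup>2" for \<rho> :: real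
      by (auto intro: divide_right_mono)
    show "\<exists>C. \<forall>\<rho>\<ge>1. \<forall>\<phi>. ground_branch A \<rho> \<phi> \<longrightarrow>
            H1_norm (mi_H2_pd ?\<beta> \<phi> 0) \<le> C / \<rho>\<^sup>2 \<and>
            \<bar>mi_pd ?\<beta> (lambda1 A \<rho>) 0 - 2 * mean (\<lambda>y. axis j 1 \<bullet> (A y *v axis k 1))\<bar> \<le> C / \<rho>\<^sup>2"
    proof (intro exI[of _ "max C C'"] allI impI conjI)
      fix \<rho> :: real and \<phi> assume h: "1 \<le> \<rho>" "ground_branch A \<rho> \<phi>"
      have "H1_norm (mi_H2_pd ?\<beta> \<phi> 0) \<le> C / \<rho>\<^sup>2" using C h unfolding size by auto
      then show "H1_norm (mi_H2_pd ?\<beta> \<phi> 0) \<le> max C C' / \<rho>\<^sup>2" using le(1) by (rule order_trans)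
      have "\<bar>mi_pd ?\<beta> (lambda1 A \<rho>) 0 - 2 * mean (\<lambda>y. axis j 1 \<bullet> (A y *v axis k 1))\<bar> \<le> C' / \<rho>\<^sup>2"
        using C' h by blast
      then show "\<bar>mi_pd ?\<beta> (lambda1 A \<rho>) 0 - 2 * mean (\<lambda>y. axis j 1 \<bullet> (A y *v axis k 1))\<bar> \<le> max C C' / \<rho>\<^sup>2"
        using le(2) by (rule order_trans)
    qed
  next
    fix j k l
    let ?\<beta> = "axis j 1 + axis k 1 + axis l 1 :: nat ^ 'd::{finite,linorder}"
    have size: "mi_size ?\<beta> = 3" unfolding mi_size_add mi_size_axis by simp
    obtain C where C: "\<forall>\<rho>\<ge>1. \<forall>\<phi>. ground_branch A \<rho> \<phi> \<longrightarrow>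
      H1_norm (mi_H2_pd ?\<beta> \<phi> 0) \<le> C * (if mi_size ?\<beta> \<in> {1..3} then 1 / \<rho>\<^sup>2 else 1)" using H1 by blast
    show "\<exists>C. \<forall>\<rho>\<ge>1. \<forall>\<phi>. ground_branch A \<rho> \<phi> \<longrightarrow>
            H1_norm (mi_H2_pd ?\<beta> \<phi> 0) \<le> C / \<rho>\<^sup>2 \<and> mi_pd ?\<beta> (lambda1 A \<rho>) 0 = 0"
      using C odd[of _ _ ?\<beta>] unfolding size by (intro exI[of _ C]) auto
  next
    fix \<beta> :: "nat ^ 'd::{finite,linorder}" assume "4 \<le> mi_size \<beta>"
    then show "\<exists>C. \<forall>\<rho>\<ge>1. \<forall>\<phi>. ground_branch A \<rho> \<phi> \<longrightarrow> H1_norm (mi_H2_pd \<beta> \<phi> 0) \<le> C"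
      using H1[of \<beta>] by auto
  next
    fix \<beta> :: "nat ^ 'd::{finite,linorder}" assume "mi_size \<beta> = 4"
    then show "\<exists>C. \<forall>\<rho>\<ge>1. \<forall>\<phi>. ground_branch A \<rho> \<phi> \<longrightarrow> \<bar>mi_pd \<beta> (lambda1 A \<rho>) 0\<bar> \<le> C * \<rho>\<^sup>2"
      using l[of \<beta>] by simp
  next
    fix \<beta> :: "nat ^ 'd::{finite,linorder}" assume "4 < mi_size \<beta>"
    then show "\<exists>C. \<forall>\<rho>\<ge>1. \<forall>\<phi>. ground_branch A \<rho> \<phi> \<longrightarrow> \<bar>mi_pd \<beta> (lambda1 A \<rho>) 0\<bar> \<le> C"
      using l[of \<beta>] by simp
  qed
qed

end
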